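(* For every $T>0$ the attainable set $\mathcal A^{\mathrm{sing}}_{q_0}(T)\subset\mathbb R^5$ is semi-algebraic.
   Context: Let $M=\mathbb R^5$ with coordinates $(x,y,z,v,w)$, $q_0=\mathrm{Id}=0$, $X_1=\partial_x-\frac y2\partial_z-\frac{x^2+y^2}{2}\partial_w$, $X_2=\partial_y+\frac x2\partial_z+\frac{x^2+y^2}{2}\partial_v$ (left-invariant fields on the Cartan group). Consider $\dot q=u_1X_1(q)+u_2X_2(q)$ with $u=(u_1,u_2)$ measurable, $\max(|u_1|,|u_2|)\le1$, $q(0)=q_0$. For $T>0$, $\mathcal A^{\mathrm{sing}}_{q_0}(T)$ denotes the set of endpoints $q(T)$ of trajectories on $[0,T]$ starting at $q_0$ whose control satisfies $u_i(t)\equiv1$ or $u_i(t)\equiv-1$ (for a.e. $t\in[0,T]$) for some $i\in\{1,2\}$. *)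

theory Defs
  imports "HOL-Analysis.Analysis"
begin

(* The smallest Boolean algebra of sets containing all sets {x. p x > 0}, p polynomial.
   On a Euclidean space, real_polynomial_function holds of exactly the polynomials in the
   coordinates: it is generated by the linear functionals and the constants. *)
inductive semialgebraic :: "'a::euclidean_space set \<Rightarrow> bool" where
  pos: "real_polynomial_function p \<Longrightarrow> semialgebraic {x. p x > 0}"
| union: "semialgebraic A \<Longrightarrow> semialgebraic B \<Longrightarrow> semialgebraic (A \<union> B)"
| inter: "semialgebraic A \<Longrightarrow> semialgebraic B \<Longrightarrow> semialgebraic (A \<inter> B)"
| compl: "semialgebraic A \<Longrightarrow> semialgebraic (- A)"

(* Absolute continuity of a curve. D ranges over the finite families of nonoverlapping
   compact subintervals k = {Inf k..Sup k} of {a..b}. *)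
definition abs_continuous_on_interval ::
    "real \<Rightarrow> real \<Rightarrow> (real \<Rightarrow> 'a::real_normed_vector) \<Rightarrow> bool" where
  "abs_continuous_on_interval a b f \<longleftrightarrow>
     (\<forall>\<epsilon>>0. \<exists>\<delta>>0. \<forall>D. D division_of \<Union>D \<longrightarrow> \<Union>D \<subseteq> {a..b} \<longrightarrow>
        (\<Sum>k\<in>D. Sup k - Inf k) < \<delta> \<longrightarrow> (\<Sum>k\<in>D. norm (f (Sup k) - f (Inf k))) < \<epsilon>)"

(* The coordinates (x, y, z, v, w) of a point are its components 1, ..., 5,
   and axis i 1 is the corresponding coordinate vector field. *)
definition X1 :: "real ^ 5 \<Rightarrow> real ^ 5" where
  "X1 q = axis 1 1 - (q $ 2 / 2) *\<^sub>R axis 3 1 - (((q $ 1)\<^sup>2 + (q $ 2)\<^sup>2) / 2) *\<^sub>R axis 5 1"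

definition X2 :: "real ^ 5 \<Rightarrow> real ^ 5" where
  "X2 q = axis 2 1 + (q $ 1 / 2) *\<^sub>R axis 3 1 + (((q $ 1)\<^sup>2 + (q $ 2)\<^sup>2) / 2) *\<^sub>R axis 4 1"

definition admissible_control :: "real \<Rightarrow> (real \<Rightarrow> real ^ 2) \<Rightarrow> bool" where
  "admissible_control T u \<longleftrightarrow>
     u \<in> borel_measurable (lebesgue_on {0..T}) \<and>
     (\<forall>t\<in>{0..T}. max \<bar>u t $ 1\<bar> \<bar>u t $ 2\<bar> \<le> 1)"

(* Caratheodory solutions: the control is only measurable, so the equation is required
   almost everywhere. *)
definition trajectory :: "real \<Rightarrow> (real \<Rightarrow> real ^ 2) \<Rightarrow> (real \<Rightarrow> real ^ 5) \<Rightarrow> bool" where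
  "trajectory T u q \<longleftrightarrow>
     q 0 = 0 \<and> abs_continuous_on_interval 0 T q \<and>
     (AE t in lebesgue_on {0..T}.
        (q has_vector_derivative (u t $ 1) *\<^sub>R X1 (q t) + (u t $ 2) *\<^sub>R X2 (q t))
          (at t within {0..T}))"

definition singular_control :: "real \<Rightarrow> (real \<Rightarrow> real ^ 2) \<Rightarrow> bool" where
  "singular_control T u \<longleftrightarrow>
     (\<exists>i. (AE t in lebesgue_on {0..T}. u t $ i = 1) \<or>
          (AE t in lebesgue_on {0..T}. u t $ i = -1))"

definition attainable_sing :: "real \<Rightarrow> (real ^ 5) set" where
  "attainable_sing T =
     {q T | q u. admissible_control T u \<and> singular_control T u \<and> trajectory T u q}"

end

theory Submission
  imports Defs
begin

text \<open>For a singular control one of \<open>x\<close>, \<open>y\<close> is \<open>\<plusminus>t\<close> and the other one is a 1-Lipschitz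
  function \<open>f\<close>; the endpoint is a polynomial in \<open>f T\<close>, \<open>A = \<integral>f\<close>, \<open>B = \<integral>t f\<close> and \<open>C = \<integral>f\<^sup>2\<close>. For
  given values of \<open>f T\<close>, \<open>A\<close> and \<open>B\<close> the admissible \<open>f\<close> form a convex set, so \<open>C\<close> ranges over an
  interval. Its lower end is attained by a line clamped between the extremal curves, and from above
  \<open>C\<close> is dominated by a zigzag with at most eight pieces: as long as there are more, a zigzag can be
  shortened without changing \<open>f T\<close>, \<open>A\<close> and \<open>B\<close> and without decreasing \<open>C\<close>. Hence it suffices to know
  the moments of polygonal curves with a bounded number of pieces, which form a semialgebraic set
  by the Tarski-Seidenberg theorem.

  That theorem is proved by the method of Cohen and Hoermander: the arrangement of the signs of a
  family of polynomials along the line is determined by that of a family in which a polynomial of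
  maximal degree is replaced by its derivative and by remainders.\<close>

text \<open>The two ends of the interval for \<open>C\<close> need opposite constructions because
  \<open>C\<close> is a convex functional of \<open>f\<close>. Maximising it drives the slope of
  \<open>f\<close> to \<plusminus>1, which suggests zigzags; but zigzags close to a given curve have
  more and more teeth, so their number must be bounded before a limit can be taken. The bound is a
  dimension count: five teeth leave three movable levels, the values of \<open>A\<close> and
  \<open>B\<close> confine these to a circle, and a maximiser of \<open>C\<close> on the admissible
  part of that circle has two teeth that merge. Four teeth are eight segments. Minimising
  \<open>C\<close> is a problem with two linear constraints, whose unconstrained stationary points
  are lines; clamping brings in five lines in all, whose crossings bound the number of segments by
  26.

  The moments of an arbitrary curve need not be polygonal with these bounds; they only lie between
  two such states. A convex combination of the two polygonal curves then realises the same moments.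
  It is differentiable off a finite set, so that a measurable control can be read off from it
  without differentiating arbitrary Lipschitz functions.\<close>

section \<open>The sign behaviour of univariate polynomials\<close>

text \<open>The pairs in \<open>\<rho>\<close> are read as corresponding breakpoints on two lines.
  Matched points are corresponding breakpoints or lie in corresponding gaps. A relation avoids
  sorted lists of roots and their indices.\<close>

definition matched :: "(real \<times> real) set \<Rightarrow> real \<Rightarrow> real \<Rightarrow> bool" where
  "matched \<rho> t t' \<longleftrightarrow> (\<forall>(a, b)\<in>\<rho>. (a < t \<longleftrightarrow> b < t') \<and> (a = t \<longleftrightarrow> b = t'))"

text \<open>The graph of an order isomorphism between two finite sets of reals.\<close>

definition order_rel :: "(real \<times> real) set \<Rightarrow> bool" where
  "order_rel \<rho> \<longleftrightarrow> finite \<rho> \<and> (\<forall>(a, b)\<in>\<rho>. matched \<rho> a b)"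

text \<open>All points of one gap are matched with the same points, so for an
  \<open>order_rel\<close> this includes that every polynomial keeps its sign on each gap.\<close>

definition sgn_agree :: "(real poly \<times> real poly) set \<Rightarrow> (real \<times> real) set \<Rightarrow> bool" where
  "sgn_agree P \<rho> \<longleftrightarrow>
     (\<forall>(g, g')\<in>P. \<forall>t t'. matched \<rho> t t' \<longrightarrow> sgn (poly g t) = sgn (poly g' t'))"

lemma matchedD:
  assumes "matched \<rho> t t'" "(a, b) \<in> \<rho>"
  shows "a < t \<longleftrightarrow> b < t'" "a = t \<longleftrightarrow> b = t'" "t < a \<longleftrightarrow> t' < b"
  using assms unfolding matched_def by (force, force, force)

lemma matched_converse [simp]: "matched (\<rho>\<inverse>) t' t \<longleftrightarrow> matched \<rho> t t'"
  unfolding matched_def by auto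

lemma order_rel_converse [simp]: "order_rel (\<rho>\<inverse>) \<longleftrightarrow> order_rel \<rho>"
  unfolding order_rel_def case_prod_beta by force


lemma sgn_agreeD:
  "sgn_agree P \<rho> \<Longrightarrow> (g, g') \<in> P \<Longrightarrow> matched \<rho> t t' \<Longrightarrow> sgn (poly g t) = sgn (poly g' t')"
  unfolding sgn_agree_def by blast

lemma finite_separate:
  fixes L U :: "real set"
  assumes "finite L" "finite U" "\<And>a b. a \<in> L \<Longrightarrow> b \<in> U \<Longrightarrow> a < b"
  shows "\<exists>t. (\<forall>a\<in>L. a < t) \<and> (\<forall>b\<in>U. t < b)"
proof (cases "L = {}")
  case True
  show ?thesis
  proof (cases "U = {}")
    case False
    have "Min U - 1 < b" if "b \<in> U" for b
      using Min_le[OF assms(2) that] by linarith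
    then show ?thesis using True by auto
  qed (use True in auto)
next
  case False
  show ?thesis
  proof (cases "U = {}")
    case True
    have "a < Max L + 1" if "a \<in> L" for a
      using Max_ge[OF assms(1) that] by linarith
    then show ?thesis using True by auto
  next
    case U: False
    have "Max L < Min U"
      using False U assms by simp
    then obtain t where t: "Max L < t" "t < Min U"
      using dense by blast
    have "a < t" if "a \<in> L" for a
      using Max_ge[OF assms(1) that] t by linarith
    moreover have "t < b" if "b \<in> U" for b
      using Min_le[OF assms(2) that] t by linarith
    ultimately show ?thesis by blast
  qed
qed

lemma matched_exists:
  assumes "order_rel \<rho>"
  shows "\<exists>t'. matched \<rho> t t'"
proof (cases "\<exists>b. (t, b) \<in> \<rho>")
  case True
  then show ?thesis using assms unfolding order_rel_def by blast
next
  case False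
  define L where "L = snd ` {p\<in>\<rho>. fst p < t}"
  define U where "U = snd ` {p\<in>\<rho>. t < fst p}"
  have fin: "finite L" "finite U"
    using assms unfolding L_def U_def order_rel_def by auto
  have "a < b" if ab: "a \<in> L" "b \<in> U" for a b
  proof -
    obtain a1 b1 where *: "(a1, a) \<in> \<rho>" "a1 < t" "(b1, b) \<in> \<rho>" "t < b1"
      using ab unfolding L_def U_def by auto
    moreover have "matched \<rho> b1 b"
      using * assms unfolding order_rel_def by blast
    ultimately show "a < b"
      using matchedD(1)[of \<rho> b1 b a1 a] by auto
  qed
  then obtain t' where t': "\<forall>a\<in>L. a < t'" "\<forall>b\<in>U. t' < b"
    using finite_separate[OF fin] by blast
  have "matched \<rho> t t'"
    unfolding matched_def
  proof clarify
    fix a b assume ab: "(a, b) \<in> \<rho>"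
    have "a \<noteq> t" using False ab by blast
    then consider "a < t" | "t < a" by linarith
    then show "(a < t \<longleftrightarrow> b < t') \<and> (a = t \<longleftrightarrow> b = t')"
    proof cases
      case 1
      then have "b \<in> L" using ab unfolding L_def by force
      then show ?thesis using t' 1 by force
    next
      case 2
      then have "b \<in> U" using ab unfolding U_def by force
      then show ?thesis using t' 2 by force
    qed
  qed
  then show ?thesis ..
qed

lemma matched_exists':
  assumes "order_rel \<rho>"
  shows "\<exists>t. matched \<rho> t t'"
  using matched_exists[of "\<rho>\<inverse>" t'] assms by simp

text \<open>If \<open>s\<close> were not a breakpoint, a whole interval to the right of
  \<open>s\<close> would be matched with \<open>s'\<close>, and \<open>g\<close> would vanish on
  it.\<close>

lemma root_mem_order_rel:
  assumes fin: "finite \<rho>" and ag: "sgn_agree {(g, g')} \<rho>" and g: "g \<noteq> 0"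
    and m: "matched \<rho> s s'" and root: "poly g s = 0"
  shows "(s, s') \<in> \<rho>"
proof (cases "\<exists>b. (s, b) \<in> \<rho>")
  case True
  then show ?thesis using matchedD(2)[OF m] by blast
next
  case False
  have "finite (fst ` \<rho>)" using fin by simp
  then obtain e where e: "e > 0" "\<And>a. a \<in> fst ` \<rho> \<Longrightarrow> a \<noteq> s \<Longrightarrow> e \<le> dist s a"
    using finite_set_avoid[of "fst ` \<rho>" s] by blast
  have "poly g u = 0" if u: "s < u" "u < s + e" for u
  proof -
    have "matched \<rho> u s'"
      unfolding matched_def
    proof clarify
      fix a b assume ab: "(a, b) \<in> \<rho>"
      then have "a \<noteq> s" using False by blast
      moreover have "e \<le> dist s a"
        using ab \<open>a \<noteq> s\<close> e(2) by force
      ultimately have "(a < u \<longleftrightarrow> a < s) \<and> a \<noteq> u"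
        using u by (auto simp: dist_real_def)
      then show "(a < u \<longleftrightarrow> b < s') \<and> (a = u \<longleftrightarrow> b = s')"
        using matchedD[OF m ab] \<open>a \<noteq> s\<close> by simp
    qed
    then have "sgn (poly g u) = sgn (poly g s)"
      using sgn_agreeD[OF ag _ m] sgn_agreeD[OF ag, of g g' u s'] by simp
    then show ?thesis using root by (simp add: sgn_zero_iff)
  qed
  then have "{s<..<s+e} \<subseteq> {u. poly g u = 0}" by auto
  then have "finite {s<..<s+e}"
    using poly_roots_finite[OF g] finite_subset by blast
  then show ?thesis using e(1) by (simp add: infinite_Ioo)
qed

lemma sgn_agree_mono: "sgn_agree P \<rho> \<Longrightarrow> Q \<subseteq> P \<Longrightarrow> sgn_agree Q \<rho>"
  unfolding sgn_agree_def by blast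

lemma poly_sgn_eq_between:
  fixes p :: "real poly"
  assumes "sgn (poly p a) \<noteq> sgn (poly p b)"
  shows "\<exists>s. min a b \<le> s \<and> s \<le> max a b \<and> poly p s = 0"
proof (rule ccontr)
  assume "\<not> ?thesis"
  then have no: "\<And>s. min a b \<le> s \<Longrightarrow> s \<le> max a b \<Longrightarrow> poly p s \<noteq> 0" by blast
  have "poly p a \<noteq> 0" "poly p b \<noteq> 0" "a \<noteq> b"
    using no[of a] no[of b] assms by auto
  then have "poly p a * poly p b < 0"
    using assms by (auto simp: sgn_if mult_less_0_iff split: if_splits)
  then show False
    using poly_IVT[of a b p] poly_IVT[of b a p] no \<open>a \<noteq> b\<close>
    by (cases "a < b") (force simp: mult.commute)+
qed

text \<open>Breakpoints that are no roots separate nothing: a sign change of \<open>g'\<close>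
  inside a cell of \<open>\<rho>0\<close> would give a root of \<open>g'\<close> there, and the pair
  of that root survives in \<open>\<rho>0\<close>. Afterwards the sign of a new polynomial has to be
  known at roots of the family only.\<close>

lemma sgn_agree_restrict:
  assumes ord: "order_rel \<rho>" and ag: "sgn_agree P \<rho>"
    and \<rho>0: "\<rho>0 = {(a, b) \<in> \<rho>. \<exists>(g, g')\<in>P. g \<noteq> 0 \<and> poly g a = 0}"
  shows "sgn_agree P \<rho>0"
  unfolding sgn_agree_def
proof clarify
  fix g g' t t' assume gP: "(g, g') \<in> P" and m: "matched \<rho>0 t t'"
  obtain t2 where t2: "matched \<rho> t t2"
    using matched_exists[OF ord] by blast
  have m2: "matched \<rho>0 t t2"
    using t2 \<rho>0 unfolding matched_def by auto
  have "sgn (poly g' t2) = sgn (poly g' t')"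
  proof (rule ccontr)
    assume ne: "sgn (poly g' t2) \<noteq> sgn (poly g' t')"
    then obtain s' where s': "min t2 t' \<le> s'" "s' \<le> max t2 t'" "poly g' s' = 0"
      using poly_sgn_eq_between by blast
    obtain s where s: "matched \<rho> s s'" using matched_exists'[OF ord] by blast
    have root: "poly g s = 0"
      using sgn_agreeD[OF ag gP s] s'(3) by (simp add: sgn_zero_iff)
    have "g \<noteq> 0"
    proof
      assume "g = 0"
      then have "poly g' u = 0" for u
        using sgn_agreeD[OF ag gP] matched_exists'[OF ord, of u] by (force simp: sgn_zero_iff)
      then show False using ne by simp
    qed
    have "(s, s') \<in> \<rho>"
      using root_mem_order_rel[OF _ _ \<open>g \<noteq> 0\<close> s root] sgn_agree_mono[OF ag] gP ord
      unfolding order_rel_def by blast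
    then have "(s, s') \<in> \<rho>0"
      using \<rho>0 gP root \<open>g \<noteq> 0\<close> by blast
    then have "s' < t2 \<longleftrightarrow> s' < t'" "s' = t2 \<longleftrightarrow> s' = t'"
      using matchedD[OF m] matchedD[OF m2] by blast+
    then have "t2 = t'" using s'(1,2) by (auto simp: min_def max_def split: if_splits)
    then show False using ne by simp
  qed
  then show "sgn (poly g t) = sgn (poly g' t')"
    using sgn_agreeD[OF ag gP t2] by simp
qed

text \<open>A nonconstant polynomial is unbounded in absolute value towards minus infinity; as it
  increases up to \<open>t\<close>, it must become negative there. This replaces the missing
  breakpoint of the leftmost gap.\<close>

lemma poly_root_on_ray:
  fixes q :: "real poly"
  assumes pos: "\<And>u. u \<le> t \<Longrightarrow> poly (pderiv q) u > 0" and t: "poly q t \<ge> 0"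
  shows "\<exists>r\<le>t. poly q r = 0"
proof -
  have "degree q \<noteq> 0"
  proof
    assume "degree q = 0"
    then have "pderiv q = 0" by (simp add: pderiv_eq_0_iff)
    then show False using pos[of t] by simp
  qed
  then have "filterlim (poly q) at_infinity at_infinity"
    by (intro filterlim_poly_at_infinity) auto
  then have "eventually (\<lambda>u. norm (poly q u) \<ge> poly q t + 1) at_infinity"
    unfolding filterlim_at_infinity[OF order_refl]
    by (elim allE[of _ "max 1 (poly q t + 1)"]) (auto elim: eventually_mono)
  then obtain b where b: "\<And>u. norm u \<ge> b \<Longrightarrow> norm (poly q u) \<ge> poly q t + 1"
    unfolding eventually_at_infinity by blast
  define u where "u = - (\<bar>b\<bar> + \<bar>t\<bar> + 1)"
  have u: "u < t" "norm u \<ge> b" unfolding u_def by auto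
  have "poly q u < poly q t"
  proof (rule DERIV_pos_imp_increasing[OF u(1)])
    fix x assume "u \<le> x" "x \<le> t"
    then show "\<exists>y. (poly q has_real_derivative y) (at x) \<and> 0 < y"
      using pos poly_DERIV by blast
  qed
  then have "poly q u < 0" using b[OF u(2)] t by auto
  then have "\<exists>r. u \<le> r \<and> r \<le> t \<and> poly q r = 0"
    using t u(1) by (intro IVT) auto
  then show ?thesis by blast
qed

text \<open>Both polynomials increase on their gaps. At the left breakpoint \<open>p\<close> is
  smaller than at \<open>t\<close>, hence negative; so is \<open>p'\<close> by \<open>S\<close>, and
  \<open>p'\<close> has to cross zero before \<open>t'\<close>.\<close>

lemma matched_root_below:
  assumes ord: "order_rel \<rho>" and ag: "sgn_agree {(pderiv p, pderiv p')} \<rho>"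
    and S: "\<And>a b. (a, b) \<in> \<rho> \<Longrightarrow> sgn (poly p a) = sgn (poly p' b)"
    and m: "matched \<rho> t t'" and nd: "t \<notin> fst ` \<rho>"
    and le: "poly p t \<le> 0" "0 \<le> poly p' t'" and d: "poly (pderiv p) t > 0"
  shows "\<exists>r'\<le>t'. matched \<rho> t r' \<and> poly p' r' = 0"
proof -
  have d': "poly (pderiv p') u' > 0" if "matched \<rho> t u'" for u'
    using sgn_agreeD[OF ag _ that] d by (auto simp: sgn_if split: if_splits)
  have d2: "poly (pderiv p) u > 0" if "matched \<rho> u t'" for u
    using sgn_agreeD[OF ag _ that] d'[OF m] by (auto simp: sgn_if split: if_splits)
  have ne: "a \<noteq> t" if "(a, b) \<in> \<rho>" for a b using nd that by force
  show ?thesis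
  proof (cases "\<exists>(a, b)\<in>\<rho>. a < t")
    case False
    have M: "matched \<rho> t u'" if "u' \<le> t'" for u'
      unfolding matched_def
    proof clarify
      fix a b assume ab: "(a, b) \<in> \<rho>"
      then have "t < a" using False ne[OF ab] by force
      then show "(a < t \<longleftrightarrow> b < u') \<and> (a = t \<longleftrightarrow> b = u')"
        using matchedD[OF m ab] that by auto
    qed
    then show ?thesis
      using poly_root_on_ray[of t' p'] d' le(2) by blast
  next
    case True
    define L where "L = {a\<in>fst ` \<rho>. a < t}"
    have fin: "finite L" "L \<noteq> {}"
      using True ord unfolding L_def order_rel_def by force+
    define l where "l = Max L"
    have "l \<in> L" unfolding l_def using fin by simp
    then obtain l' where l: "(l, l') \<in> \<rho>" "l < t" unfolding L_def by force
    have lmax: "a \<le> l" if "(a, b) \<in> \<rho>" "a < t" for a b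
      unfolding l_def using that fin by (intro Max_ge) (force simp: L_def)+
    have l't: "l' < t'" using matchedD[OF m l(1)] l(2) by simp
    have M: "matched \<rho> t u'" if "l' < u'" "u' \<le> t'" for u'
      unfolding matched_def
    proof clarify
      fix a b assume ab: "(a, b) \<in> \<rho>"
      have "b \<le> l'" if "a < t"
        using lmax[OF ab that] matchedD[of \<rho> l l' a b] ord ab l(1)
        unfolding order_rel_def by fastforce
      then show "(a < t \<longleftrightarrow> b < u') \<and> (a = t \<longleftrightarrow> b = u')"
        using matchedD[OF m ab] that ne[OF ab] by fastforce
    qed
    have M2: "matched \<rho> u t'" if "l < u" "u \<le> t" for u
      unfolding matched_def
    proof clarify
      fix a b assume ab: "(a, b) \<in> \<rho>"
      have "a < t \<Longrightarrow> a \<le> l"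
        using lmax[OF ab] by simp
      then show "(a < u \<longleftrightarrow> b < t') \<and> (a = u \<longleftrightarrow> b = t')"
        using matchedD[OF m ab] that ne[OF ab] by fastforce
    qed
    have "poly p l < poly p t"
    proof (rule DERIV_pos_imp_increasing_open[OF l(2)])
      fix x assume "l < x" "x < t"
      then show "\<exists>y. (poly p has_real_derivative y) (at x) \<and> 0 < y"
        using d2[OF M2, of x] poly_DERIV[of p x] by (intro exI[of _ "poly (pderiv p) x"]) auto
    qed (intro continuous_intros)
    then have "poly p' l' < 0"
      using S[OF l(1)] le(1) by (auto simp: sgn_if split: if_splits)
    then have "\<exists>r. l' \<le> r \<and> r \<le> t' \<and> poly p' r = 0"
      using le(2) l't by (intro IVT) auto
    then obtain r where r: "l' \<le> r" "r \<le> t'" "poly p' r = 0" by blast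
    then have "l' < r" using \<open>poly p' l' < 0\<close> by (cases "l' = r") auto
    then show ?thesis using M r by blast
  qed
qed

text \<open>Point reflection of the graph at the origin, not reversal of the coefficients. It
  exchanges left and right and keeps the sign of the derivative, so it reduces
  \<open>matched_root_above\<close> to \<open>matched_root_below\<close>.\<close>

definition reflect_poly :: "real poly \<Rightarrow> real poly" where
  "reflect_poly p = - (p \<circ>\<^sub>p [:0, -1:])"

lemma poly_reflect [simp]: "poly (reflect_poly p) t = - poly p (- t)"
  by (simp add: reflect_poly_def poly_pcompose)

lemma poly_pderiv_reflect [simp]: "poly (pderiv (reflect_poly p)) t = poly (pderiv p) (- t)"
  by (simp add: reflect_poly_def pderiv_minus pderiv_pcompose poly_pcompose pderiv_pCons)

lemma matched_root_above:
  assumes ord: "order_rel \<rho>" and ag: "sgn_agree {(pderiv p, pderiv p')} \<rho>"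
    and S: "\<And>a b. (a, b) \<in> \<rho> \<Longrightarrow> sgn (poly p a) = sgn (poly p' b)"
    and m: "matched \<rho> t t'" and nd: "t \<notin> fst ` \<rho>"
    and le: "poly p t \<le> 0" "0 \<le> poly p' t'" and d: "poly (pderiv p) t > 0"
  shows "\<exists>r\<ge>t. matched \<rho> r t' \<and> poly p r = 0"
proof -
  \<comment> \<open>Reflection reverses both inequalities in \<open>le\<close>; exchanging the two
    lines as well restores them.\<close>
  define \<sigma> where "\<sigma> = (\<lambda>(a, b). (- b, - a)) ` \<rho>"
  have M: "matched \<sigma> (- u') (- u) \<longleftrightarrow> matched \<rho> u u'" for u u'
    unfolding matched_def \<sigma>_def by fastforce
  have "order_rel \<sigma>"
    using ord M unfolding order_rel_def by (force simp: \<sigma>_def)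
  moreover have "sgn_agree {(pderiv (reflect_poly p'), pderiv (reflect_poly p))} \<sigma>"
    unfolding sgn_agree_def
  proof clarsimp
    fix s s' assume "matched \<sigma> s s'"
    then have "matched \<rho> (- s') (- s)" using M[of "- s" "- s'"] by simp
    then show "sgn (poly (pderiv p') (- s)) = sgn (poly (pderiv p) (- s'))"
      using sgn_agreeD[OF ag] by simp
  qed
  moreover have "sgn (poly (reflect_poly p') a) = sgn (poly (reflect_poly p) b)"
    if "(a, b) \<in> \<sigma>" for a b
  proof -
    have "(- b, - a) \<in> \<rho>" using that unfolding \<sigma>_def by auto
    then show ?thesis using S by (simp add: sgn_minus)
  qed
  moreover have "- t' \<notin> fst ` \<sigma>"
    using nd matchedD(2)[OF m] by (force simp: \<sigma>_def)
  moreover have "poly (pderiv p') t' > 0"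
    using sgn_agreeD[OF ag _ m] d by (auto simp: sgn_if split: if_splits)
  ultimately have "\<exists>r\<le>- t. matched \<sigma> (- t') r \<and> poly (reflect_poly p) r = 0"
    using m M[of t' t] le
    by (intro matched_root_below[of \<sigma> "reflect_poly p'" "reflect_poly p" "- t'" "- t"]) (auto simp: M)
  then obtain r where "r \<le> - t" "matched \<sigma> (- t') r" "poly p (- r) = 0" by auto
  then show ?thesis
    using M[of t' "- r"] by (intro exI[of _ "- r"]) auto
qed

text \<open>There are roots \<open>r \<ge> t\<close> of \<open>p\<close> and
  \<open>r' \<le> t'\<close> of \<open>p'\<close> in corresponding positions. By \<open>N\<close>
  they lie on the same side of \<open>t\<close> and \<open>t'\<close>, which is possible only for
  \<open>r = t\<close> and \<open>r' = t'\<close>.\<close>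

lemma matched_no_sign_change:
  assumes ord: "order_rel \<rho>" and ag: "sgn_agree {(pderiv p, pderiv p')} \<rho>"
    and S: "\<And>a b. (a, b) \<in> \<rho> \<Longrightarrow> sgn (poly p a) = sgn (poly p' b)"
    and m: "matched \<rho> t t'" and nd: "t \<notin> fst ` \<rho>"
    and N: "\<And>r r'. matched \<rho> r r' \<Longrightarrow> poly p r = 0 \<Longrightarrow> poly p' r' = 0 \<Longrightarrow>
              (r < t \<longleftrightarrow> r' < t') \<and> (r = t \<longleftrightarrow> r' = t')"
    and le: "poly p t \<le> 0" "0 \<le> poly p' t'" and d: "poly (pderiv p) t > 0"
  shows "poly p t = 0 \<and> poly p' t' = 0"
proof -
  obtain r' where r': "r' \<le> t'" "matched \<rho> t r'" "poly p' r' = 0"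
    using matched_root_below[OF ord ag S m nd le d] by blast
  obtain r where r: "t \<le> r" "matched \<rho> r t'" "poly p r = 0"
    using matched_root_above[OF ord ag S m nd le d] by blast
  have "matched \<rho> r r'"
    using r(2) r'(2) m unfolding matched_def by fastforce
  then have "r = t" "r' = t'"
    using N[of r r'] r r' by auto
  then show ?thesis using r r' by blast
qed

lemma sgn_agree_uminus: "sgn_agree {(pderiv (- p), pderiv (- p'))} \<rho> \<longleftrightarrow> sgn_agree {(pderiv p, pderiv p')} \<rho>"
  by (simp add: sgn_agree_def pderiv_minus sgn_minus)

text \<open>Up to exchanging the two lines and negating both polynomials, different signs are the
  situation of \<open>matched_no_sign_change\<close>.\<close>

lemma matched_sgn_eq:
  assumes ord: "order_rel \<rho>" and ag: "sgn_agree {(pderiv p, pderiv p')} \<rho>"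
    and S: "\<And>a b. (a, b) \<in> \<rho> \<Longrightarrow> sgn (poly p a) = sgn (poly p' b)"
    and m: "matched \<rho> t t'" and nd: "t \<notin> fst ` \<rho>"
    and N: "\<And>r r'. matched \<rho> r r' \<Longrightarrow> poly p r = 0 \<Longrightarrow> poly p' r' = 0 \<Longrightarrow>
              (r < t \<longleftrightarrow> r' < t') \<and> (r = t \<longleftrightarrow> r' = t')"
    and d: "poly (pderiv p) t \<noteq> 0"
  shows "sgn (poly p t) = sgn (poly p' t')"
proof -
  have pos: "sgn (poly p t) = sgn (poly p' t')"
    if ag: "sgn_agree {(pderiv p, pderiv p')} \<rho>"
    and S: "\<And>a b. (a, b) \<in> \<rho> \<Longrightarrow> sgn (poly p a) = sgn (poly p' b)"
    and N: "\<And>r r'. matched \<rho> r r' \<Longrightarrow> poly p r = 0 \<Longrightarrow> poly p' r' = 0 \<Longrightarrow>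
              (r < t \<longleftrightarrow> r' < t') \<and> (r = t \<longleftrightarrow> r' = t')"
    and d: "poly (pderiv p) t > 0" for p p' :: "real poly"
  proof -
    consider "poly p t \<le> 0" "0 \<le> poly p' t'" | "poly p' t' \<le> 0" "0 \<le> poly p t"
      | "sgn (poly p t) = sgn (poly p' t')"
      by (cases "poly p t" "0::real" rule: linorder_cases;
          cases "poly p' t'" "0::real" rule: linorder_cases) auto
    then show ?thesis
    proof cases
      case 1
      then have "poly p t = 0 \<and> poly p' t' = 0"
        using S N d by (intro matched_no_sign_change[OF ord ag _ m nd]) blast+
      then show ?thesis by simp
    next
      case 2
      have "t' \<notin> fst ` (\<rho>\<inverse>)" using nd matchedD(2)[OF m] by force
      moreover have "sgn_agree {(pderiv p', pderiv p)} (\<rho>\<inverse>)"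
        using ag unfolding sgn_agree_def by simp
      moreover have "poly (pderiv p') t' > 0"
        using sgn_agreeD[OF ag _ m] d by (auto simp: sgn_if split: if_splits)
      ultimately have "poly p' t' = 0 \<and> poly p t = 0"
        using ord S m N 2 by (intro matched_no_sign_change[of "\<rho>\<inverse>"]) auto
      then show ?thesis by simp
    qed
  qed
  show ?thesis
  proof (cases "poly (pderiv p) t > 0")
    case True
    then show ?thesis using pos[OF ag S N] by blast
  next
    case False
    then have "poly (pderiv (- p)) t > 0" using d by (simp add: pderiv_minus)
    moreover have "sgn (poly (- p) a) = sgn (poly (- p') b)" if "(a, b) \<in> \<rho>" for a b
      using S[OF that] by (simp add: sgn_minus)
    ultimately have "sgn (poly (- p) t) = sgn (poly (- p') t')"
      using N by (intro pos) (auto simp: sgn_agree_uminus ag)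
    then show ?thesis by (simp add: sgn_minus)
  qed
qed

text \<open>The induction step of the method. All roots of the derivative are breakpoints, so
  \<open>p\<close> is monotone on each gap, and its signs at the breakpoints together with its
  growth at infinity decide which gaps contain a root. \<open>H\<close> provides these signs at
  roots of the family, which is why all other breakpoints are discarded first.\<close>

lemma extend_order_rel:
  assumes ord: "order_rel \<rho>" and ag: "sgn_agree (insert (pderiv p, pderiv p') P) \<rho>"
    and nz: "pderiv p \<noteq> 0" "pderiv p' \<noteq> 0"
    and H: "\<And>g g' a b. (g, g') \<in> insert (pderiv p, pderiv p') P \<Longrightarrow> g \<noteq> 0 \<Longrightarrow> (a, b) \<in> \<rho> \<Longrightarrow>
              poly g a = 0 \<Longrightarrow> poly g' b = 0 \<Longrightarrow> sgn (poly p a) = sgn (poly p' b)"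
  shows "\<exists>\<sigma>. order_rel \<sigma> \<and> sgn_agree (insert (p, p') P) \<sigma>"
proof -
  let ?P = "insert (pderiv p, pderiv p') P"
  define \<tau> where "\<tau> = {(a, b) \<in> \<rho>. \<exists>(g, g')\<in>?P. g \<noteq> 0 \<and> poly g a = 0}"
  have agt: "sgn_agree ?P \<tau>"
    using sgn_agree_restrict[OF ord ag \<tau>_def] .
  have ordt: "order_rel \<tau>"
    using ord unfolding order_rel_def \<tau>_def matched_def
    by (auto intro: finite_subset[of _ \<rho>])
  have S: "sgn (poly p a) = sgn (poly p' b)" if ab: "(a, b) \<in> \<tau>" for a b
  proof -
    obtain g g' where g: "(g, g') \<in> ?P" "g \<noteq> 0" "poly g a = 0" "(a, b) \<in> \<rho>"
      using ab unfolding \<tau>_def by blast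
    have "matched \<tau> a b" using ordt ab unfolding order_rel_def by blast
    then have "poly g' b = 0"
      using sgn_agreeD[OF agt g(1)] g(3) by (force simp: sgn_zero_iff)
    then show ?thesis using H[OF g(1,2,4,3)] by blast
  qed
  have ag1: "sgn_agree {(pderiv p, pderiv p')} \<tau>"
    using sgn_agree_mono[OF agt] by blast
  have ag1': "sgn_agree {(pderiv p', pderiv p)} (\<tau>\<inverse>)"
    using ag1 unfolding sgn_agree_def by simp
  \<comment> \<open>New breakpoints are the pairs of roots of \<open>p\<close> and \<open>p'\<close>
    in corresponding cells.\<close>
  define \<sigma> where "\<sigma> = \<tau> \<union> {(r, r'). matched \<tau> r r' \<and> poly p r = 0 \<and> poly p' r' = 0}"
  have "p \<noteq> 0" "p' \<noteq> 0" using nz by auto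
  then have "finite ({r. poly p r = 0} \<times> {r. poly p' r = 0})"
    using poly_roots_finite by blast
  then have "finite \<sigma>"
    using ordt unfolding \<sigma>_def order_rel_def
    by (auto elim: finite_subset[rotated])
  \<comment> \<open>Two roots of \<open>p\<close> enclose a root of the derivative, hence a
    breakpoint. So a gap receives at most one new pair, and the new pairs are ordered alike on both
    lines.\<close>
  have rolle: "r' < s'"
    if "order_rel \<tau>" and ag: "sgn_agree {(pderiv p, pderiv p')} \<tau>" and "pderiv p \<noteq> 0"
    and r: "matched \<tau> r r'" "poly p r = 0" and s: "matched \<tau> s s'" "poly p s = 0" and "r < s"
    for p p' r r' s s' \<tau>
  proof -
    obtain c where c: "r < c" "c < s" "poly (pderiv p) c = 0"
      using poly_MVT[OF \<open>r < s\<close>, of p] r s by auto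
    obtain c' where m: "matched \<tau> c c'" using matched_exists[OF \<open>order_rel \<tau>\<close>] by blast
    then have "(c, c') \<in> \<tau>"
      using root_mem_order_rel[OF _ ag \<open>pderiv p \<noteq> 0\<close> m] c that(1) unfolding order_rel_def by blast
    then show ?thesis
      using matchedD[OF r(1)] matchedD[OF s(1)] c by (metis less_trans)
  qed
  have new: "(r < s \<longleftrightarrow> r' < s') \<and> (r = s \<longleftrightarrow> r' = s')"
    if "matched \<tau> r r'" "poly p r = 0" "poly p' r' = 0"
       "matched \<tau> s s'" "poly p s = 0" "poly p' s' = 0" for r r' s s'
    using rolle[OF ordt ag1 nz(1), of r r' s s'] rolle[OF ordt ag1 nz(1), of s s' r r']
      rolle[OF _ ag1' nz(2), of r' r s' s] rolle[OF _ ag1' nz(2), of s' s r' r] that ordt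
    by (metis order_rel_converse matched_converse linorder_neqE_linordered_idom less_asym)
  have "order_rel \<sigma>"
    unfolding order_rel_def
  proof (intro conjI ballI, fact \<open>finite \<sigma>\<close>, clarify)
    fix a b assume ab: "(a, b) \<in> \<sigma>"
    then have m: "matched \<tau> a b"
      using ordt unfolding \<sigma>_def order_rel_def by blast
    show "matched \<sigma> a b"
      unfolding matched_def
    proof clarify
      fix c d assume cd: "(c, d) \<in> \<sigma>"
      then have m': "matched \<tau> c d"
        using ordt unfolding \<sigma>_def order_rel_def by blast
      show "(c < a \<longleftrightarrow> d < b) \<and> (c = a \<longleftrightarrow> d = b)"
      proof (cases "(c, d) \<in> \<tau> \<or> (a, b) \<in> \<tau>")
        case True
        then show ?thesis using matchedD[OF m] matchedD[OF m'] by metis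
      next
        case False
        then show ?thesis using ab cd new unfolding \<sigma>_def by blast
      qed
    qed
  qed
  moreover have "sgn_agree (insert (p, p') P) \<sigma>"
    unfolding sgn_agree_def
  proof clarify
    fix g g' t t' assume g: "(g, g') \<in> insert (p, p') P" and m: "matched \<sigma> t t'"
    have mt: "matched \<tau> t t'"
      using m unfolding \<sigma>_def matched_def by blast
    show "sgn (poly g t) = sgn (poly g' t')"
    proof (cases "(g, g') \<in> P")
      case True
      then show ?thesis using sgn_agreeD[OF agt _ mt] by blast
    next
      case False
      then have gp: "g = p" "g' = p'" using g by auto
      show ?thesis
      proof (cases "(t, t') \<in> \<tau>")
        case True
        then show ?thesis using S gp by blast
      next
        case nt: False
        then have nd: "t \<notin> fst ` \<tau>" using matchedD(2)[OF mt] by force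
        have "poly (pderiv p) t \<noteq> 0"
          using root_mem_order_rel[OF _ ag1 nz(1) mt] nt ordt unfolding order_rel_def by blast
        then have "sgn (poly p t) = sgn (poly p' t')"
        proof (intro matched_sgn_eq[OF ordt ag1 S mt nd])
          fix r r' assume "matched \<tau> r r'" "poly p r = 0" "poly p' r' = 0"
          then have "(r, r') \<in> \<sigma>" unfolding \<sigma>_def by blast
          then show "(r < t \<longleftrightarrow> r' < t') \<and> (r = t \<longleftrightarrow> r' = t')"
            using matchedD[OF m] by blast
        qed auto
        then show ?thesis using gp by simp
      qed
    qed
  qed
  ultimately show ?thesis by blast
qed

section \<open>The Tarski-Seidenberg theorem\<close>

text \<open>Univariate polynomials whose coefficients are polynomials in a parameter. The number
  \<open>d\<close> is a formal degree, since the true degree varies with the parameter.\<close>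

definition poly_family :: "nat \<Rightarrow> ('a::euclidean_space \<Rightarrow> real poly) \<Rightarrow> bool" where
  "poly_family d f \<longleftrightarrow>
     (\<forall>i. real_polynomial_function (\<lambda>x. coeff (f x) i)) \<and> (\<forall>x. degree (f x) \<le> d)"

definition sgn_equiv :: "(real poly \<times> real poly) set \<Rightarrow> bool" where
  "sgn_equiv P \<longleftrightarrow> (\<exists>\<rho>. order_rel \<rho> \<and> sgn_agree P \<rho>)"

lemma poly_family_mono: "poly_family d f \<Longrightarrow> d \<le> e \<Longrightarrow> poly_family e f"
  unfolding poly_family_def using order_trans by blast

lemma poly_family_pderiv:
  assumes "poly_family (Suc d) f"
  shows "poly_family d (\<lambda>x. pderiv (f x))"
  unfolding poly_family_def
proof (intro conjI allI)
  fix i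
  have "real_polynomial_function (\<lambda>x. coeff (f x) (Suc i))"
    using assms unfolding poly_family_def by blast
  then show "real_polynomial_function (\<lambda>x. coeff (pderiv (f x)) i)"
    by (auto simp: coeff_pderiv)
next
  fix x
  have "degree (f x) \<le> Suc d" using assms unfolding poly_family_def by blast
  then show "degree (pderiv (f x)) \<le> d" by (simp add: degree_pderiv)
qed

lemma poly_family_cutoff:
  assumes "poly_family d f"
  shows "poly_family e (\<lambda>x. poly_cutoff (Suc e) (f x))"
  unfolding poly_family_def
proof (intro conjI allI)
  fix i
  have "real_polynomial_function (\<lambda>x. coeff (f x) i)"
    using assms unfolding poly_family_def by blast
  then show "real_polynomial_function (\<lambda>x. coeff (poly_cutoff (Suc e) (f x)) i)"
    by (cases "i < Suc e") (auto simp: coeff_poly_cutoff)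
next
  fix x
  show "degree (poly_cutoff (Suc e) (f x)) \<le> e"
    by (rule degree_le) (auto simp: coeff_poly_cutoff)
qed

lemma poly_cutoff_eq_self:
  assumes "\<And>i. i \<ge> n \<Longrightarrow> coeff p i = 0"
  shows "poly_cutoff n p = p"
  using assms by (auto simp: poly_eq_iff coeff_poly_cutoff)

text \<open>Multiplying by the leading coefficient of the divisor, instead of dividing by it, keeps
  all coefficients polynomial in the parameter.\<close>

lemma poly_family_pseudo_rem:
  assumes g: "poly_family (Suc e) g" and f: "poly_family m f"
  shows "\<exists>k r. poly_family e r \<and>
           (\<forall>x. \<exists>q. smult (coeff (g x) (Suc e) ^ k) (f x) = q * g x + r x)"
  using f
proof (induction m arbitrary: f)
  case 0
  then have "poly_family e f" using poly_family_mono by blast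
  then show ?case by (intro exI[of _ 0] exI[of _ f]) (auto intro: exI[of _ 0])
next
  case (Suc m)
  show ?case
  proof (cases "Suc m \<le> e")
    case True
    then have "poly_family e f" using Suc.prems poly_family_mono by blast
    then show ?thesis by (intro exI[of _ 0] exI[of _ f]) (auto intro: exI[of _ 0])
  next
    case False
    \<comment> \<open>One step of the division; the shift \<open>m - e\<close> is
      \<open>Suc m - Suc e\<close>, so the two coefficients at \<open>Suc m\<close> cancel.\<close>
    define f1 where "f1 x = smult (coeff (g x) (Suc e)) (f x)
        - monom (coeff (f x) (Suc m)) (m - e) * g x" for x
    have rp: "real_polynomial_function (\<lambda>x. coeff (f x) i)"
      "real_polynomial_function (\<lambda>x. coeff (g x) i)" for i
      using g Suc.prems unfolding poly_family_def by blast+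
    have "poly_family m f1"
      unfolding poly_family_def
    proof (intro conjI allI)
      fix i
      show "real_polynomial_function (\<lambda>x. coeff (f1 x) i)"
        by (cases "m - e \<le> i") (auto simp: f1_def coeff_monom_mult intro!: rp)
    next
      fix x
      have deg: "degree (f x) \<le> Suc m" "degree (g x) \<le> Suc e"
        using g Suc.prems unfolding poly_family_def by blast+
      show "degree (f1 x) \<le> m"
      proof (rule degree_le, intro allI impI)
        fix i assume "m < i"
        show "coeff (f1 x) i = 0"
        proof (cases "i = Suc m")
          case True
          have "Suc m - (m - e) = Suc e" using False by simp
          then show ?thesis using True by (simp add: f1_def coeff_monom_mult)
        next
          case i: False
          then have "coeff (f x) i = 0" "coeff (g x) (i - (m - e)) = 0"
            using deg \<open>m < i\<close> False by (auto intro!: coeff_eq_0)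
          then show ?thesis by (simp add: f1_def coeff_monom_mult)
        qed
      qed
    qed
    then obtain k r where kr: "poly_family e r"
      "\<And>x. \<exists>q. smult (coeff (g x) (Suc e) ^ k) (f1 x) = q * g x + r x"
      using Suc.IH by blast
    have "\<exists>q. smult (coeff (g x) (Suc e) ^ Suc k) (f x) = q * g x + r x" for x
    proof -
      obtain q where q: "smult (coeff (g x) (Suc e) ^ k) (f1 x) = q * g x + r x"
        using kr(2) by blast
      have "smult (coeff (g x) (Suc e) ^ Suc k) (f x) =
            (q + smult (coeff (g x) (Suc e) ^ k) (monom (coeff (f x) (Suc m)) (m - e))) * g x + r x"
        using q by (simp add: f1_def algebra_simps smult_diff_right)
      then show ?thesis by blast
    qed
    then show ?thesis using kr(1) by blast
  qed
qed

text \<open>The pseudo-remainders of \<open>f\<close> carry the signs of \<open>f\<close> at the roots of the other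
  polynomials. They are formed for every truncation of a divisor \<open>g\<close>, because the actual degree
  of \<open>g x\<close> depends on the parameter \<open>x\<close>.\<close>

lemma sgn_equiv_eliminate:
  fixes f :: "'a::euclidean_space \<Rightarrow> real poly"
  assumes f: "poly_family (Suc D) f" and F: "\<And>d g. (d, g) \<in> F \<Longrightarrow> d \<le> Suc D \<and> poly_family d g"
    and E: "E = insert (D, \<lambda>x. pderiv (f x)) F"
    and rem: "\<And>g e. \<exists>d. poly_family d g \<Longrightarrow> \<forall>x. \<exists>q.
          smult (coeff (poly_cutoff (Suc (Suc e)) (g x)) (Suc e) ^ kk g e) (f x)
            = q * poly_cutoff (Suc (Suc e)) (g x) + rem g e x"
    and H: "H = E \<union> (\<lambda>((d, g), e). (e, rem g e)) ` (E \<times> {..<Suc D})"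
    and sgn: "\<And>d g i. (d, g) \<in> E \<Longrightarrow> sgn (coeff (g x) i) = sgn (coeff (g x') i)"
    and lc: "coeff (f x) (Suc D) \<noteq> 0" "coeff (f x') (Suc D) \<noteq> 0"
    and eq: "sgn_equiv ((\<lambda>(d, f). (f x, f x')) ` H)"
  shows "sgn_equiv ((\<lambda>(d, f). (f x, f x')) ` insert (Suc D, f) F)"
proof -
  obtain \<rho> where ord: "order_rel \<rho>" and ag: "sgn_agree ((\<lambda>(d, f). (f x, f x')) ` H) \<rho>"
    using eq unfolding sgn_equiv_def by blast
  have famE: "d \<le> Suc D \<and> poly_family d g" if "(d, g) \<in> E" for d g
    using that E F poly_family_pderiv[OF f] by auto
  let ?P = "(\<lambda>(d, f). (f x, f x')) ` F"
  let ?E = "insert (pderiv (f x), pderiv (f x')) ?P"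
  have PE: "?E = (\<lambda>(d, f). (f x, f x')) ` E"
    unfolding E by simp
  have nz: "pderiv (f x) \<noteq> 0" "pderiv (f x') \<noteq> 0"
    using lc by (auto simp: poly_eq_iff coeff_pderiv)
  have "\<exists>\<sigma>. order_rel \<sigma> \<and> sgn_agree (insert (f x, f x') ?P) \<sigma>"
  proof (rule extend_order_rel[OF ord _ nz])
    show "sgn_agree ?E \<rho>"
      unfolding PE using ag by (rule sgn_agree_mono) (auto simp: H)
  next
    fix h h' a b
    assume h: "(h, h') \<in> ?E" "h \<noteq> 0" "(a, b) \<in> \<rho>" "poly h a = 0" "poly h' b = 0"
    then obtain d g where g: "(d, g) \<in> E" "h = g x" "h' = g x'"
      unfolding PE by auto
    have co: "sgn (coeff h i) = sgn (coeff h' i)" for i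
      using sgn[OF g(1)] g by simp
    then have co0: "coeff h i = 0 \<longleftrightarrow> coeff h' i = 0" for i
      by (metis sgn_zero_iff)
    have m: "matched \<rho> a b" using ord h(3) unfolding order_rel_def by blast
    have "degree h \<noteq> 0"
    proof
      assume "degree h = 0"
      then obtain c where "h = [:c:]" by (rule degree_eq_zeroE)
      then show False using h by simp
    qed
    then obtain e where e: "degree h = Suc e" using not0_implies_Suc by blast
    have "e < Suc D"
      using famE[OF g(1)] e g(2) unfolding poly_family_def by (metis Suc_le_lessD order_trans)
    then have re: "(e, rem g e) \<in> H" using g(1) unfolding H by force
    have cut: "poly_cutoff (Suc (Suc e)) h = h"
      by (rule poly_cutoff_eq_self) (auto simp: e intro!: coeff_eq_0)
    \<comment> \<open>The index \<open>e\<close> comes from the true degree at \<open>x\<close>;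
      since coefficients have equal signs at \<open>x\<close> and \<open>x'\<close>, it fits
      \<open>x'\<close> as well.\<close>
    have cut': "poly_cutoff (Suc (Suc e)) h' = h'"
    proof (rule poly_cutoff_eq_self)
      fix i assume "Suc (Suc e) \<le> i"
      then have "coeff h i = 0" by (auto simp: e intro!: coeff_eq_0)
      then show "coeff h' i = 0" using co0 by simp
    qed
    let ?c = "coeff h (Suc e) ^ kk g e" and ?c' = "coeff h' (Suc e) ^ kk g e"
    have ex: "\<exists>d. poly_family d g" using famE[OF g(1)] by blast
    obtain q where "smult ?c (f x) = q * h + rem g e x"
      using rem[OF ex, of e] g cut by metis
    then have "poly (smult ?c (f x)) a = poly (q * h + rem g e x) a" by simp
    then have r1: "?c * poly (f x) a = poly (rem g e x) a" using h(4) by simp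
    obtain q' where "smult ?c' (f x') = q' * h' + rem g e x'"
      using rem[OF ex, of e] g cut' by metis
    then have "poly (smult ?c' (f x')) b = poly (q' * h' + rem g e x') b" by simp
    then have r2: "?c' * poly (f x') b = poly (rem g e x') b" using h(5) by simp
    have "(rem g e x, rem g e x') \<in> (\<lambda>(d, f). (f x, f x')) ` H" using re by force
    then have "sgn (poly (rem g e x) a) = sgn (poly (rem g e x') b)"
      using sgn_agreeD[OF ag _ m] by blast
    then have "sgn (?c * poly (f x) a) = sgn (?c' * poly (f x') b)"
      unfolding r1 r2 .
    then have "sgn ?c * sgn (poly (f x) a) = sgn ?c' * sgn (poly (f x') b)"
      by (simp only: sgn_mult)
    moreover have "sgn ?c = sgn ?c'" using co by simp
    moreover have "sgn ?c \<noteq> 0"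
      using e h(2) by (metis leading_coeff_0_iff power_not_zero sgn_zero_iff)
    ultimately show "sgn (poly (f x) a) = sgn (poly (f x') b)" by (metis mult_left_cancel)
  qed
  then show ?thesis unfolding sgn_equiv_def by simp
qed

text \<open>Outer induction on the degree bound, inner induction on the number of members at that
  bound: the derivative and the remainders that replace a member may be many, but all have smaller
  formal degree. For this count the members carry their formal degrees with them.\<close>

lemma finite_sgn_invariants:
  fixes F :: "(nat \<times> ('a::euclidean_space \<Rightarrow> real poly)) set"
  assumes "finite F" "\<And>d f. (d, f) \<in> F \<Longrightarrow> d \<le> D \<and> poly_family d f"
  shows "\<exists>G. finite G \<and> (\<forall>g\<in>G. real_polynomial_function g) \<and>
           (\<forall>x x'. (\<forall>g\<in>G. sgn (g x) = sgn (g x')) \<longrightarrow> sgn_equiv ((\<lambda>(d, f). (f x, f x')) ` F))"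
  using assms
proof (induction D arbitrary: F)
  case 0
  let ?G = "(\<lambda>(d, f) x. coeff (f x) 0) ` F"
  show ?case
  proof (intro exI[of _ ?G] conjI allI impI)
    show "finite ?G" using 0(1) by simp
    show "\<forall>g\<in>?G. real_polynomial_function g" using 0(2) unfolding poly_family_def by auto
    fix x x' assume G: "\<forall>g\<in>?G. sgn (g x) = sgn (g x')"
    have "sgn (poly (f x) t) = sgn (poly (f x') t')" if "(d, f) \<in> F" for d f t t'
    proof -
      have "degree (f x) = 0" "degree (f x') = 0"
        using 0(2)[OF that] unfolding poly_family_def by auto
      moreover have "sgn (coeff (f x) 0) = sgn (coeff (f x') 0)" using G that by force
      ultimately show ?thesis by (auto elim!: degree_eq_zeroE)
    qed
    then have "sgn_agree ((\<lambda>(d, f). (f x, f x')) ` F) {}" unfolding sgn_agree_def by auto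
    moreover have "order_rel {}" unfolding order_rel_def by simp
    ultimately show "sgn_equiv ((\<lambda>(d, f). (f x, f x')) ` F)" unfolding sgn_equiv_def by blast
  qed
next
  case (Suc D)
  note IH = Suc.IH
  have "\<exists>G. finite G \<and> (\<forall>g\<in>G. real_polynomial_function g) \<and>
           (\<forall>x x'. (\<forall>g\<in>G. sgn (g x) = sgn (g x')) \<longrightarrow> sgn_equiv ((\<lambda>(d, f). (f x, f x')) ` F))"
    if "card {p\<in>F. fst p = Suc D} = n" "finite F"
       "\<And>d f. (d, f) \<in> F \<Longrightarrow> d \<le> Suc D \<and> poly_family d f"
    for n and F :: "(nat \<times> ('a \<Rightarrow> real poly)) set"
    using that
  proof (induction n arbitrary: F)
    case 0
    then have "{p\<in>F. fst p = Suc D} = {}" by simp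
    then have "d \<le> D \<and> poly_family d f" if "(d, f) \<in> F" for d f
      using 0(3)[OF that] that by (cases "d = Suc D") auto
    then show ?case using IH[of F] 0(2) by blast
  next
    case (Suc n)
    have "{p\<in>F. fst p = Suc D} \<noteq> {}"
    proof
      assume "{p\<in>F. fst p = Suc D} = {}"
      then show False using Suc.prems(1) by (metis card.empty nat.distinct(1))
    qed
    then obtain f where f: "(Suc D, f) \<in> F" by (force simp: split_paired_all)
    define F0 where "F0 = F - {(Suc D, f)}"
    have F: "F = insert (Suc D, f) F0" using f unfolding F0_def by blast
    have fin0: "finite F0" using Suc.prems(2) unfolding F0_def by simp
    have "{p\<in>F0. fst p = Suc D} = {p\<in>F. fst p = Suc D} - {(Suc D, f)}"
      unfolding F0_def by blast
    then have card0: "card {p\<in>F0. fst p = Suc D} = n"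
      using Suc.prems(1,2) f by simp
    have famf: "poly_family (Suc D) f" using Suc.prems(3) f by blast
    have fam0: "d \<le> Suc D \<and> poly_family d g" if "(d, g) \<in> F0" for d g
      using Suc.prems(3) that unfolding F0_def by blast
    \<comment> \<open>Where the top coefficient of \<open>f\<close> vanishes, \<open>f\<close>
      equals its truncation, which has smaller formal degree.\<close>
    define F1 where "F1 = insert (D, \<lambda>x. poly_cutoff (Suc D) (f x)) F0"
    have "{p\<in>F1. fst p = Suc D} = {p\<in>F0. fst p = Suc D}" unfolding F1_def by auto
    moreover have "d \<le> Suc D \<and> poly_family d g" if "(d, g) \<in> F1" for d g
      using that fam0 poly_family_cutoff[OF famf] unfolding F1_def by auto
    ultimately obtain G1 where G1: "finite G1" "\<forall>g\<in>G1. real_polynomial_function g"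
      "\<And>x x'. \<forall>g\<in>G1. sgn (g x) = sgn (g x') \<Longrightarrow> sgn_equiv ((\<lambda>(d, f). (f x, f x')) ` F1)"
      using Suc.IH[of F1] card0 fin0 F1_def by auto
    define E where "E = insert (D, \<lambda>x. pderiv (f x)) F0"
    have famE: "d \<le> Suc D \<and> poly_family d g" if "(d, g) \<in> E" for d g
      using that fam0 poly_family_pderiv[OF famf] unfolding E_def by auto
    have "\<exists>k r. (\<exists>d. poly_family d g) \<longrightarrow> poly_family e r \<and> (\<forall>x. \<exists>q.
          smult (coeff (poly_cutoff (Suc (Suc e)) (g x)) (Suc e) ^ k) (f x)
            = q * poly_cutoff (Suc (Suc e)) (g x) + r x)" for g :: "'a \<Rightarrow> real poly" and e
      using poly_family_pseudo_rem[OF poly_family_cutoff famf, of _ g e] by blast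
    then obtain kk rem where rem: "\<And>g e. (\<exists>d. poly_family d g) \<Longrightarrow> poly_family e (rem g e)"
      "\<And>g e. (\<exists>d. poly_family d g) \<Longrightarrow> \<forall>x. \<exists>q.
          smult (coeff (poly_cutoff (Suc (Suc e)) (g x)) (Suc e) ^ kk g e) (f x)
            = q * poly_cutoff (Suc (Suc e)) (g x) + rem g e x"
      by metis
    define H where "H = E \<union> (\<lambda>((d, g), e). (e, rem g e)) ` (E \<times> {..<Suc D})"
    have "{p\<in>H. fst p = Suc D} = {p\<in>F0. fst p = Suc D}" unfolding H_def E_def by auto
    moreover have "d \<le> Suc D \<and> poly_family d g" if "(d, g) \<in> H" for d g
      using that famE rem(1) unfolding H_def by fastforce
    moreover have "finite H" using fin0 unfolding H_def E_def by simp
    ultimately obtain G2 where G2: "finite G2" "\<forall>g\<in>G2. real_polynomial_function g"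
      "\<And>x x'. \<forall>g\<in>G2. sgn (g x) = sgn (g x') \<Longrightarrow> sgn_equiv ((\<lambda>(d, f). (f x, f x')) ` H)"
      using Suc.IH[of H] card0 by auto
    \<comment> \<open>The signs of the coefficients ensure that \<open>x\<close> and
      \<open>x'\<close> fall into the same case and that all divisors have the same true degree at
      both.\<close>
    define G0 where "G0 = (\<lambda>((d, g), i) x. coeff (g x) i) ` (insert (Suc D, f) E \<times> {..Suc D})"
    have fin: "finite (G0 \<union> G1 \<union> G2)" using G1 G2 fin0 unfolding G0_def E_def by simp
    have rp: "\<forall>g\<in>G0 \<union> G1 \<union> G2. real_polynomial_function g"
      using G1(2) G2(2) famE famf unfolding G0_def poly_family_def by auto
    have main: "sgn_equiv ((\<lambda>(d, f). (f x, f x')) ` F)"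
      if G: "\<forall>g\<in>G0 \<union> G1 \<union> G2. sgn (g x) = sgn (g x')" for x x'
    proof -
      have sgn: "sgn (coeff (g x) i) = sgn (coeff (g x') i)"
        if g: "(d, g) \<in> insert (Suc D, f) E" for d g i
      proof (cases "i \<le> Suc D")
        case True
        then have "(\<lambda>x. coeff (g x) i) \<in> G0" using g unfolding G0_def by force
        then show ?thesis using bspec[OF G, of "\<lambda>x. coeff (g x) i"] by simp
      next
        case False
        have "degree (g y) \<le> Suc D" for y
          using g famE famf unfolding poly_family_def by (force intro: order_trans)
        then have "coeff (g y) i = 0" for y
          using False le_less_trans[of "degree (g y)" "Suc D" i] by (intro coeff_eq_0) simp
        then show ?thesis by simp
      qed
      have sf: "sgn (coeff (f x) (Suc D)) = sgn (coeff (f x') (Suc D))" using sgn by blast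
      show ?thesis
      proof (cases "coeff (f x) (Suc D) = 0")
        case True
        then have c0: "coeff (f x) (Suc D) = 0" "coeff (f x') (Suc D) = 0"
          using sf by (auto simp: sgn_zero_iff)
        have "poly_cutoff (Suc D) (f y) = f y" if "coeff (f y) (Suc D) = 0" for y
        proof (rule poly_cutoff_eq_self)
          fix i assume "Suc D \<le> i"
          moreover have "degree (f y) \<le> Suc D" using famf unfolding poly_family_def by blast
          ultimately show "coeff (f y) i = 0"
            using that by (cases "i = Suc D") (auto intro!: coeff_eq_0)
        qed
        then have "(\<lambda>(d, f). (f x, f x')) ` F1 = (\<lambda>(d, f). (f x, f x')) ` F"
          unfolding F1_def F using c0 by simp
        then show ?thesis using G1(3)[of x x'] G by simp
      next
        case False
        then have lc': "coeff (f x') (Suc D) \<noteq> 0" using sf by (metis sgn_zero_iff)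
        have eqH: "sgn_equiv ((\<lambda>(d, f). (f x, f x')) ` H)" using G2(3)[of x x'] G by simp
        have sgnE: "sgn (coeff (g x) i) = sgn (coeff (g x') i)" if "(d, g) \<in> E" for d g i
          using sgn that by blast
        have "sgn_equiv ((\<lambda>(d, f). (f x, f x')) ` insert (Suc D, f) F0)"
          by (rule sgn_equiv_eliminate[where x = x and x' = x',
                OF famf fam0 E_def rem(2) H_def sgnE False lc' eqH]) assumption+
        then show ?thesis unfolding F .
      qed
    qed
    show ?case
      by (intro exI[of _ "G0 \<union> G1 \<union> G2"] conjI allI impI fin rp) (rule main)
  qed
  then show ?case using Suc.prems by blast
qed

section \<open>Closure properties of semialgebraic sets, up to projections and polynomial
  images\<close>

lemma semialgebraic_UNIV: "semialgebraic UNIV"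
  using semialgebraic.pos[of "\<lambda>x. 1::real"] real_polynomial_function.intros(2)[of 1] by simp

lemma semialgebraic_empty: "semialgebraic {}"
  using semialgebraic.compl[OF semialgebraic_UNIV] by simp

lemma semialgebraic_UN:
  assumes "finite I" "\<And>i. i \<in> I \<Longrightarrow> semialgebraic (A i)"
  shows "semialgebraic (\<Union>i\<in>I. A i)"
  using assms by (induction I) (auto intro: semialgebraic_empty semialgebraic.union)

lemma semialgebraic_INT:
  assumes "finite I" "\<And>i. i \<in> I \<Longrightarrow> semialgebraic (A i)"
  shows "semialgebraic (\<Inter>i\<in>I. A i)"
  using assms by (induction I) (auto intro: semialgebraic_UNIV semialgebraic.inter)

lemma semialgebraic_nonneg:
  assumes "real_polynomial_function p"
  shows "semialgebraic {x. p x \<ge> 0}"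
proof -
  have "semialgebraic (- {x. - p x > 0})"
    using assms by (intro semialgebraic.compl semialgebraic.pos) auto
  moreover have "- {x. - p x > 0} = {x. p x \<ge> 0}" by auto
  ultimately show ?thesis by simp
qed

lemma semialgebraic_eq0:
  assumes "real_polynomial_function p"
  shows "semialgebraic {x. p x = 0}"
proof -
  have "semialgebraic ({x. p x \<ge> 0} \<inter> {x. - p x \<ge> 0})"
    using assms by (intro semialgebraic.inter semialgebraic_nonneg) auto
  moreover have "{x. p x \<ge> 0} \<inter> {x. - p x \<ge> 0} = {x. p x = 0}" by auto
  ultimately show ?thesis by simp
qed

lemma semialgebraic_sgn:
  assumes "real_polynomial_function p"
  shows "semialgebraic {x. sgn (p x) = s}"
proof -
  consider "s = 1" | "s = -1" | "s = 0" | "s \<notin> {1, -1, 0}" by blast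
  then show ?thesis
  proof cases
    case 1
    then have "{x. sgn (p x) = s} = {x. p x > 0}" by (auto simp: sgn_if)
    then show ?thesis using semialgebraic.pos[OF assms] by simp
  next
    case 2
    then have "{x. sgn (p x) = s} = {x. - p x > 0}" by (auto simp: sgn_if)
    then show ?thesis using semialgebraic.pos[of "\<lambda>x. - p x"] assms by auto
  next
    case 3
    then have "{x. sgn (p x) = s} = {x. p x = 0}" by (auto simp: sgn_if)
    then show ?thesis using semialgebraic_eq0[OF assms] by simp
  next
    case 4
    then have "{x. sgn (p x) = s} = {}" by (auto simp: sgn_if)
    then show ?thesis using semialgebraic_empty by simp
  qed
qed

text \<open>Finitely many polynomials have finitely many sign vectors, and \<open>X\<close> is the
  union of the cells of those sign vectors that occur in it.\<close>

lemma semialgebraic_sgn_invariant: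
  fixes X :: "'a::euclidean_space set"
  assumes G: "finite G" "\<And>g. g \<in> G \<Longrightarrow> real_polynomial_function g"
    and inv: "\<And>x x'. \<forall>g\<in>G. sgn (g x) = sgn (g x') \<Longrightarrow> x \<in> X \<Longrightarrow> x' \<in> X"
  shows "semialgebraic X"
proof -
  define \<Sigma> where "\<Sigma> = (\<lambda>x. restrict (\<lambda>g. sgn (g x)) G) ` X"
  have "\<Sigma> \<subseteq> (\<Pi>\<^sub>E g\<in>G. {-1, 0, 1})"
    unfolding \<Sigma>_def by (auto simp: sgn_if split: if_splits)
  then have fin: "finite \<Sigma>"
    using finite_PiE[OF G(1), of "\<lambda>_. {-1, 0, 1::real}"] finite_subset by blast
  have "X = (\<Union>\<sigma>\<in>\<Sigma>. \<Inter>g\<in>G. {x. sgn (g x) = \<sigma> g})"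
  proof (intro set_eqI iffI)
    fix x assume "x \<in> X"
    then show "x \<in> (\<Union>\<sigma>\<in>\<Sigma>. \<Inter>g\<in>G. {x. sgn (g x) = \<sigma> g})"
      unfolding \<Sigma>_def by force
  next
    fix x assume "x \<in> (\<Union>\<sigma>\<in>\<Sigma>. \<Inter>g\<in>G. {x. sgn (g x) = \<sigma> g})"
    then obtain y where "y \<in> X" "\<forall>g\<in>G. sgn (g y) = sgn (g x)"
      unfolding \<Sigma>_def by force
    then show "x \<in> X" using inv by blast
  qed
  moreover have "semialgebraic (\<Union>\<sigma>\<in>\<Sigma>. \<Inter>g\<in>G. {x. sgn (g x) = \<sigma> g})"
    using fin G by (intro semialgebraic_UN semialgebraic_INT semialgebraic_sgn)
  ultimately show ?thesis by simp
qed

lemma real_polynomial_function_poly_family: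
  fixes p :: "'a::euclidean_space \<times> real \<Rightarrow> real"
  assumes "real_polynomial_function p"
  shows "\<exists>d f. poly_family d f \<and> (\<forall>x t. p (x, t) = poly (f x) t)"
  using assms
proof induction
  case (linear h)
  define f where "f x = [:h (x, 0), h (0, 1):]" for x :: 'a
  have lin: "bounded_linear (\<lambda>x. h (x, 0))"
    using bounded_linear_compose[OF linear, of "\<lambda>x. (x, 0)"]
    by (simp add: bounded_linear_Pair bounded_linear_ident bounded_linear_zero)
  have "real_polynomial_function (\<lambda>x. coeff (f x) i)" for i
  proof (cases i)
    case 0
    then show ?thesis using lin by (auto simp: f_def)
  next
    case (Suc j)
    then show ?thesis by (auto simp: f_def)
  qed
  moreover have "degree (f x) \<le> 1" for x by (simp add: f_def)
  moreover have "h (x, t) = poly (f x) t" for x t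
  proof -
    have "(x, t) = (x, 0) + t *\<^sub>R (0, 1)" by simp
    then have "h (x, t) = h (x, 0) + t *\<^sub>R h (0, 1)"
      by (metis linear bounded_linear.linear linear_add linear_scale)
    then show ?thesis by (simp add: f_def)
  qed
  ultimately show ?case unfolding poly_family_def by blast
next
  case (const c)
  have "poly_family 0 (\<lambda>x::'a. [:c:])"
    unfolding poly_family_def by (auto simp: coeff_pCons split: nat.split)
  then show ?case by fastforce
next
  case (add p q)
  then obtain d f e g where "poly_family d f" "\<forall>x t. p (x, t) = poly (f x) t"
    "poly_family e g" "\<forall>x t. q (x, t) = poly (g x) t" by blast
  moreover from this have "poly_family (max d e) (\<lambda>x. f x + g x)"
    unfolding poly_family_def by (auto intro!: degree_add_le intro: le_trans[OF _ max.cobounded1] le_trans[OF _ max.cobounded2])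
  ultimately show ?case by fastforce
next
  case (mult p q)
  then obtain d f e g where fg: "poly_family d f" "\<forall>x t. p (x, t) = poly (f x) t"
    "poly_family e g" "\<forall>x t. q (x, t) = poly (g x) t" by blast
  have "poly_family (d + e) (\<lambda>x. f x * g x)"
    unfolding poly_family_def
  proof (intro conjI allI)
    show "real_polynomial_function (\<lambda>x. coeff (f x * g x) i)" for i
      using fg(1,3) unfolding poly_family_def coeff_mult
      by (intro real_polynomial_function_sum) auto
    show "degree (f x * g x) \<le> d + e" for x
      using fg(1,3) unfolding poly_family_def
      by (meson add_mono degree_mult_le order_trans)
  qed
  then show ?case using fg by fastforce
qed

text \<open>A substitute for a disjunctive normal form: membership depends on finitely many signs.
  Complements keep the same \<open>F\<close>, unions and intersections take the union of both
  families.\<close>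

definition sgn_determined ::
    "(nat \<times> ('a::euclidean_space \<Rightarrow> real poly)) set \<Rightarrow> ('a \<times> real) set \<Rightarrow> bool" where
  "sgn_determined F S \<longleftrightarrow> finite F \<and> (\<forall>(d, f)\<in>F. poly_family d f) \<and>
     (\<forall>x t x' t'. (\<forall>(d, f)\<in>F. sgn (poly (f x) t) = sgn (poly (f x') t')) \<longrightarrow>
        ((x, t) \<in> S \<longleftrightarrow> (x', t') \<in> S))"

lemma sgn_determinedD:
  assumes "sgn_determined F S" "\<And>d f. (d, f) \<in> F \<Longrightarrow> sgn (poly (f x) t) = sgn (poly (f x') t')"
  shows "(x, t) \<in> S \<longleftrightarrow> (x', t') \<in> S"
proof -
  have "\<forall>(d, f)\<in>F. sgn (poly (f x) t) = sgn (poly (f x') t')" using assms(2) by blast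
  then show ?thesis using assms(1) unfolding sgn_determined_def by blast
qed

lemma sgn_determinedI:
  assumes "finite F" "\<And>d f. (d, f) \<in> F \<Longrightarrow> poly_family d f"
    "\<And>x t x' t'. (\<And>d f. (d, f) \<in> F \<Longrightarrow> sgn (poly (f x) t) = sgn (poly (f x') t')) \<Longrightarrow>
       (x, t) \<in> S \<longleftrightarrow> (x', t') \<in> S"
  shows "sgn_determined F S"
  unfolding sgn_determined_def
proof (intro conjI allI impI)
  show "finite F" "\<forall>(d, f)\<in>F. poly_family d f" using assms(1,2) by blast+
  fix x t x' t' assume "\<forall>(d, f)\<in>F. sgn (poly (f x) t) = sgn (poly (f x') t')"
  then show "(x, t) \<in> S \<longleftrightarrow> (x', t') \<in> S" by (intro assms(3)) blast
qed

lemma sgn_determined_Un_Int: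
  assumes FG: "sgn_determined F A" "sgn_determined G B"
  shows "sgn_determined (F \<union> G) (A \<union> B)" "sgn_determined (F \<union> G) (A \<inter> B)"
proof -
  have fam: "finite (F \<union> G)" "\<And>d f. (d, f) \<in> F \<union> G \<Longrightarrow> poly_family d f"
    using FG unfolding sgn_determined_def by blast+
  have eq: "((x, t) \<in> A \<longleftrightarrow> (x', t') \<in> A) \<and> ((x, t) \<in> B \<longleftrightarrow> (x', t') \<in> B)"
    if "\<And>d f. (d, f) \<in> F \<union> G \<Longrightarrow> sgn (poly (f x) t) = sgn (poly (f x') t')" for x t x' t'
    using sgn_determinedD[OF FG(1), of x t x' t'] sgn_determinedD[OF FG(2), of x t x' t'] that by blast
  show "sgn_determined (F \<union> G) (A \<union> B)"
    by (rule sgn_determinedI[OF fam]) (use eq in blast)+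
  show "sgn_determined (F \<union> G) (A \<inter> B)"
    by (rule sgn_determinedI[OF fam]) (use eq in blast)+
qed

lemma semialgebraic_sgn_determined:
  fixes S :: "('a::euclidean_space \<times> real) set"
  assumes "semialgebraic S"
  shows "\<exists>F. sgn_determined F S"
  using assms
proof (induction S)
  case (pos p)
  then obtain d f where f: "poly_family d f" "\<And>x t. p (x, t) = poly (f x) t"
    using real_polynomial_function_poly_family by blast
  have "sgn_determined {(d, f)} {x. p x > 0}"
  proof (rule sgn_determinedI)
    fix x t x' t'
    assume "\<And>e g. (e, g) \<in> {(d, f)} \<Longrightarrow> sgn (poly (g x) t) = sgn (poly (g x') t')"
    then have "sgn (p (x, t)) = sgn (p (x', t'))" by (simp add: f(2))
    then show "(x, t) \<in> {x. p x > 0} \<longleftrightarrow> (x', t') \<in> {x. p x > 0}"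
      by (simp add: sgn_if split: if_splits)
  qed (use f(1) in auto)
  then show ?case by blast
next
  case (union A B)
  then show ?case using sgn_determined_Un_Int(1) by blast
next
  case (inter A B)
  then show ?case using sgn_determined_Un_Int(2) by blast
next
  case (compl A)
  then show ?case unfolding sgn_determined_def by simp
qed

text \<open>If the signs of \<open>G\<close> agree at \<open>x\<close> and \<open>x'\<close>, the
  lines over these points carry corresponding arrangements, and a point matched with a witness over
  \<open>x\<close> is a witness over \<open>x'\<close>.\<close>

lemma semialgebraic_Ex_real:
  fixes S :: "('a::euclidean_space \<times> real) set"
  assumes "semialgebraic S"
  shows "semialgebraic {x. \<exists>t. (x, t) \<in> S}"
proof -
  obtain F where detF: "sgn_determined F S"
    using semialgebraic_sgn_determined[OF assms] by blast
  then have F: "finite F" "\<forall>(d, f)\<in>F. poly_family d f"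
    unfolding sgn_determined_def by blast+
  have "d \<le> Max (fst ` F) \<and> poly_family d f" if "(d, f) \<in> F" for d f
    using F(1,2) that by (force intro: Max_ge)
  then obtain G where G: "finite G" "\<forall>g\<in>G. real_polynomial_function g"
    "\<And>x x'. \<forall>g\<in>G. sgn (g x) = sgn (g x') \<Longrightarrow> sgn_equiv ((\<lambda>(d, f). (f x, f x')) ` F)"
    using finite_sgn_invariants[OF F(1), of "Max (fst ` F)"] by blast
  show ?thesis
  proof (rule semialgebraic_sgn_invariant[OF G(1)])
    show "real_polynomial_function g" if "g \<in> G" for g using G(2) that by blast
    fix x x' assume *: "\<forall>g\<in>G. sgn (g x) = sgn (g x')" "x \<in> {x. \<exists>t. (x, t) \<in> S}"
    then obtain t \<rho> where t: "(x, t) \<in> S" "order_rel \<rho>" "sgn_agree ((\<lambda>(d, f). (f x, f x')) ` F) \<rho>"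
      using G(3) unfolding sgn_equiv_def by blast
    obtain t' where m: "matched \<rho> t t'" using matched_exists[OF t(2)] by blast
    have "sgn (poly (f x) t) = sgn (poly (f x') t')" if "(d, f) \<in> F" for d f
      using sgn_agreeD[OF t(3) _ m, of "f x" "f x'"] that by force
    then have "(x', t') \<in> S" using sgn_determinedD[OF detF, of x t x' t'] t(1) by blast
    then show "x' \<in> {x. \<exists>t. (x, t) \<in> S}" by blast
  qed
qed

lemma semialgebraic_vimage:
  fixes f :: "'a::euclidean_space \<Rightarrow> 'b::euclidean_space"
  assumes "semialgebraic S" "polynomial_function f"
  shows "semialgebraic (f -` S)"
  using assms(1)
proof induction
  case (pos p)
  have "real_polynomial_function (p \<circ> f)"
    using assms(2) pos by (rule real_polynomial_function_compose)
  then show ?case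
    using semialgebraic.pos[of "p \<circ> f"] by (simp add: vimage_def)
qed (simp_all add: vimage_Un vimage_Int vimage_Compl semialgebraic.union semialgebraic.inter
    semialgebraic.compl)

text \<open>Eliminates several coordinates while staying in one type: a projection is replaced by
  the cylinder over it, one direction at a time.\<close>

lemma semialgebraic_cylinder:
  fixes S :: "'a::euclidean_space set"
  assumes "finite B" "semialgebraic S"
  shows "semialgebraic {p. \<exists>c. p + (\<Sum>b\<in>B. c b *\<^sub>R b) \<in> S}"
  using assms(1)
proof induction
  case empty
  then show ?case using assms(2) by simp
next
  case (insert b B)
  let ?S = "{p. \<exists>c. p + (\<Sum>b\<in>B. c b *\<^sub>R b) \<in> S}"
  have "polynomial_function (\<lambda>(p::'a, t::real). p + t *\<^sub>R b)"
    unfolding case_prod_beta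
    by (intro polynomial_function_bounded_linear bounded_linear_add bounded_linear_fst
        bounded_linear_compose[OF bounded_linear_scaleR_left bounded_linear_snd])
  then have "semialgebraic ((\<lambda>(p::'a, t::real). p + t *\<^sub>R b) -` ?S)"
    by (rule semialgebraic_vimage[OF insert.IH])
  then have "semialgebraic {p. \<exists>t. (p, t) \<in> (\<lambda>(p::'a, t::real). p + t *\<^sub>R b) -` ?S}"
    by (rule semialgebraic_Ex_real)
  moreover have "{p. \<exists>t. (p, t) \<in> (\<lambda>(p::'a, t::real). p + t *\<^sub>R b) -` ?S}
      = {p. \<exists>c. p + (\<Sum>b\<in>insert b B. c b *\<^sub>R b) \<in> S}"
  proof (intro set_eqI iffI)
    fix p assume "p \<in> {p. \<exists>t. (p, t) \<in> (\<lambda>(p::'a, t::real). p + t *\<^sub>R b) -` ?S}"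
    then obtain t c where tc: "p + t *\<^sub>R b + (\<Sum>b\<in>B. c b *\<^sub>R b) \<in> S" by auto
    have "(\<Sum>b'\<in>B. (c(b := t)) b' *\<^sub>R b') = (\<Sum>b\<in>B. c b *\<^sub>R b)"
      using insert.hyps by (intro sum.cong) auto
    then have "p + (\<Sum>b'\<in>insert b B. (c(b := t)) b' *\<^sub>R b') \<in> S"
      using tc insert.hyps by (simp add: add.assoc)
    then show "p \<in> {p. \<exists>c. p + (\<Sum>b\<in>insert b B. c b *\<^sub>R b) \<in> S}" by blast
  next
    fix p assume "p \<in> {p. \<exists>c. p + (\<Sum>b\<in>insert b B. c b *\<^sub>R b) \<in> S}"
    then obtain c where "p + (\<Sum>b\<in>insert b B. c b *\<^sub>R b) \<in> S" by blast
    then have "p + c b *\<^sub>R b + (\<Sum>b\<in>B. c b *\<^sub>R b) \<in> S"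
      using insert.hyps by (simp add: add.assoc)
    then show "p \<in> {p. \<exists>t. (p, t) \<in> (\<lambda>(p::'a, t::real). p + t *\<^sub>R b) -` ?S}" by auto
  qed
  ultimately show ?case by simp
qed

lemma semialgebraic_fst_image:
  fixes S :: "('a::euclidean_space \<times> 'b::euclidean_space) set"
  assumes "semialgebraic S"
  shows "semialgebraic (fst ` S)"
proof -
  let ?B = "Pair (0::'a) ` (Basis :: 'b set)"
  have lin: "polynomial_function (\<lambda>x::'a. (x, 0::'b))"
    by (intro polynomial_function_bounded_linear bounded_linear_Pair bounded_linear_ident
        bounded_linear_zero)
  have "semialgebraic ((\<lambda>x. (x, 0)) -` {p. \<exists>c. p + (\<Sum>b\<in>?B. c b *\<^sub>R b) \<in> S})"
    by (intro semialgebraic_vimage[OF _ lin] semialgebraic_cylinder assms) simp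
  moreover have "(\<lambda>x. (x, 0)) -` {p. \<exists>c. p + (\<Sum>b\<in>?B. c b *\<^sub>R b) \<in> S} = fst ` S"
  proof -
    have sum: "(\<Sum>b\<in>?B. c b *\<^sub>R b) = (0, \<Sum>b\<in>Basis. c (0, b) *\<^sub>R b)" for c
      by (subst sum.reindex) (auto simp: inj_on_def sum_prod)
    have "(\<exists>c. (x, \<Sum>b\<in>Basis. c (0::'a, b) *\<^sub>R b) \<in> S) \<longleftrightarrow> x \<in> fst ` S" for x
    proof
      assume "x \<in> fst ` S"
      then obtain y where "(x, y) \<in> S" by force
      then show "\<exists>c. (x, \<Sum>b\<in>Basis. c (0::'a, b) *\<^sub>R b) \<in> S"
        by (intro exI[of _ "\<lambda>p. y \<bullet> snd p"]) (simp add: euclidean_representation)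
    qed force
    then show ?thesis by (auto simp: sum vimage_def)
  qed
  ultimately show ?thesis by simp
qed

lemma real_polynomial_function_inner:
  fixes f g :: "'a::real_normed_vector \<Rightarrow> 'b::euclidean_space"
  assumes "polynomial_function f" "polynomial_function g"
  shows "real_polynomial_function (\<lambda>x. f x \<bullet> g x)"
proof -
  have "real_polynomial_function (\<lambda>x. \<Sum>b\<in>Basis. (f x \<bullet> b) * (g x \<bullet> b))"
    using assms by (intro real_polynomial_function_sum) (auto simp: polynomial_function_iff_Basis_inner)
  moreover have "(\<Sum>b\<in>Basis. (f x \<bullet> b) * (g x \<bullet> b)) = f x \<bullet> g x" for x
    by (rule euclidean_inner[symmetric])
  ultimately show ?thesis by simp
qed

text \<open>The image is a projection of the graph over \<open>S\<close>, and the graph is the zero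
  set of a single polynomial, the squared distance of \<open>fst p\<close> and
  \<open>f (snd p)\<close>.\<close>

theorem semialgebraic_image:
  fixes f :: "'a::euclidean_space \<Rightarrow> 'b::euclidean_space"
  assumes S: "semialgebraic S" and f: "polynomial_function f"
  shows "semialgebraic (f ` S)"
proof -
  have fst: "polynomial_function (fst :: 'b \<times> 'a \<Rightarrow> 'b)"
    and snd: "polynomial_function (snd :: 'b \<times> 'a \<Rightarrow> 'a)"
    by (intro polynomial_function_bounded_linear bounded_linear_fst bounded_linear_snd)+
  have "polynomial_function (\<lambda>p :: 'b \<times> 'a. fst p - f (snd p))"
    using polynomial_function_diff[OF fst polynomial_function_compose[OF snd f]] by (simp add: o_def)
  then have "real_polynomial_function (\<lambda>p :: 'b \<times> 'a. (fst p - f (snd p)) \<bullet> (fst p - f (snd p)))"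
    by (rule real_polynomial_function_inner[rotated])
      (use polynomial_function_diff[OF fst polynomial_function_compose[OF snd f]] in \<open>simp add: o_def\<close>)
  then have "semialgebraic ({p :: 'b \<times> 'a. (fst p - f (snd p)) \<bullet> (fst p - f (snd p)) = 0} \<inter> snd -` S)"
    by (intro semialgebraic.inter semialgebraic_eq0 semialgebraic_vimage[OF S snd])
  then have "semialgebraic (fst ` ({p :: 'b \<times> 'a. (fst p - f (snd p)) \<bullet> (fst p - f (snd p)) = 0} \<inter> snd -` S))"
    by (rule semialgebraic_fst_image)
  moreover have "fst ` ({p :: 'b \<times> 'a. (fst p - f (snd p)) \<bullet> (fst p - f (snd p)) = 0} \<inter> snd -` S) = f ` S"
    by (auto simp: image_iff Bex_def)
  ultimately show ?thesis by simp
qed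

section \<open>Polygonal curves and zigzags\<close>

lemma polynomial_function_fst [intro]: "polynomial_function f \<Longrightarrow> polynomial_function (\<lambda>x. fst (f x))"
  using polynomial_function_compose[OF _ polynomial_function_bounded_linear[OF bounded_linear_fst]]
  by (simp add: o_def)

lemma polynomial_function_snd [intro]: "polynomial_function f \<Longrightarrow> polynomial_function (\<lambda>x. snd (f x))"
  using polynomial_function_compose[OF _ polynomial_function_bounded_linear[OF bounded_linear_snd]]
  by (simp add: o_def)

lemma polynomial_function_Pair [intro]:
  assumes "polynomial_function f" "polynomial_function g"
  shows "polynomial_function (\<lambda>x. (f x, g x))"
proof -
  have "polynomial_function (\<lambda>x. (f x, 0))" "polynomial_function (\<lambda>x. (0, g x))"
    using polynomial_function_compose[OF assms(1) polynomial_function_bounded_linear[of "\<lambda>y. (y, 0)"]]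
      polynomial_function_compose[OF assms(2) polynomial_function_bounded_linear[of "\<lambda>y. (0, y)"]]
    by (simp_all add: o_def bounded_linear_Pair bounded_linear_ident bounded_linear_zero)
  then have "polynomial_function (\<lambda>x. (f x, 0) + (0, g x))" by (rule polynomial_function_add)
  then show ?thesis by simp
qed

lemma polynomial_function_times [intro]:
  fixes f g :: "'a::real_normed_vector \<Rightarrow> real"
  shows "polynomial_function f \<Longrightarrow> polynomial_function g \<Longrightarrow> polynomial_function (\<lambda>x. f x * g x)"
  using polynomial_function_mult[of f g] by simp

lemma polynomial_function_divide [intro]:
  fixes f :: "'a::real_normed_vector \<Rightarrow> real"
  shows "polynomial_function f \<Longrightarrow> polynomial_function (\<lambda>x. f x / c)"
  by (metis real_polynomial_function_divide real_polynomial_function_eq)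

lemma polynomial_function_power [intro]:
  fixes f :: "'a::real_normed_vector \<Rightarrow> real"
  shows "polynomial_function f \<Longrightarrow> polynomial_function (\<lambda>x. f x ^ n)"
  by (metis real_polynomial_function_power real_polynomial_function_eq)

lemmas polynomial_function_intros =
  polynomial_function_const polynomial_function_id polynomial_function_add polynomial_function_diff
  polynomial_function_minus polynomial_function_times polynomial_function_divide
  polynomial_function_power polynomial_function_fst polynomial_function_snd polynomial_function_Pair

section \<open>States of polygonal curves\<close>

type_synonym state = "real \<times> real \<times> real \<times> real \<times> real"

text \<open>A state \<open>(s, y, A, B, C)\<close> records the end \<open>(s, y)\<close> of a curve in the \<open>(t, y)\<close>-plane that
  starts at the origin, together with the integrals of \<open>y\<close>, \<open>t y\<close> and \<open>y\<^sup>2\<close> along it. Such a curve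
  is prolonged by a segment with direction vector \<open>(\<tau>, \<delta>)\<close>.\<close>

fun line_step :: "real \<Rightarrow> real \<Rightarrow> state \<Rightarrow> state" where
  "line_step \<tau> \<delta> (s, y, A, B, C) =
     (s + \<tau>, y + \<delta>, A + \<tau> * (y + \<delta> / 2),
      B + s * \<tau> * (y + \<delta> / 2) + \<tau>\<^sup>2 * (y / 2 + \<delta> / 3),
      C + \<tau> * (y\<^sup>2 + y * \<delta> + \<delta>\<^sup>2 / 3))"

text \<open>Segments of length zero are allowed, so \<open>reach n\<close> stands for at most
  \<open>n\<close> segments.\<close>

primrec reach :: "nat \<Rightarrow> state set" where
  "reach 0 = {0}"
| "reach (Suc n) = {line_step \<tau> \<delta> st | \<tau> \<delta> st. st \<in> reach n \<and> \<bar>\<delta>\<bar> \<le> \<tau>}"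

declare reach.simps(2) [simp del]

lemma line_step_0 [simp]: "line_step 0 0 st = st"
  by (cases st) simp

lemma reach_SucI: "st \<in> reach n \<Longrightarrow> \<bar>\<delta>\<bar> \<le> \<tau> \<Longrightarrow> line_step \<tau> \<delta> st \<in> reach (Suc n)"
  unfolding reach.simps by blast

lemma reach_Suc_mono: "reach n \<subseteq> reach (Suc n)"
proof
  fix st assume "st \<in> reach n"
  then show "st \<in> reach (Suc n)"
    using reach_SucI[of st n 0 0] by simp
qed

lemma reach_mono: "m \<le> n \<Longrightarrow> reach m \<subseteq> reach n"
  using lift_Suc_mono_le[of reach] reach_Suc_mono by blast

lemma semialgebraic_singleton_0: "semialgebraic {0 :: 'a::euclidean_space}"
proof -
  have "semialgebraic {x :: 'a. x \<bullet> x = 0}"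
    by (intro semialgebraic_eq0 real_polynomial_function_inner polynomial_function_id)
  then show ?thesis by simp
qed

text \<open>\<open>line_step\<close> is polynomial in the segment and the state jointly, so every
  further segment means one polynomial image.\<close>

lemma semialgebraic_reach: "semialgebraic (reach n)"
proof (induction n)
  case 0
  then show ?case using semialgebraic_singleton_0 by simp
next
  case (Suc n)
  let ?step = "\<lambda>p :: real \<times> real \<times> state. line_step (fst p) (fst (snd p)) (snd (snd p))"
  let ?S = "(\<lambda>p :: real \<times> real \<times> state. snd (snd p)) -` reach n
      \<inter> {p. fst p - fst (snd p) \<ge> 0} \<inter> {p. fst p + fst (snd p) \<ge> 0}"
  have "?step p = (fst (snd (snd p)) + fst p, fst (snd (snd (snd p))) + fst (snd p),
      fst (snd (snd (snd (snd p)))) + fst p * (fst (snd (snd (snd p))) + fst (snd p) / 2),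
      fst (snd (snd (snd (snd (snd p))))) + fst (snd (snd p)) * fst p * (fst (snd (snd (snd p))) + fst (snd p) / 2)
        + (fst p)\<^sup>2 * (fst (snd (snd (snd p))) / 2 + fst (snd p) / 3),
      snd (snd (snd (snd (snd (snd p))))) + fst p * ((fst (snd (snd (snd p))))\<^sup>2
        + fst (snd (snd (snd p))) * fst (snd p) + (fst (snd p))\<^sup>2 / 3))" for p
    by (cases p) auto
  then have "polynomial_function ?step"
    by (simp only:) (intro polynomial_function_intros)
  moreover have "semialgebraic ?S"
    by (intro semialgebraic.inter semialgebraic_nonneg semialgebraic_vimage[OF Suc])
      (unfold real_polynomial_function_eq, (intro polynomial_function_intros)+)
  ultimately have "semialgebraic (?step ` ?S)"
    by (intro semialgebraic_image)
  moreover have "?step ` ?S = reach (Suc n)"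
  proof (intro set_eqI iffI)
    fix x assume "x \<in> ?step ` ?S"
    then show "x \<in> reach (Suc n)" by (auto intro!: reach_SucI)
  next
    fix x assume "x \<in> reach (Suc n)"
    then obtain \<tau> \<delta> st where "x = line_step \<tau> \<delta> st" "st \<in> reach n" "\<bar>\<delta>\<bar> \<le> \<tau>"
      unfolding reach.simps by blast
    then show "x \<in> ?step ` ?S" by (intro image_eqI[of _ _ "(\<tau>, \<delta>, st)"]) auto
  qed
  ultimately show ?case by simp
qed

section \<open>Zigzags and the reduction to four teeth\<close>

abbreviation zigzag :: "real \<Rightarrow> real \<Rightarrow> state \<Rightarrow> state" where
  "zigzag \<xi> \<eta> st \<equiv> line_step \<eta> (- \<eta>) (line_step \<xi> \<xi> st)"

primrec zreach :: "nat \<Rightarrow> state \<Rightarrow> state set" where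
  "zreach 0 st = {st}"
| "zreach (Suc n) st = {zigzag \<xi> \<eta> st' | \<xi> \<eta> st'. st' \<in> zreach n st \<and> 0 \<le> \<xi> \<and> 0 \<le> \<eta>}"

declare zreach.simps(2) [simp del]

lemma zreach_SucI: "st' \<in> zreach n st \<Longrightarrow> 0 \<le> \<xi> \<Longrightarrow> 0 \<le> \<eta> \<Longrightarrow> zigzag \<xi> \<eta> st' \<in> zreach (Suc n) st"
  unfolding zreach.simps by blast

lemma zreach_Suc_mono: "st' \<in> zreach n st \<Longrightarrow> st' \<in> zreach (Suc n) st"
  using zreach_SucI[of st' n st 0 0] by simp

lemma zreach_self: "st \<in> zreach n st"
proof (induction n)
  case (Suc n)
  then show ?case by (rule zreach_Suc_mono)
qed simp

lemma zreach_subset_reach: "zreach n 0 \<subseteq> reach (2 * n)"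
proof (induction n)
  case (Suc n)
  show ?case
  proof
    fix st assume "st \<in> zreach (Suc n) 0"
    then obtain \<xi> \<eta> st' where st: "st = zigzag \<xi> \<eta> st'" "st' \<in> zreach n 0" "0 \<le> \<xi>" "0 \<le> \<eta>"
      unfolding zreach.simps by blast
    then have "line_step \<xi> \<xi> st' \<in> reach (Suc (2 * n))" using Suc reach_SucI[of st' "2 * n" \<xi> \<xi>] by auto
    then have "st \<in> reach (Suc (Suc (2 * n)))" using st(1,4) reach_SucI[of "line_step \<xi> \<xi> st'" "Suc (2 * n)" "- \<eta>" \<eta>] by simp
    then show "st \<in> reach (2 * Suc n)" by (simp only: mult_Suc_right add_2_eq_Suc)
  qed
qed simp

fun add_last :: "real \<Rightarrow> state \<Rightarrow> state" where
  "add_last c (s, y, A, B, C) = (s, y, A, B, C + c)"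

text \<open>A step only adds to \<open>C\<close> and does not otherwise read it, so a gain in
  \<open>C\<close> survives all later steps.\<close>

lemma line_step_add_last: "line_step \<tau> \<delta> (add_last c st) = add_last c (line_step \<tau> \<delta> st)"
  by (cases st) simp

lemma add_last_add_last [simp]: "add_last c (add_last d st) = add_last (d + c) st"
  by (cases st) simp

lemma add_last_0 [simp]: "add_last 0 st = st"
  by (cases st) simp

lemma zigzag_up_merge: "zigzag \<xi>' \<eta>' (zigzag \<xi> 0 st) = zigzag (\<xi> + \<xi>') \<eta>' st"
  by (cases st) (simp add: field_simps power2_eq_square)

lemma zigzag_down_merge: "zigzag 0 \<eta>' (zigzag \<xi> \<eta> st) = zigzag \<xi> (\<eta> + \<eta>') st"
  by (cases st) (simp add: field_simps power2_eq_square)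

text \<open>In the light-cone coordinates \<open>\<xi>\<close>, \<open>\<eta>\<close> a zigzag is a staircase with levels \<open>g\<^sub>i\<close>. With fixed
  tread lengths \<open>l\<^sub>i\<close> and midpoints \<open>c\<^sub>i\<close>, the first two integrals are fixed by a hyperplane and a
  sphere centred at \<open>- c\<close>, and on their intersection the third one is an affine function of
  \<open>\<Sum> l\<^sub>i c\<^sub>i g\<^sub>i\<close>. A minimum of this linear function on a circle has \<open>g + c\<close> decreasing up to
  constants, so a monotone staircase can only be minimal when two of its levels coincide.\<close>

lemma circle_decrease:
  fixes l1 l2 l3 c1 c2 c3 h1 h2 h3 D :: real
  assumes l: "l1 > 0" "l2 > 0" "l3 > 0" and c: "c1 < c2" "c2 < c3"
    and h: "0 < h1" "h1 < h2" "h2 < h3" "h3 < D"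
  shows "\<exists>k1 k2 k3. 0 \<le> k1 \<and> k1 \<le> k2 \<and> k2 \<le> k3 \<and> k3 \<le> D \<and>
     l1 * k1 + l2 * k2 + l3 * k3 = l1 * h1 + l2 * h2 + l3 * h3 \<and>
     l1 * (k1 + c1)\<^sup>2 + l2 * (k2 + c2)\<^sup>2 + l3 * (k3 + c3)\<^sup>2
       = l1 * (h1 + c1)\<^sup>2 + l2 * (h2 + c2)\<^sup>2 + l3 * (h3 + c3)\<^sup>2 \<and>
     l1 * c1 * k1 + l2 * c2 * k2 + l3 * c3 * k3 < l1 * c1 * h1 + l2 * c2 * h2 + l3 * c3 * h3"
proof -
  define L where "L = l1 + l2 + l3"
  \<comment> \<open>The weighted mean of \<open>h + c\<close>, which is the centre of the circle
    after the shift by \<open>c\<close>.\<close>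
  define m where "m = (l1 * (h1 + c1) + l2 * (h2 + c2) + l3 * (h3 + c3)) / L"
  define a1 where "a1 = h1 + c1 - m"
  define a2 where "a2 = h2 + c2 - m"
  define a3 where "a3 = h3 + c3 - m"
  have L: "L > 0" using l unfolding L_def by simp
  have "L * m = l1 * (h1 + c1) + l2 * (h2 + c2) + l3 * (h3 + c3)" using L unfolding m_def by simp
  then have sa: "l1 * a1 + l2 * a2 + l3 * a3 = 0"
    unfolding a1_def a2_def a3_def L_def by (simp add: algebra_simps)
  have a: "a1 < a2" "a2 < a3" using c h unfolding a1_def a2_def a3_def by simp_all
  \<comment> \<open>For the weights \<open>l\<close> the vector \<open>d\<close> is orthogonal to
    \<open>(1, 1, 1)\<close> and to \<open>a\<close>: up to the weights it is their cross
    product.\<close>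
  define d1 where "d1 = l2 * l3 * (a3 - a2)"
  define d2 where "d2 = l1 * l3 * (a1 - a3)"
  define d3 where "d3 = l1 * l2 * (a2 - a1)"
  have sd: "l1 * d1 + l2 * d2 + l3 * d3 = 0" "l1 * a1 * d1 + l2 * a2 * d2 + l3 * a3 * d3 = 0"
    unfolding d1_def d2_def d3_def by (simp_all add: algebra_simps)
  define N where "N = l1 * a1\<^sup>2 + l2 * a2\<^sup>2 + l3 * a3\<^sup>2"
  define M where "M = l1 * d1\<^sup>2 + l2 * d2\<^sup>2 + l3 * d3\<^sup>2"
  have "d1 > 0" using l a unfolding d1_def by simp
  then have M: "M > 0" using l unfolding M_def
    by (intro add_pos_nonneg) auto
  have N: "N \<ge> 0" using l unfolding N_def by (intro add_nonneg_nonneg) auto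
  define \<kappa> where "\<kappa> = sqrt (N / M)"
  have \<kappa>: "\<kappa>\<^sup>2 * M = N" using M N unfolding \<kappa>_def by simp
  define Q where "Q = l1 * c1 * a1 + l2 * c2 * a2 + l3 * c3 * a3"
  \<comment> \<open>Chebyshev's sum identity: \<open>a\<close> and \<open>c\<close> increase
    together, so their weighted covariance is positive.\<close>
  have "L * Q = l1 * l2 * ((c2 - c1) * (a2 - a1)) + l1 * l3 * ((c3 - c1) * (a3 - a1))
      + l2 * l3 * ((c3 - c2) * (a3 - a2))
      + (l1 * c1 + l2 * c2 + l3 * c3) * (l1 * a1 + l2 * a2 + l3 * a3)"
    unfolding L_def Q_def by (simp add: algebra_simps)
  also have "\<dots> > 0" using l c a unfolding sa
    by (auto intro!: add_pos_pos mult_pos_pos)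
  finally have Q: "Q > 0" using L by (simp add: zero_less_mult_iff)
  define R where "R = l1 * c1 * d1 + l2 * c2 * d2 + l3 * c3 * d3"
  \<comment> \<open>A parametrisation of the circle near \<open>h\<close>, with \<open>s\<close> the
    sine of the angle; \<open>\<kappa>\<close> stretches \<open>d\<close> to the radius
    \<open>sqrt N\<close>.\<close>
  define k1 where "k1 s = m - c1 + sqrt (1 - s\<^sup>2) * a1 + s * (\<kappa> * d1)" for s
  define k2 where "k2 s = m - c2 + sqrt (1 - s\<^sup>2) * a2 + s * (\<kappa> * d2)" for s
  define k3 where "k3 s = m - c3 + sqrt (1 - s\<^sup>2) * a3 + s * (\<kappa> * d3)" for s
  have k0: "k1 0 = h1" "k2 0 = h2" "k3 0 = h3"
    unfolding k1_def k2_def k3_def a1_def a2_def a3_def by simp_all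
  have cont: "isCont k1 0" "isCont k2 0" "isCont k3 0"
    unfolding k1_def k2_def k3_def by (intro continuous_intros)+
  have "\<forall>\<^sub>F s in at 0. 0 < k1 s" "\<forall>\<^sub>F s in at 0. k1 s < k2 s" "\<forall>\<^sub>F s in at 0. k2 s < k3 s"
    "\<forall>\<^sub>F s in at 0. k3 s < D"
    using cont k0 h
    by (auto simp: isCont_def intro: order_tendstoD
        order_tendstoD(1)[OF tendsto_diff, of k2 _ _ k1 _ 0, simplified]
        order_tendstoD(1)[OF tendsto_diff, of k3 _ _ k2 _ 0, simplified])
  moreover have "\<forall>\<^sub>F s::real in at 0. \<bar>s\<bar> < 1"
    unfolding eventually_at by (intro exI[of _ 1]) auto
  ultimately have "\<forall>\<^sub>F s in at 0. 0 < k1 s \<and> k1 s < k2 s \<and> k2 s < k3 s \<and> k3 s < D \<and> \<bar>s\<bar> < 1"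
    by eventually_elim auto
  then obtain e where e: "e > 0" "\<And>s. s \<noteq> 0 \<Longrightarrow> \<bar>s\<bar> < e \<Longrightarrow>
      0 < k1 s \<and> k1 s < k2 s \<and> k2 s < k3 s \<and> k3 s < D \<and> \<bar>s\<bar> < 1"
    unfolding eventually_at by (auto simp: dist_real_def)
  \<comment> \<open>The sign of \<open>s\<close> makes the linear term nonpositive, whatever
    \<open>R\<close> is. The decrease is strict because the cosine \<open>\<gamma>\<close> is below
    1 and \<open>Q > 0\<close>.\<close>
  define s where "s = (if \<kappa> * R \<le> 0 then e / 2 else - (e / 2))"
  have s0: "s \<noteq> 0" "\<bar>s\<bar> < e" "s * (\<kappa> * R) \<le> 0"
    using e(1) unfolding s_def by (auto simp: mult_nonneg_nonpos)
  note in_s = e(2)[OF s0(1,2)]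
  define \<gamma> where "\<gamma> = sqrt (1 - s\<^sup>2)"
  have s2: "s\<^sup>2 > 0" "s\<^sup>2 < 1" using s0 in_s by (auto simp: abs_square_less_1)
  have \<gamma>: "\<gamma>\<^sup>2 = 1 - s\<^sup>2" "\<gamma> < 1" using s2 unfolding \<gamma>_def by simp_all
  have E1: "l1 * k1 s + l2 * k2 s + l3 * k3 s = l1 * h1 + l2 * h2 + l3 * h3"
  proof -
    have "l1 * k1 s + l2 * k2 s + l3 * k3 s = (l1 + l2 + l3) * m - (l1 * c1 + l2 * c2 + l3 * c3)
        + \<gamma> * (l1 * a1 + l2 * a2 + l3 * a3) + s * \<kappa> * (l1 * d1 + l2 * d2 + l3 * d3)"
      unfolding k1_def k2_def k3_def \<gamma>_def[symmetric] by (simp add: algebra_simps)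
    also have "\<dots> = L * m - (l1 * c1 + l2 * c2 + l3 * c3)" unfolding sa sd L_def by simp
    finally show ?thesis
      using \<open>L * m = _\<close> by (simp add: algebra_simps)
  qed
  have E2: "l1 * (k1 s + c1)\<^sup>2 + l2 * (k2 s + c2)\<^sup>2 + l3 * (k3 s + c3)\<^sup>2
       = l1 * (h1 + c1)\<^sup>2 + l2 * (h2 + c2)\<^sup>2 + l3 * (h3 + c3)\<^sup>2"
  proof -
    have gen: "l1 * (m + u * a1 + v * d1)\<^sup>2 + l2 * (m + u * a2 + v * d2)\<^sup>2 + l3 * (m + u * a3 + v * d3)\<^sup>2
        = L * m\<^sup>2 + u\<^sup>2 * N + v\<^sup>2 * M" for u v
    proof -
      have "l1 * (m + u * a1 + v * d1)\<^sup>2 + l2 * (m + u * a2 + v * d2)\<^sup>2 + l3 * (m + u * a3 + v * d3)\<^sup>2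
        = L * m\<^sup>2 + u\<^sup>2 * N + v\<^sup>2 * M + 2 * m * u * (l1 * a1 + l2 * a2 + l3 * a3)
          + 2 * m * v * (l1 * d1 + l2 * d2 + l3 * d3)
          + 2 * u * v * (l1 * a1 * d1 + l2 * a2 * d2 + l3 * a3 * d3)"
        unfolding L_def N_def M_def by (simp add: algebra_simps power2_eq_square)
      then show ?thesis unfolding sa sd by simp
    qed
    have "l1 * (k1 s + c1)\<^sup>2 + l2 * (k2 s + c2)\<^sup>2 + l3 * (k3 s + c3)\<^sup>2 = L * m\<^sup>2 + \<gamma>\<^sup>2 * N + (s * \<kappa>)\<^sup>2 * M"
      using gen[of \<gamma> "s * \<kappa>"] unfolding k1_def k2_def k3_def \<gamma>_def by (simp add: algebra_simps)
    also have "\<dots> = L * m\<^sup>2 + \<gamma>\<^sup>2 * N + s\<^sup>2 * (\<kappa>\<^sup>2 * M)" by (simp add: power_mult_distrib)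
    also have "\<dots> = L * m\<^sup>2 + N" unfolding \<kappa> \<gamma>(1) by (simp add: algebra_simps)
    also have "\<dots> = l1 * (h1 + c1)\<^sup>2 + l2 * (h2 + c2)\<^sup>2 + l3 * (h3 + c3)\<^sup>2"
      using gen[of 1 0] unfolding a1_def a2_def a3_def by simp
    finally show ?thesis .
  qed
  have "l1 * c1 * k1 s + l2 * c2 * k2 s + l3 * c3 * k3 s - (l1 * c1 * h1 + l2 * c2 * h2 + l3 * c3 * h3)
      = (\<gamma> - 1) * Q + s * (\<kappa> * R)"
    unfolding k1_def k2_def k3_def \<gamma>_def[symmetric] Q_def R_def a1_def a2_def a3_def
    by (simp add: algebra_simps)
  also have "\<dots> < 0"
    using mult_neg_pos[of "\<gamma> - 1" Q] \<gamma>(2) Q s0(3) by linarith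
  finally show ?thesis
    using E1 E2 in_s by (intro exI[of _ "k1 s"] exI[of _ "k2 s"] exI[of _ "k3 s"]) simp
qed

text \<open>The linear function has a minimum on a compact set, and by
  \<open>circle_decrease\<close> a minimiser cannot have its levels strictly separated from each
  other and from \<open>0\<close> and \<open>D\<close>.\<close>

lemma merge_levels:
  fixes l1 l2 l3 c1 c2 c3 g1 g2 g3 D :: real
  assumes l: "l1 > 0" "l2 > 0" "l3 > 0" and c: "c1 < c2" "c2 < c3"
    and g: "0 \<le> g1" "g1 \<le> g2" "g2 \<le> g3" "g3 \<le> D"
  shows "\<exists>h1 h2 h3. 0 \<le> h1 \<and> h1 \<le> h2 \<and> h2 \<le> h3 \<and> h3 \<le> D \<and>
     l1 * h1 + l2 * h2 + l3 * h3 = l1 * g1 + l2 * g2 + l3 * g3 \<and>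
     l1 * (h1 + c1)\<^sup>2 + l2 * (h2 + c2)\<^sup>2 + l3 * (h3 + c3)\<^sup>2
       = l1 * (g1 + c1)\<^sup>2 + l2 * (g2 + c2)\<^sup>2 + l3 * (g3 + c3)\<^sup>2 \<and>
     l1 * c1 * h1 + l2 * c2 * h2 + l3 * c3 * h3 \<le> l1 * c1 * g1 + l2 * c2 * g2 + l3 * c3 * g3 \<and>
     (h1 = 0 \<or> h1 = h2 \<or> h2 = h3 \<or> h3 = D)"
proof -
  define S where "S = {p :: real \<times> real \<times> real. 0 \<le> fst p \<and> fst p \<le> fst (snd p) \<and>
     fst (snd p) \<le> snd (snd p) \<and> snd (snd p) \<le> D \<and>
     l1 * fst p + l2 * fst (snd p) + l3 * snd (snd p) = l1 * g1 + l2 * g2 + l3 * g3 \<and>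
     l1 * (fst p + c1)\<^sup>2 + l2 * (fst (snd p) + c2)\<^sup>2 + l3 * (snd (snd p) + c3)\<^sup>2
       = l1 * (g1 + c1)\<^sup>2 + l2 * (g2 + c2)\<^sup>2 + l3 * (g3 + c3)\<^sup>2}"
  have "closed S"
    unfolding S_def by (intro closed_Collect_conj closed_Collect_le closed_Collect_eq continuous_intros)
  moreover have "S \<subseteq> {0..D} \<times> {0..D} \<times> {0..D}"
    unfolding S_def by auto
  then have "S = S \<inter> ({0..D} \<times> {0..D} \<times> {0..D})" by blast
  ultimately have "compact S"
    using closed_Int_compact[of S "{0..D} \<times> {0..D} \<times> {0..D}"] by (metis compact_Icc compact_Times)
  moreover have g_in: "(g1, g2, g3) \<in> S" using g unfolding S_def by simp
  moreover have "continuous_on S (\<lambda>p. l1 * c1 * fst p + l2 * c2 * fst (snd p) + l3 * c3 * snd (snd p))"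
    by (intro continuous_intros)
  ultimately obtain p where p: "p \<in> S" "\<And>q. q \<in> S \<Longrightarrow>
      l1 * c1 * fst p + l2 * c2 * fst (snd p) + l3 * c3 * snd (snd p)
      \<le> l1 * c1 * fst q + l2 * c2 * fst (snd q) + l3 * c3 * snd (snd q)"
    using continuous_attains_inf[of S] by blast
  obtain h1 h2 h3 where h: "p = (h1, h2, h3)" by (cases p)
  have "h1 = 0 \<or> h1 = h2 \<or> h2 = h3 \<or> h3 = D"
  proof (rule ccontr)
    assume "\<not> ?thesis"
    then have "0 < h1" "h1 < h2" "h2 < h3" "h3 < D" using p(1) unfolding S_def h by auto
    from circle_decrease[OF l c this] obtain k1 k2 k3 where k:
      "0 \<le> k1" "k1 \<le> k2" "k2 \<le> k3" "k3 \<le> D"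
      "l1 * k1 + l2 * k2 + l3 * k3 = l1 * h1 + l2 * h2 + l3 * h3"
      "l1 * (k1 + c1)\<^sup>2 + l2 * (k2 + c2)\<^sup>2 + l3 * (k3 + c3)\<^sup>2
       = l1 * (h1 + c1)\<^sup>2 + l2 * (h2 + c2)\<^sup>2 + l3 * (h3 + c3)\<^sup>2"
      "l1 * c1 * k1 + l2 * c2 * k2 + l3 * c3 * k3 < l1 * c1 * h1 + l2 * c2 * h2 + l3 * c3 * h3"
      by blast
    then have "(k1, k2, k3) \<in> S" using p(1) unfolding S_def h by simp
    then show False using p(2)[of "(k1, k2, k3)"] k(7) unfolding h by simp
  qed
  moreover have "l1 * c1 * h1 + l2 * c2 * h2 + l3 * c3 * h3 \<le> l1 * c1 * g1 + l2 * c2 * g2 + l3 * c3 * g3"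
    using p(2)[OF g_in] unfolding h by simp
  ultimately show ?thesis
    using p(1) unfolding S_def h by (intro exI[of _ h1] exI[of _ h2] exI[of _ h3]) simp
qed

text \<open>Compared with the levels zero, \<open>A\<close> changes by a multiple of the linear form
  \<open>G\<close>, \<open>B\<close> by a combination of \<open>G\<close> and the quadratic form
  \<open>K\<close>, and \<open>C\<close> by a further such combination minus \<open>8 J\<close>.
  Equal \<open>G\<close> and \<open>K\<close> therefore leave only a change of
  \<open>C\<close>.\<close>

lemma staircase_levels:
  fixes l0 l1 l2 l3 g1 g2 g3 h1 h2 h3 D :: real
  assumes E1: "l1 * h1 + l2 * h2 + l3 * h3 = l1 * g1 + l2 * g2 + l3 * g3"
    and E2: "l1 * (h1 + l1 / 2)\<^sup>2 + l2 * (h2 + (l1 + l2 / 2))\<^sup>2 + l3 * (h3 + (l1 + l2 + l3 / 2))\<^sup>2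
       = l1 * (g1 + l1 / 2)\<^sup>2 + l2 * (g2 + (l1 + l2 / 2))\<^sup>2 + l3 * (g3 + (l1 + l2 + l3 / 2))\<^sup>2"
  shows "zigzag l3 (D - h3) (zigzag l2 (h3 - h2) (zigzag l1 (h2 - h1) (zigzag l0 h1 st)))
     = add_last (8 * (l1 * (l1 / 2) * g1 + l2 * (l1 + l2 / 2) * g2 + l3 * (l1 + l2 + l3 / 2) * g3
           - (l1 * (l1 / 2) * h1 + l2 * (l1 + l2 / 2) * h2 + l3 * (l1 + l2 + l3 / 2) * h3)))
         (zigzag l3 (D - g3) (zigzag l2 (g3 - g2) (zigzag l1 (g2 - g1) (zigzag l0 g1 st))))"
proof (cases st)
  case (fields s y A B C)
  define G where "G g1 g2 g3 = l1 * g1 + l2 * g2 + l3 * g3" for g1 g2 g3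
  define K where "K g1 g2 g3 = l1 * (g1 + l1 / 2)\<^sup>2 + l2 * (g2 + (l1 + l2 / 2))\<^sup>2
      + l3 * (g3 + (l1 + l2 + l3 / 2))\<^sup>2" for g1 g2 g3
  define J where "J g1 g2 g3 = l1 * (l1 / 2) * g1 + l2 * (l1 + l2 / 2) * g2
      + l3 * (l1 + l2 + l3 / 2) * g3" for g1 g2 g3
  let ?Z = "\<lambda>g1 g2 g3. zigzag l3 (D - g3) (zigzag l2 (g3 - g2) (zigzag l1 (g2 - g1) (zigzag l0 g1 st)))"
  have 1: "fst (?Z g1 g2 g3) = s + l0 + l1 + l2 + l3 + D" for g1 g2 g3
    by (simp add: fields)
  have 2: "fst (snd (?Z g1 g2 g3)) = y + l0 + l1 + l2 + l3 - D" for g1 g2 g3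
    by (simp add: fields)
  have 3: "fst (snd (snd (?Z g1 g2 g3))) - fst (snd (snd (?Z 0 0 0))) = - 2 * G g1 g2 g3" for g1 g2 g3
    by (simp add: fields G_def algebra_simps power2_eq_square add_divide_distrib diff_divide_distrib)
  have 4: "fst (snd (snd (snd (?Z g1 g2 g3)))) - fst (snd (snd (snd (?Z 0 0 0))))
      = - 2 * (s + l0) * G g1 g2 g3 - (K g1 g2 g3 - K 0 0 0)" for g1 g2 g3
    by (simp add: fields G_def K_def algebra_simps power2_eq_square add_divide_distrib diff_divide_distrib)
  have 5: "snd (snd (snd (snd (?Z g1 g2 g3)))) - snd (snd (snd (snd (?Z 0 0 0))))
      = - 4 * (y + l0) * G g1 g2 g3 + 2 * (K g1 g2 g3 - K 0 0 0) - 8 * J g1 g2 g3" for g1 g2 g3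
    by (simp add: fields G_def K_def J_def algebra_simps power2_eq_square add_divide_distrib diff_divide_distrib)
  have GK: "G h1 h2 h3 = G g1 g2 g3" "K h1 h2 h3 = K g1 g2 g3"
    using E1 E2 unfolding G_def K_def by simp_all
  have "fst (?Z h1 h2 h3) = fst (?Z g1 g2 g3)" "fst (snd (?Z h1 h2 h3)) = fst (snd (?Z g1 g2 g3))"
    "fst (snd (snd (?Z h1 h2 h3))) = fst (snd (snd (?Z g1 g2 g3)))"
    "fst (snd (snd (snd (?Z h1 h2 h3)))) = fst (snd (snd (snd (?Z g1 g2 g3))))"
    using 1[of h3 h2 h1] 1[of g3 g2 g1] 2[of h3 h2 h1] 2[of g3 g2 g1] 3[of h3 h2 h1, unfolded GK]
      3[of g3 g2 g1] 4[of h3 h2 h1, unfolded GK] 4[of g3 g2 g1]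
    by linarith+
  moreover have "u = v + 8 * (j - i)" if "u - z = a + k - 8 * i" "v - z = a + k - 8 * j"
    for u v z a k i j :: real
    using that by simp
  from this[OF 5[of h3 h2 h1, unfolded GK] 5[of g3 g2 g1]]
  have "snd (snd (snd (snd (?Z h1 h2 h3)))) = snd (snd (snd (snd (?Z g1 g2 g3)))) + 8 * (J g1 g2 g3 - J h1 h2 h3)" .
  moreover have "p = add_last c q" if "fst p = fst q" "fst (snd p) = fst (snd q)"
    "fst (snd (snd p)) = fst (snd (snd q))" "fst (snd (snd (snd p))) = fst (snd (snd (snd q)))"
    "snd (snd (snd (snd p))) = snd (snd (snd (snd q))) + c" for p q :: state and c
    using that by (cases p; cases q) simp
  ultimately show ?thesis unfolding J_def by blast
qed

text \<open>The ascents, the last descent and the sum \<open>D\<close> of the other four descents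
  are kept, which leaves three movable levels. When a level meets its neighbour, \<open>0\<close> or
  \<open>D\<close>, a descent becomes empty and two teeth merge. The decrease in
  \<open>merge_levels\<close> is the gain in \<open>C\<close>.\<close>

lemma zreach_reduce:
  assumes "st' \<in> zreach 5 st"
  shows "\<exists>c\<ge>0. add_last c st' \<in> zreach 4 st"
proof -
  have n: "(5::nat) = Suc (Suc (Suc (Suc (Suc 0))))" "(4::nat) = Suc (Suc (Suc (Suc 0)))" by simp_all
  obtain l0 l1 l2 l3 l4 d0 d1 d2 d3 d4 where
    st': "st' = zigzag l4 d4 (zigzag l3 d3 (zigzag l2 d2 (zigzag l1 d1 (zigzag l0 d0 st))))"
    and pos: "0 \<le> l0" "0 \<le> l1" "0 \<le> l2" "0 \<le> l3" "0 \<le> l4" "0 \<le> d0" "0 \<le> d1" "0 \<le> d2" "0 \<le> d3" "0 \<le> d4"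
    using assms unfolding n zreach.simps by auto
  have four: "zigzag a3 b3 (zigzag a2 b2 (zigzag a1 b1 (zigzag a0 b0 st))) \<in> zreach 4 st"
    if "0 \<le> a0" "0 \<le> a1" "0 \<le> a2" "0 \<le> a3" "0 \<le> b0" "0 \<le> b1" "0 \<le> b2" "0 \<le> b3" for a0 a1 a2 a3 b0 b1 b2 b3
    unfolding n by (intro zreach_SucI that) simp
  show ?thesis
  proof (cases "l1 = 0 \<or> l2 = 0 \<or> l3 = 0")
    case True
    then have "st' \<in> zreach 4 st"
      using four pos unfolding st' by (auto simp only: zigzag_down_merge intro!: add_nonneg_nonneg)
    then show ?thesis by (intro exI[of _ 0]) simp
  next
    case False
    then have l: "l1 > 0" "l2 > 0" "l3 > 0" using pos by auto
    \<comment> \<open>The levels are the accumulated descents.\<close>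
    define g1 g2 g3 D where "g1 = d0" "g2 = d0 + d1" "g3 = d0 + d1 + d2" "D = d0 + d1 + d2 + d3"
    note gdef = this
    have g: "0 \<le> g1" "g1 \<le> g2" "g2 \<le> g3" "g3 \<le> D" using pos unfolding gdef by auto
    have c: "l1 / 2 < l1 + l2 / 2" "l1 + l2 / 2 < l1 + l2 + l3 / 2" using l by auto
    from merge_levels[OF l c g] obtain h1 h2 h3 where h: "0 \<le> h1" "h1 \<le> h2" "h2 \<le> h3" "h3 \<le> D"
      and E: "l1 * h1 + l2 * h2 + l3 * h3 = l1 * g1 + l2 * g2 + l3 * g3"
        "l1 * (h1 + l1 / 2)\<^sup>2 + l2 * (h2 + (l1 + l2 / 2))\<^sup>2 + l3 * (h3 + (l1 + l2 + l3 / 2))\<^sup>2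
       = l1 * (g1 + l1 / 2)\<^sup>2 + l2 * (g2 + (l1 + l2 / 2))\<^sup>2 + l3 * (g3 + (l1 + l2 + l3 / 2))\<^sup>2"
      and less: "l1 * (l1 / 2) * h1 + l2 * (l1 + l2 / 2) * h2 + l3 * (l1 + l2 + l3 / 2) * h3
        \<le> l1 * (l1 / 2) * g1 + l2 * (l1 + l2 / 2) * g2 + l3 * (l1 + l2 + l3 / 2) * g3"
      and bd: "h1 = 0 \<or> h1 = h2 \<or> h2 = h3 \<or> h3 = D"
      by blast
    define c where "c = 8 * (l1 * (l1 / 2) * g1 + l2 * (l1 + l2 / 2) * g2 + l3 * (l1 + l2 + l3 / 2) * g3
           - (l1 * (l1 / 2) * h1 + l2 * (l1 + l2 / 2) * h2 + l3 * (l1 + l2 + l3 / 2) * h3))"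
    have d: "d0 = g1" "d1 = g2 - g1" "d2 = g3 - g2" "d3 = D - g3" unfolding gdef by simp_all
    let ?Z = "zigzag l4 d4 (zigzag l3 (D - h3) (zigzag l2 (h3 - h2) (zigzag l1 (h2 - h1) (zigzag l0 h1 st))))"
    have eq: "?Z = add_last c st'"
      unfolding staircase_levels[OF E] st' d line_step_add_last c_def ..
    have "?Z \<in> zreach 4 st"
      using bd
    proof (elim disjE)
      assume "h1 = 0"
      then have "?Z = zigzag l4 d4 (zigzag l3 (D - h3) (zigzag l2 (h3 - h2) (zigzag (l0 + l1) h2 st)))"
        by (simp only: zigzag_up_merge diff_0_right)
      then show ?thesis using pos h by (simp only: four add_nonneg_nonneg diff_ge_0_iff_ge)
    next
      assume "h1 = h2"
      then have "?Z = zigzag l4 d4 (zigzag l3 (D - h3) (zigzag (l1 + l2) (h3 - h2) (zigzag l0 h1 st)))"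
        by (simp only: zigzag_up_merge diff_self)
      then show ?thesis using pos h by (simp only: four add_nonneg_nonneg diff_ge_0_iff_ge)
    next
      assume "h2 = h3"
      then have "?Z = zigzag l4 d4 (zigzag (l2 + l3) (D - h3) (zigzag l1 (h2 - h1) (zigzag l0 h1 st)))"
        by (simp only: zigzag_up_merge diff_self)
      then show ?thesis using pos h by (simp only: four add_nonneg_nonneg diff_ge_0_iff_ge)
    next
      assume "h3 = D"
      then have "?Z = zigzag (l3 + l4) d4 (zigzag l2 (h3 - h2) (zigzag l1 (h2 - h1) (zigzag l0 h1 st)))"
        by (simp only: zigzag_up_merge diff_self)
      then show ?thesis using pos h by (simp only: four add_nonneg_nonneg diff_ge_0_iff_ge)
    qed
    moreover have "c \<ge> 0"
      unfolding c_def by (rule mult_nonneg_nonneg[OF _ iffD2[OF diff_ge_0_iff_ge less]]) simp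
    ultimately show ?thesis unfolding eq by blast
  qed
qed

lemma zreach_four:
  assumes "st' \<in> zreach n st"
  shows "\<exists>c\<ge>0. add_last c st' \<in> zreach 4 st"
  using assms
proof (induction n arbitrary: st')
  case 0
  then show ?case using zreach_self by (intro exI[of _ 0]) simp
next
  case (Suc n)
  then obtain \<xi> \<eta> st1 where st1: "st' = zigzag \<xi> \<eta> st1" "st1 \<in> zreach n st" "0 \<le> \<xi>" "0 \<le> \<eta>"
    unfolding zreach.simps by blast
  obtain c where c: "c \<ge> 0" "add_last c st1 \<in> zreach 4 st" using Suc.IH[OF st1(2)] by blast
  have "(5::nat) = Suc 4" by simp
  then have "zigzag \<xi> \<eta> (add_last c st1) \<in> zreach 5 st"
    using zreach_SucI[OF c(2) st1(3,4)] by simp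
  then obtain d where "d \<ge> 0" "add_last d (zigzag \<xi> \<eta> (add_last c st1)) \<in> zreach 4 st"
    using zreach_reduce by blast
  then show ?case
    using c(1) by (intro exI[of _ "c + d"]) (simp add: st1(1) line_step_add_last)
qed

text \<open>The bound on the teeth makes the set compact. By \<open>zreach_bounded\<close> it misses
  no zigzag that ends by time \<open>T\<close>.\<close>

primrec bounded_zreach :: "real \<Rightarrow> nat \<Rightarrow> state set" where
  "bounded_zreach T 0 = {0}"
| "bounded_zreach T (Suc n) = {zigzag \<xi> \<eta> st | \<xi> \<eta> st. st \<in> bounded_zreach T n \<and> \<xi> \<in> {0..T} \<and> \<eta> \<in> {0..T}}"

lemma bounded_zreach_subset: "bounded_zreach T n \<subseteq> zreach n 0"
proof (induction n)
  case (Suc n)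
  show ?case
  proof
    fix st assume "st \<in> bounded_zreach T (Suc n)"
    then obtain \<xi> \<eta> st1 where "st = zigzag \<xi> \<eta> st1" "st1 \<in> bounded_zreach T n" "0 \<le> \<xi>" "0 \<le> \<eta>"
      by auto
    then show "st \<in> zreach (Suc n) 0" using Suc zreach_SucI by blast
  qed
qed simp

lemma continuous_on_line_step [continuous_intros]:
  assumes "continuous_on S f" "continuous_on S g" "continuous_on S h"
  shows "continuous_on S (\<lambda>x. line_step (f x) (g x) (h x))"
proof -
  have "line_step \<tau> \<delta> st = (fst st + \<tau>, fst (snd st) + \<delta>,
      fst (snd (snd st)) + \<tau> * (fst (snd st) + \<delta> / 2),
      fst (snd (snd (snd st))) + fst st * \<tau> * (fst (snd st) + \<delta> / 2)
        + \<tau>\<^sup>2 * (fst (snd st) / 2 + \<delta> / 3),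
      snd (snd (snd (snd st))) + \<tau> * ((fst (snd st))\<^sup>2 + fst (snd st) * \<delta> + \<delta>\<^sup>2 / 3))" for \<tau> \<delta> st
    by (cases st) simp
  then show ?thesis
    using assms by (simp only:) (auto intro!: continuous_intros)
qed

lemma compact_bounded_zreach: "compact (bounded_zreach T n)"
proof (induction n)
  case (Suc n)
  let ?f = "\<lambda>p :: real \<times> real \<times> state. zigzag (fst p) (fst (snd p)) (snd (snd p))"
  have "bounded_zreach T (Suc n) = ?f ` ({0..T} \<times> {0..T} \<times> bounded_zreach T n)"
    by (force simp: image_iff)
  moreover have "compact (?f ` ({0..T} \<times> {0..T} \<times> bounded_zreach T n))"
    by (intro compact_continuous_image continuous_intros compact_Times Suc compact_Icc)
  ultimately show ?case by simp
qed simp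

lemma zreach_bounded:
  assumes "st \<in> zreach n 0" "fst st \<le> T"
  shows "st \<in> bounded_zreach T n \<and> fst st \<ge> 0"
  using assms
proof (induction n arbitrary: st)
  case (Suc n)
  then obtain \<xi> \<eta> st1 where st1: "st = zigzag \<xi> \<eta> st1" "st1 \<in> zreach n 0" "0 \<le> \<xi>" "0 \<le> \<eta>"
    unfolding zreach.simps by blast
  have "fst st = fst st1 + \<xi> + \<eta>" unfolding st1(1) by (cases st1) simp
  then have *: "st1 \<in> bounded_zreach T n" "fst st1 \<ge> 0" "\<xi> \<in> {0..T}" "\<eta> \<in> {0..T}" "fst st \<ge> 0"
    using Suc.IH[OF st1(2)] Suc.prems(2) st1(3,4) by auto
  then have "st \<in> bounded_zreach T (Suc n)"
    unfolding st1(1) bounded_zreach.simps mem_Collect_eq by blast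
  then show ?case using * by blast
qed simp

section \<open>Moments of Lipschitz functions\<close>

definition lip1 :: "(real \<Rightarrow> real) \<Rightarrow> bool" where
  "lip1 f \<longleftrightarrow> (\<forall>a b. \<bar>f a - f b\<bar> \<le> \<bar>a - b\<bar>)"

lemma lip1D: "lip1 f \<Longrightarrow> \<bar>f a - f b\<bar> \<le> \<bar>a - b\<bar>"
  unfolding lip1_def by blast

lemma lip1_continuous_on: "lip1 f \<Longrightarrow> continuous_on S f"
  unfolding continuous_on_iff lip1_def dist_real_def by (meson le_less_trans)

definition moments :: "(real \<Rightarrow> real) \<Rightarrow> real \<Rightarrow> state" where
  "moments f t = (t, f t, integral {0..t} f, integral {0..t} (\<lambda>r. r * f r),
     integral {0..t} (\<lambda>r. (f r)\<^sup>2))"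

lemma moments_0: "f 0 = 0 \<Longrightarrow> moments f 0 = 0"
  by (simp add: moments_def zero_prod_def)

lemma integral_extend_antiderivative:
  fixes g :: "real \<Rightarrow> real"
  assumes "continuous_on UNIV g" "0 \<le> s" "0 \<le> \<tau>"
    and "\<And>r. r \<in> {s..s + \<tau>} \<Longrightarrow> g r = G r"
    and "\<And>r. (F has_real_derivative G r) (at r)"
  shows "integral {0..s + \<tau>} g = integral {0..s} g + (F (s + \<tau>) - F s)"
proof -
  have "(G has_integral (F (s + \<tau>) - F s)) {s..s + \<tau>}"
    using assms(3,5)
    by (intro fundamental_theorem_of_calculus)
      (auto simp: has_real_derivative_iff_has_vector_derivative[symmetric] intro: has_field_derivative_at_within)
  then have "(g has_integral (F (s + \<tau>) - F s)) {s..s + \<tau>}"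
    using has_integral_cong[of "{s..s + \<tau>}" g G] assms(4) by blast
  then have "integral {s..s + \<tau>} g = F (s + \<tau>) - F s" by (rule integral_unique)
  moreover have "g integrable_on {0..s + \<tau>}"
    using assms(1) continuous_on_subset by (intro integrable_continuous_interval) blast
  ultimately show ?thesis
    using Henstock_Kurzweil_Integration.integral_combine[of 0 s "s + \<tau>" g] assms(2,3) by simp
qed

lemma moments_affine:
  assumes f: "continuous_on UNIV f" and "0 \<le> s" "0 \<le> \<tau>"
    and aff: "\<And>r. r \<in> {s..s + \<tau>} \<Longrightarrow> f r = f s + q * (r - s)"
  shows "moments f (s + \<tau>) = line_step \<tau> (q * \<tau>) (moments f s)"
proof -
  define y where "y = f s"
  have f0: "f (s + \<tau>) = y + q * \<tau>" using aff[of "s + \<tau>"] \<open>0 \<le> \<tau>\<close> by (simp add: y_def)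
  have aff': "f r = y + q * (r - s)" if "r \<in> {s..s + \<tau>}" for r using aff[OF that] unfolding y_def .
  have c: "continuous_on UNIV (\<lambda>r. r * f r)" "continuous_on UNIV (\<lambda>r. (f r)\<^sup>2)"
    by (intro continuous_intros f)+
  have "((\<lambda>r. y * (r - s) + q * (r - s)\<^sup>2 / 2) has_real_derivative y + q * (r - s)) (at r)" for r
    by (auto intro!: derivative_eq_intros)
  from integral_extend_antiderivative[OF f assms(2,3) aff' this]
  have A: "integral {0..s + \<tau>} f = integral {0..s} f + (y * \<tau> + q * \<tau>\<^sup>2 / 2)" by simp
  have dB: "((\<lambda>r. s * y * (r - s) + (y + s * q) * (r - s)\<^sup>2 / 2 + q * (r - s) ^ 3 / 3)
      has_real_derivative r * (y + q * (r - s))) (at r)" for r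
    by (auto intro!: derivative_eq_intros simp: field_simps power2_eq_square)
  have eB: "r * f r = r * (y + q * (r - s))" if "r \<in> {s..s + \<tau>}" for r using aff'[OF that] by simp
  from integral_extend_antiderivative[OF c(1) assms(2,3) eB dB]
  have B: "integral {0..s + \<tau>} (\<lambda>r. r * f r) = integral {0..s} (\<lambda>r. r * f r)
      + (s * y * \<tau> + (y + s * q) * \<tau>\<^sup>2 / 2 + q * \<tau> ^ 3 / 3)"
    by simp
  have dC: "((\<lambda>r. y\<^sup>2 * (r - s) + y * q * (r - s)\<^sup>2 + q\<^sup>2 * (r - s) ^ 3 / 3)
      has_real_derivative (y + q * (r - s))\<^sup>2) (at r)" for r
    by (auto intro!: derivative_eq_intros simp: field_simps power2_eq_square)
  have eC: "(f r)\<^sup>2 = (y + q * (r - s))\<^sup>2" if "r \<in> {s..s + \<tau>}" for r using aff'[OF that] by simp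
  from integral_extend_antiderivative[OF c(2) assms(2,3) eC dC]
  have C: "integral {0..s + \<tau>} (\<lambda>r. (f r)\<^sup>2) = integral {0..s} (\<lambda>r. (f r)\<^sup>2)
      + (y\<^sup>2 * \<tau> + y * q * \<tau>\<^sup>2 + q\<^sup>2 * \<tau> ^ 3 / 3)"
    by simp
  show ?thesis
    unfolding moments_def A B C f0 line_step.simps y_def[symmetric]
    by (simp add: field_simps power2_eq_square power3_eq_cube)
qed

text \<open>Differentiability off a finite set is inherited by convex combinations and suffices for
  a measurable control.\<close>

definition piecewise_C1_lip1 :: "(real \<Rightarrow> real) \<Rightarrow> bool" where
  "piecewise_C1_lip1 f \<longleftrightarrow> lip1 f \<and> f 0 = 0 \<and>
     (\<exists>S. finite S \<and> (\<forall>t. t \<notin> S \<longrightarrow> (\<exists>D. (f has_real_derivative D) (at t))))"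

text \<open>With \<open>min\<close> and \<open>max\<close> in place of a case distinction the
  Lipschitz bound is immediate: the absolute increments of \<open>min t s\<close> and
  \<open>max t s\<close> add up to that of \<open>t\<close>.\<close>

definition prolong :: "(real \<Rightarrow> real) \<Rightarrow> real \<Rightarrow> real \<Rightarrow> real \<Rightarrow> real" where
  "prolong f s q t = f (min t s) + q * (max t s - s)"

lemma prolong_le: "t \<le> s \<Longrightarrow> prolong f s q t = f t"
  by (simp add: prolong_def)

lemma prolong_ge: "t \<ge> s \<Longrightarrow> prolong f s q t = f s + q * (t - s)"
  by (simp add: prolong_def)

lemma lip1_prolong:
  assumes "lip1 f" "\<bar>q\<bar> \<le> 1"
  shows "lip1 (prolong f s q)"
  unfolding lip1_def
proof (intro allI)
  fix a b
  have "\<bar>prolong f s q a - prolong f s q b\<bar> = \<bar>(f (min a s) - f (min b s)) + q * (max a s - max b s)\<bar>"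
    unfolding prolong_def by (simp add: algebra_simps)
  also have "\<dots> \<le> \<bar>f (min a s) - f (min b s)\<bar> + \<bar>q * (max a s - max b s)\<bar>"
    by (rule abs_triangle_ineq)
  also have "\<dots> \<le> \<bar>min a s - min b s\<bar> + \<bar>max a s - max b s\<bar>"
    using mult_right_mono[OF assms(2), of "\<bar>max a s - max b s\<bar>"]
    by (intro add_mono lip1D[OF assms(1)]) (simp add: abs_mult)
  also have "\<dots> = \<bar>a - b\<bar>"
    by (auto simp: min_def max_def)
  finally show "\<bar>prolong f s q a - prolong f s q b\<bar> \<le> \<bar>a - b\<bar>" .
qed

lemma piecewise_C1_lip1_prolong:
  assumes f: "piecewise_C1_lip1 f" and "\<bar>q\<bar> \<le> 1" "0 \<le> s"
  shows "piecewise_C1_lip1 (prolong f s q)"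
proof -
  obtain S where S: "finite S" "\<And>t. t \<notin> S \<Longrightarrow> \<exists>D. (f has_real_derivative D) (at t)"
    using f unfolding piecewise_C1_lip1_def by blast
  have "\<exists>D. (prolong f s q has_real_derivative D) (at t)" if t: "t \<notin> insert s S" for t
  proof (cases "t < s")
    case True
    obtain D where "(f has_real_derivative D) (at t)" using S t by blast
    then have "(prolong f s q has_real_derivative D) (at t)"
      by (rule has_field_derivative_transform_within_open[of _ _ _ "{..<s}"])
        (use True in \<open>auto simp: prolong_le\<close>)
    then show ?thesis ..
  next
    case False
    then have "t > s" using t by auto
    have "((\<lambda>t. f s + q * (t - s)) has_real_derivative q) (at t)"
      by (auto intro!: derivative_eq_intros)
    then have "(prolong f s q has_real_derivative q) (at t)"
      by (rule has_field_derivative_transform_within_open[of _ _ _ "{s<..}"])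
        (use \<open>t > s\<close> in \<open>auto simp: prolong_ge\<close>)
    then show ?thesis ..
  qed
  then have "\<exists>S. finite S \<and> (\<forall>t. t \<notin> S \<longrightarrow> (\<exists>D. (prolong f s q has_real_derivative D) (at t)))"
    using S(1) by (intro exI[of _ "insert s S"]) auto
  then show ?thesis
    using f lip1_prolong[OF _ assms(2)] prolong_le[OF \<open>0 \<le> s\<close>] unfolding piecewise_C1_lip1_def by simp
qed

lemma moments_cong:
  assumes "\<And>r. 0 \<le> r \<Longrightarrow> r \<le> t \<Longrightarrow> f r = g r" "0 \<le> t"
  shows "moments f t = moments g t"
  unfolding moments_def using assms by (auto intro!: Henstock_Kurzweil_Integration.integral_cong)

lemma moments_prolong:
  assumes "lip1 f" "\<bar>q\<bar> \<le> 1" "0 \<le> s" "0 \<le> \<tau>"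
  shows "moments (prolong f s q) (s + \<tau>) = line_step \<tau> (q * \<tau>) (moments f s)"
proof -
  have "moments (prolong f s q) (s + \<tau>) = line_step \<tau> (q * \<tau>) (moments (prolong f s q) s)"
    using assms lip1_continuous_on[OF lip1_prolong]
    by (intro moments_affine) (auto simp: prolong_ge)
  then show ?thesis
    using moments_cong[of s "prolong f s q" f] assms(3) by (simp add: prolong_le)
qed

lemma reach_realized:
  assumes "st \<in> reach n"
  shows "\<exists>f. piecewise_C1_lip1 f \<and> 0 \<le> fst st \<and> moments f (fst st) = st"
  using assms
proof (induction n arbitrary: st)
  case 0
  have "piecewise_C1_lip1 (\<lambda>t. 0)"
    unfolding piecewise_C1_lip1_def lip1_def by (auto intro!: exI[of _ "{}"] exI[of _ 0])
  then show ?case using 0 moments_0[of "\<lambda>t. 0"] by (intro exI[of _ "\<lambda>t. 0"]) simp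
next
  case (Suc n)
  then obtain \<tau> \<delta> st1 where st1: "st = line_step \<tau> \<delta> st1" "st1 \<in> reach n" "\<bar>\<delta>\<bar> \<le> \<tau>"
    unfolding reach.simps by blast
  obtain f where f: "piecewise_C1_lip1 f" "0 \<le> fst st1" "moments f (fst st1) = st1"
    using Suc.IH[OF st1(2)] by blast
  show ?case
  proof (cases "\<tau> = 0")
    case True
    then show ?thesis using st1 f by auto
  next
    case False
    then have "\<tau> > 0" using st1(3) by linarith
    define q where "q = \<delta> / \<tau>"
    have q: "\<bar>q\<bar> \<le> 1" "q * \<tau> = \<delta>" using st1(3) \<open>\<tau> > 0\<close> unfolding q_def by auto
    have "lip1 f" using f(1) unfolding piecewise_C1_lip1_def by blast
    then have "moments (prolong f (fst st1) q) (fst st1 + \<tau>) = st"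
      using moments_prolong[OF _ q(1) f(2), of f \<tau>] \<open>\<tau> > 0\<close> q(2) f(3) st1(1) by simp
    moreover have "fst st = fst st1 + \<tau>" unfolding st1(1) by (cases st1) simp
    ultimately show ?thesis
      using piecewise_C1_lip1_prolong[OF f(1) q(1) f(2)] f(2) \<open>\<tau> > 0\<close> by auto
  qed
qed

lemma piecewise_C1_lip1_convex:
  assumes f: "piecewise_C1_lip1 f" and g: "piecewise_C1_lip1 g" and \<theta>: "0 \<le> \<theta>" "\<theta> \<le> 1"
  shows "piecewise_C1_lip1 (\<lambda>t. (1 - \<theta>) * f t + \<theta> * g t)"
proof -
  obtain S R where S: "finite S" "\<And>t. t \<notin> S \<Longrightarrow> \<exists>D. (f has_real_derivative D) (at t)"
    and R: "finite R" "\<And>t. t \<notin> R \<Longrightarrow> \<exists>D. (g has_real_derivative D) (at t)"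
    using f g unfolding piecewise_C1_lip1_def by blast
  have "\<exists>D. ((\<lambda>t. (1 - \<theta>) * f t + \<theta> * g t) has_real_derivative D) (at t)" if t: "t \<notin> S \<union> R" for t
  proof -
    obtain D E where "(f has_real_derivative D) (at t)" "(g has_real_derivative E) (at t)"
      using S R t by blast
    then have "((\<lambda>t. (1 - \<theta>) * f t + \<theta> * g t) has_real_derivative (1 - \<theta>) * D + \<theta> * E) (at t)"
      by (auto intro!: derivative_eq_intros)
    then show ?thesis ..
  qed
  moreover have "lip1 (\<lambda>t. (1 - \<theta>) * f t + \<theta> * g t)"
    unfolding lip1_def
  proof (intro allI)
    fix a b
    have "\<bar>f a - f b\<bar> \<le> \<bar>a - b\<bar>" "\<bar>g a - g b\<bar> \<le> \<bar>a - b\<bar>"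
      using f g unfolding piecewise_C1_lip1_def lip1_def by blast+
    then have "\<bar>(1 - \<theta>) * (f a - f b)\<bar> \<le> (1 - \<theta>) * \<bar>a - b\<bar>" "\<bar>\<theta> * (g a - g b)\<bar> \<le> \<theta> * \<bar>a - b\<bar>"
      using \<theta> by (simp_all add: abs_mult mult_left_mono)
    moreover have "(1 - \<theta>) * f a + \<theta> * g a - ((1 - \<theta>) * f b + \<theta> * g b)
        = (1 - \<theta>) * (f a - f b) + \<theta> * (g a - g b)" by (simp add: algebra_simps)
    moreover have "(1 - \<theta>) * \<bar>a - b\<bar> + \<theta> * \<bar>a - b\<bar> = \<bar>a - b\<bar>" by (simp add: algebra_simps)
    ultimately show "\<bar>(1 - \<theta>) * f a + \<theta> * g a - ((1 - \<theta>) * f b + \<theta> * g b)\<bar> \<le> \<bar>a - b\<bar>"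
      by linarith
  qed
  ultimately show ?thesis
    using f g S(1) R(1) unfolding piecewise_C1_lip1_def
    by (intro conjI exI[of _ "S \<union> R"]) auto
qed

text \<open>On the segment from \<open>f\<close> to \<open>g\<close> the end value and the first two
  integrals are affine, hence constant, while the third is a quadratic polynomial in
  \<open>\<theta>\<close> that runs from \<open>C1\<close> to \<open>C2\<close>.\<close>

lemma moments_intermediate:
  assumes f: "piecewise_C1_lip1 f" and g: "piecewise_C1_lip1 g"
    and "moments f T = (T, Y, A, B, C1)" "moments g T = (T, Y, A, B, C2)" "C1 \<le> C" "C \<le> C2"
  shows "\<exists>h. piecewise_C1_lip1 h \<and> moments h T = (T, Y, A, B, C)"
proof -
  define h where "h \<theta> t = (1 - \<theta>) * f t + \<theta> * g t" for \<theta> t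
  have c: "continuous_on S f" "continuous_on S g" for S
    using f g lip1_continuous_on unfolding piecewise_C1_lip1_def by blast+
  define M where "M = integral {0..T} (\<lambda>r. f r * g r)"
  have int: "(\<lambda>r. (f r)\<^sup>2) integrable_on {0..T}" "(\<lambda>r. (g r)\<^sup>2) integrable_on {0..T}"
    "(\<lambda>r. f r * g r) integrable_on {0..T}" "f integrable_on {0..T}" "g integrable_on {0..T}"
    "(\<lambda>r. r * f r) integrable_on {0..T}" "(\<lambda>r. r * g r) integrable_on {0..T}"
    by (intro integrable_continuous_interval continuous_intros c)+
  have eq: "f T = Y" "g T = Y" "integral {0..T} f = A" "integral {0..T} g = A"
    "integral {0..T} (\<lambda>r. r * f r) = B" "integral {0..T} (\<lambda>r. r * g r) = B"
    "integral {0..T} (\<lambda>r. (f r)\<^sup>2) = C1" "integral {0..T} (\<lambda>r. (g r)\<^sup>2) = C2"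
    using assms(3,4) unfolding moments_def by simp_all
  have hi: "((\<lambda>r. u * F r + v * G r) has_integral (u * integral {0..T} F + v * integral {0..T} G)) {0..T}"
    if "F integrable_on {0..T}" "G integrable_on {0..T}" for F G :: "real \<Rightarrow> real" and u v
    using that by (intro has_integral_add[OF has_integral_mult_right has_integral_mult_right] integrable_integral)
  \<comment> \<open>The factor \<open>1\<close> keeps the shape of \<open>hi\<close>, which combines
    two functions at a time.\<close>
  have hC: "integral {0..T} (\<lambda>r. (h \<theta> r)\<^sup>2) = (1 - \<theta>)\<^sup>2 * C1 + 1 * (2 * (1 - \<theta>) * \<theta> * M + \<theta>\<^sup>2 * C2)" for \<theta>
  proof -
    have *: "((\<lambda>r. 2 * (1 - \<theta>) * \<theta> * (f r * g r) + \<theta>\<^sup>2 * (g r)\<^sup>2) has_integral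
        2 * (1 - \<theta>) * \<theta> * M + \<theta>\<^sup>2 * C2) {0..T}"
      using hi[OF int(3,2)] unfolding M_def eq .
    have "((\<lambda>r. (1 - \<theta>)\<^sup>2 * (f r)\<^sup>2 + 1 * (2 * (1 - \<theta>) * \<theta> * (f r * g r) + \<theta>\<^sup>2 * (g r)\<^sup>2)) has_integral
        ((1 - \<theta>)\<^sup>2 * C1 + 1 * (2 * (1 - \<theta>) * \<theta> * M + \<theta>\<^sup>2 * C2))) {0..T}"
      using hi[OF int(1) has_integral_integrable[OF *], of "(1 - \<theta>)\<^sup>2" 1]
      unfolding integral_unique[OF *] eq .
    moreover have "(1 - \<theta>)\<^sup>2 * (f r)\<^sup>2 + 1 * (2 * (1 - \<theta>) * \<theta> * (f r * g r) + \<theta>\<^sup>2 * (g r)\<^sup>2) = (h \<theta> r)\<^sup>2" for r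
      unfolding h_def by (simp add: power2_eq_square algebra_simps)
    ultimately show ?thesis by (simp add: integral_unique)
  qed
  have "\<exists>\<theta>. 0 \<le> \<theta> \<and> \<theta> \<le> 1 \<and> integral {0..T} (\<lambda>r. (h \<theta> r)\<^sup>2) = C"
    unfolding hC using assms(5,6) by (intro IVT') (auto intro!: continuous_intros)
  then obtain \<theta> where \<theta>: "0 \<le> \<theta>" "\<theta> \<le> 1" "integral {0..T} (\<lambda>r. (h \<theta> r)\<^sup>2) = C" by blast
  have hA: "integral {0..T} (h \<theta>) = A"
    using integral_unique[OF hi[OF int(4,5), of "1 - \<theta>" \<theta>]] unfolding h_def eq
    by (simp add: algebra_simps)
  have "(\<lambda>r. r * h \<theta> r) = (\<lambda>r. (1 - \<theta>) * (r * f r) + \<theta> * (r * g r))"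
    unfolding h_def by (auto simp: algebra_simps)
  then have hB: "integral {0..T} (\<lambda>r. r * h \<theta> r) = B"
    using integral_unique[OF hi[OF int(6,7), of "1 - \<theta>" \<theta>]] unfolding eq
    by (simp add: algebra_simps)
  have "h \<theta> T = Y" unfolding h_def eq by (simp add: algebra_simps)
  then have "moments (h \<theta>) T = (T, Y, A, B, C)"
    unfolding moments_def hA hB \<theta>(3) by simp
  moreover have "piecewise_C1_lip1 (h \<theta>)"
    using piecewise_C1_lip1_convex[OF f g \<theta>(1,2)] unfolding h_def .
  ultimately show ?thesis by blast
qed

text \<open>On each interval of length \<open>h\<close> one tooth joins the values of
  \<open>y\<close> at its ends: \<open>\<xi>\<close> and \<open>\<eta>\<close> solve
  \<open>\<xi> + \<eta> = h\<close> and \<open>\<xi> - \<eta> = \<Delta>\<close>. The error is at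
  most \<open>2 * h\<close> because both curves are 1-Lipschitz and agree at the left end.\<close>

lemma zigzag_approximation:
  assumes y: "lip1 y" "y 0 = 0" and h: "h \<ge> 0"
  shows "\<exists>f. lip1 f \<and> f (real k * h) = y (real k * h) \<and> moments f (real k * h) \<in> zreach k 0 \<and>
           (\<forall>t\<in>{0..real k * h}. \<bar>f t - y t\<bar> \<le> 2 * h)"
proof (induction k)
  case 0
  show ?case
    using y h moments_0[of y] by (intro exI[of _ y]) simp
next
  case (Suc k)
  then obtain f where f: "lip1 f" "f (real k * h) = y (real k * h)"
    "moments f (real k * h) \<in> zreach k 0" "\<And>t. t \<in> {0..real k * h} \<Longrightarrow> \<bar>f t - y t\<bar> \<le> 2 * h" by blast
  define s where "s = real k * h"
  define \<Delta> where "\<Delta> = y (s + h) - y s"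
  have s: "s \<ge> 0" using h unfolding s_def by simp
  have "\<bar>\<Delta>\<bar> \<le> h" using lip1D[OF y(1), of "s + h" s] h unfolding \<Delta>_def by simp
  define \<xi> where "\<xi> = (h + \<Delta>) / 2"
  define \<eta> where "\<eta> = (h - \<Delta>) / 2"
  have \<xi>\<eta>: "\<xi> \<ge> 0" "\<eta> \<ge> 0" "\<xi> + \<eta> = h" "\<xi> - \<eta> = \<Delta>"
    using \<open>\<bar>\<Delta>\<bar> \<le> h\<close> unfolding \<xi>_def \<eta>_def by (auto simp: field_simps)
  define f1 where "f1 = prolong f s 1"
  define f2 where "f2 = prolong f1 (s + \<xi>) (-1)"
  have l1: "lip1 f1" unfolding f1_def using f(1) by (intro lip1_prolong) auto
  have l2: "lip1 f2" unfolding f2_def using l1 by (intro lip1_prolong) auto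
  have "moments f1 (s + \<xi>) = line_step \<xi> \<xi> (moments f s)"
    unfolding f1_def using moments_prolong[OF f(1), of 1 s \<xi>] s \<xi>\<eta> by simp
  then have m2: "moments f2 (s + \<xi> + \<eta>) = zigzag \<xi> \<eta> (moments f s)"
    unfolding f2_def using moments_prolong[OF l1, of "-1" "s + \<xi>" \<eta>] s \<xi>\<eta> by simp
  have sk: "s + \<xi> + \<eta> = real (Suc k) * h"
    using \<xi>\<eta>(3) unfolding s_def by (simp add: algebra_simps)
  have "moments f2 (real (Suc k) * h) \<in> zreach (Suc k) 0"
    unfolding m2[unfolded sk] unfolding s_def using f(3) \<xi>\<eta>(1,2) by (rule zreach_SucI)
  moreover have "f2 (real (Suc k) * h) = f s + \<xi> - \<eta>"
    unfolding sk[symmetric] f2_def f1_def using \<xi>\<eta> s by (simp add: prolong_ge)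
  then have "f2 (real (Suc k) * h) = y (real (Suc k) * h)"
    using f(2) \<xi>\<eta>(3,4) sk unfolding s_def[symmetric] \<Delta>_def by (simp add: add.assoc)
  moreover have "\<bar>f2 t - y t\<bar> \<le> 2 * h" if t: "t \<in> {0..real (Suc k) * h}" for t
  proof (cases "t \<le> s")
    case True
    then have "f2 t = f t" using \<xi>\<eta>(1) unfolding f2_def f1_def by (simp add: prolong_le)
    then show ?thesis using f(4)[of t] True t unfolding s_def by simp
  next
    case False
    have "f2 s = y s" using \<xi>\<eta>(1) f(2) unfolding f2_def f1_def s_def[symmetric] by (simp add: prolong_le)
    moreover have "\<bar>t - s\<bar> \<le> h" using t False unfolding sk[symmetric] using \<xi>\<eta>(3) by simp
    ultimately show ?thesis
      using lip1D[OF l2, of t s] lip1D[OF y(1), of t s] by linarith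
  qed
  ultimately show ?case using l2 by blast
qed

lemma integral_close:
  fixes f g :: "real \<Rightarrow> real"
  assumes "continuous_on {0..T} f" "continuous_on {0..T} g" "0 \<le> T"
    and "\<And>t. t \<in> {0..T} \<Longrightarrow> \<bar>f t - g t\<bar> \<le> e"
  shows "\<bar>integral {0..T} f - integral {0..T} g\<bar> \<le> e * T"
proof -
  have "integral {0..T} f - integral {0..T} g = integral {0..T} (\<lambda>t. f t - g t)"
    using assms(1,2)
    by (intro Henstock_Kurzweil_Integration.integral_diff[symmetric] integrable_continuous_interval)
  moreover have "norm (integral {0..T} (\<lambda>t. f t - g t)) \<le> e * (T - 0)"
    using assms by (intro integral_bound continuous_intros) auto
  ultimately show ?thesis by simp
qed

lemma tendsto_of_bound:
  fixes a :: "nat \<Rightarrow> real"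
  assumes "\<And>n. \<bar>a n - L\<bar> \<le> K / real (Suc n)"
  shows "a \<longlonglongrightarrow> L"
proof -
  have z: "(\<lambda>n. K * inverse (real (Suc n))) \<longlonglongrightarrow> 0"
    using tendsto_mult[OF tendsto_const LIMSEQ_inverse_real_of_nat] by simp
  have "(\<lambda>n. a n - L) \<longlonglongrightarrow> 0"
    by (rule Lim_null_comparison[OF _ z]) (use assms in \<open>simp add: divide_inverse\<close>)
  then show ?thesis by (simp add: LIM_zero_iff)
qed

lemma lip1_abs_le:
  assumes "lip1 y" "y 0 = 0" "0 \<le> t" "t \<le> T"
  shows "\<bar>y t\<bar> \<le> T"
  using lip1D[OF assms(1), of t 0] assms by simp

text \<open>The approximating zigzags have ever more teeth, but each is dominated by one with four
  teeth, and these range over a compact set. A limit of a subsequence has the end value and the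
  first two integrals of \<open>y\<close>, and at least its third. Four teeth are the 8
  segments.\<close>

lemma moments_reach_above:
  assumes y: "lip1 y" "y 0 = 0" and T: "T > 0"
  shows "\<exists>c\<ge>0. add_last c (moments y T) \<in> reach 8"
proof -
  define h where "h n = T / real (Suc n)" for n
  have h: "h n \<ge> 0" "real (Suc n) * h n = T" for n using T unfolding h_def by auto
  have "\<exists>f. lip1 f \<and> f T = y T \<and> moments f T \<in> zreach (Suc n) 0 \<and> (\<forall>t\<in>{0..T}. \<bar>f t - y t\<bar> \<le> 2 * h n)" for n
    using zigzag_approximation[OF y h(1), of "Suc n" n] unfolding h(2) .
  then obtain f where f: "\<And>n. lip1 (f n)" "\<And>n. f n T = y T" "\<And>n. moments (f n) T \<in> zreach (Suc n) 0"
    "\<And>n t. t \<in> {0..T} \<Longrightarrow> \<bar>f n t - y t\<bar> \<le> 2 * h n" by metis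
  have cont: "continuous_on S (f n)" "continuous_on S y" for n S
    using lip1_continuous_on f(1) y(1) by auto
  have A: "(\<lambda>n. integral {0..T} (f n)) \<longlonglongrightarrow> integral {0..T} y"
  proof (rule tendsto_of_bound)
    show "\<bar>integral {0..T} (f n) - integral {0..T} y\<bar> \<le> 2 * T * T / real (Suc n)" for n
      using integral_close[of T "f n" y "2 * h n"] cont f(4) T unfolding h_def by simp
  qed
  have B: "(\<lambda>n. integral {0..T} (\<lambda>r. r * f n r)) \<longlonglongrightarrow> integral {0..T} (\<lambda>r. r * y r)"
  proof (rule tendsto_of_bound)
    fix n
    have "\<bar>r * f n r - r * y r\<bar> \<le> T * (2 * h n)" if "r \<in> {0..T}" for r
    proof -
      have "\<bar>r\<bar> * \<bar>f n r - y r\<bar> \<le> T * (2 * h n)"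
        using that f(4)[OF that, of n] T by (intro mult_mono) auto
      then show ?thesis by (simp add: abs_mult[symmetric] right_diff_distrib)
    qed
    then show "\<bar>integral {0..T} (\<lambda>r. r * f n r) - integral {0..T} (\<lambda>r. r * y r)\<bar> \<le> 2 * T * T * T / real (Suc n)"
      using integral_close[of T "\<lambda>r. r * f n r" "\<lambda>r. r * y r" "T * (2 * h n)"] cont T
      unfolding h_def by (simp add: continuous_intros mult_ac)
  qed
  have C: "(\<lambda>n. integral {0..T} (\<lambda>r. (f n r)\<^sup>2)) \<longlonglongrightarrow> integral {0..T} (\<lambda>r. (y r)\<^sup>2)"
  proof (rule tendsto_of_bound)
    fix n
    have "\<bar>(f n r)\<^sup>2 - (y r)\<^sup>2\<bar> \<le> (4 * T) * (2 * h n)" if r: "r \<in> {0..T}" for r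
    proof -
      have "\<bar>y r\<bar> \<le> T" using lip1_abs_le[OF y, of r T] r by simp
      moreover have "h n \<le> T" using T unfolding h_def by (simp add: field_simps)
      \<comment> \<open>The sum is at most
        \<open>2 * \<bar>y r\<bar> + \<bar>f n r - y r\<bar>\<close>, hence at most
        \<open>2 * T + 2 * T\<close>.\<close>
      ultimately have "\<bar>f n r + y r\<bar> \<le> 4 * T" using f(4)[OF r, of n] by linarith
      then have "\<bar>f n r + y r\<bar> * \<bar>f n r - y r\<bar> \<le> (4 * T) * (2 * h n)"
        using f(4)[OF r, of n] T by (intro mult_mono) auto
      then show ?thesis by (simp add: abs_mult[symmetric] power2_eq_square algebra_simps)
    qed
    then show "\<bar>integral {0..T} (\<lambda>r. (f n r)\<^sup>2) - integral {0..T} (\<lambda>r. (y r)\<^sup>2)\<bar> \<le> 8 * T * T * T / real (Suc n)"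
      using integral_close[of T "\<lambda>r. (f n r)\<^sup>2" "\<lambda>r. (y r)\<^sup>2" "(4 * T) * (2 * h n)"] cont T
      unfolding h_def by (simp add: continuous_intros mult_ac)
  qed
  have "\<exists>c\<ge>0. add_last c (moments (f n) T) \<in> zreach 4 0" for n
    using zreach_four[OF f(3)] .
  then obtain c where c: "\<And>n. c n \<ge> 0" "\<And>n. add_last (c n) (moments (f n) T) \<in> zreach 4 0" by metis
  define w where "w n = add_last (c n) (moments (f n) T)" for n
  have "w n \<in> bounded_zreach T 4" for n
    using zreach_bounded[OF c(2)] unfolding w_def moments_def by simp
  then obtain l r where l: "l \<in> bounded_zreach T 4" "strict_mono (r :: nat \<Rightarrow> nat)" "(w \<circ> r) \<longlonglongrightarrow> l"
    using compact_bounded_zreach[of T 4] unfolding compact_def by blast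
  obtain l1 l2 l3 l4 l5 where l': "l = (l1, l2, l3, l4, l5)" by (cases l)
  have w: "w n = (T, y T, integral {0..T} (f n), integral {0..T} (\<lambda>r. r * f n r),
      integral {0..T} (\<lambda>r. (f n r)\<^sup>2) + c n)" for n
    unfolding w_def moments_def by (simp add: f(2))
  have L: "(\<lambda>n. w (r n)) \<longlonglongrightarrow> (l1, l2, l3, l4, l5)" using l(3) unfolding l' o_def .
  note L1 = tendsto_snd[OF L] note L2 = tendsto_snd[OF L1] note L3 = tendsto_snd[OF L2]
  have "(\<lambda>n. fst (w (r n))) \<longlonglongrightarrow> l1" "(\<lambda>n. fst (snd (w (r n)))) \<longlonglongrightarrow> l2"
    "(\<lambda>n. fst (snd (snd (w (r n))))) \<longlonglongrightarrow> l3" "(\<lambda>n. fst (snd (snd (snd (w (r n)))))) \<longlonglongrightarrow> l4"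
    "(\<lambda>n. snd (snd (snd (snd (w (r n)))))) \<longlonglongrightarrow> l5"
    using tendsto_fst[OF L] tendsto_fst[OF L1] tendsto_fst[OF L2] tendsto_fst[OF L3] tendsto_snd[OF L3]
    by (simp_all only: fst_conv snd_conv)
  then have lim: "(\<lambda>n. T) \<longlonglongrightarrow> l1" "(\<lambda>n. y T) \<longlonglongrightarrow> l2" "(\<lambda>n. integral {0..T} (f (r n))) \<longlonglongrightarrow> l3"
    "(\<lambda>n. integral {0..T} (\<lambda>s. s * f (r n) s)) \<longlonglongrightarrow> l4"
    "(\<lambda>n. integral {0..T} (\<lambda>s. (f (r n) s)\<^sup>2) + c (r n)) \<longlonglongrightarrow> l5"
    unfolding w by simp_all
  have "l1 = T" "l2 = y T" using lim(1,2) by (simp_all add: LIMSEQ_const_iff)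
  moreover have "l3 = integral {0..T} y"
    using LIMSEQ_unique[OF lim(3)] LIMSEQ_subseq_LIMSEQ[OF A l(2)] by (simp add: o_def)
  moreover have "l4 = integral {0..T} (\<lambda>r. r * y r)"
    using LIMSEQ_unique[OF lim(4)] LIMSEQ_subseq_LIMSEQ[OF B l(2)] by (simp add: o_def)
  moreover have "integral {0..T} (\<lambda>r. (y r)\<^sup>2) \<le> l5"
    using LIMSEQ_subseq_LIMSEQ[OF C l(2)] lim(5) c(1) unfolding o_def
    by (intro LIMSEQ_le[of "\<lambda>n. integral {0..T} (\<lambda>s. (f (r n) s)\<^sup>2)" _
          "\<lambda>n. integral {0..T} (\<lambda>s. (f (r n) s)\<^sup>2) + c (r n)"]) auto
  ultimately have "l = add_last (l5 - integral {0..T} (\<lambda>r. (y r)\<^sup>2)) (moments y T)"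
    "l5 - integral {0..T} (\<lambda>r. (y r)\<^sup>2) \<ge> 0"
    unfolding l' moments_def by simp_all
  moreover have "l \<in> reach 8"
    using l(1) bounded_zreach_subset zreach_subset_reach[of 4] by auto
  ultimately show ?thesis by metis
qed

section \<open>Minimising the quadratic moment\<close>

lemma lip1_affine: "\<bar>q\<bar> \<le> 1 \<Longrightarrow> lip1 (\<lambda>t. p + q * t)"
  unfolding lip1_def
proof (intro allI)
  fix a b :: real assume "\<bar>q\<bar> \<le> 1"
  then have "\<bar>q\<bar> * \<bar>a - b\<bar> \<le> 1 * \<bar>a - b\<bar>" by (intro mult_right_mono) auto
  then show "\<bar>p + q * a - (p + q * b)\<bar> \<le> \<bar>a - b\<bar>"
    by (simp add: abs_mult[symmetric] right_diff_distrib)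
qed

lemma lip1_max:
  assumes "lip1 f" "lip1 g"
  shows "lip1 (\<lambda>t. max (f t) (g t))"
  unfolding lip1_def
proof (intro allI)
  fix a b
  show "\<bar>max (f a) (g a) - max (f b) (g b)\<bar> \<le> \<bar>a - b\<bar>"
    using lip1D[OF assms(1), of a b] lip1D[OF assms(2), of a b] by linarith
qed

lemma lip1_min:
  assumes "lip1 f" "lip1 g"
  shows "lip1 (\<lambda>t. min (f t) (g t))"
  unfolding lip1_def
proof (intro allI)
  fix a b
  show "\<bar>min (f a) (g a) - min (f b) (g b)\<bar> \<le> \<bar>a - b\<bar>"
    using lip1D[OF assms(1), of a b] lip1D[OF assms(2), of a b] by linarith
qed

text \<open>The least 1-Lipschitz curve from \<open>(0, 0)\<close> to \<open>(T, Y)\<close>. The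
  lines are spelt as \<open>p + q * t\<close> so that the rules on affine functions match.\<close>

definition low_env :: "real \<Rightarrow> real \<Rightarrow> real \<Rightarrow> real" where
  "low_env T Y t = max (0 + (-1) * t) ((Y - T) + 1 * t)"

definition up_env :: "real \<Rightarrow> real \<Rightarrow> real \<Rightarrow> real" where
  "up_env T Y t = min (0 + 1 * t) ((Y + T) + (-1) * t)"

text \<open>A line is what the multipliers \<open>c\<close> and \<open>s\<close> for fixed
  \<open>A\<close> and \<open>B\<close> prescribe for a stationary point of \<open>C\<close>; the
  envelopes enforce the values at both ends.\<close>

definition clamp_line :: "real \<Rightarrow> real \<Rightarrow> real \<Rightarrow> real \<Rightarrow> real \<Rightarrow> real" where
  "clamp_line T Y s c t = max (low_env T Y t) (min (up_env T Y t) (c + s * t))"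

lemma lip1_clamp_line: "\<bar>s\<bar> \<le> 1 \<Longrightarrow> lip1 (clamp_line T Y s c)"
  unfolding clamp_line_def[abs_def] low_env_def up_env_def
  by (intro lip1_max lip1_min lip1_affine) auto

lemma clamp_line_0: "\<bar>Y\<bar> \<le> T \<Longrightarrow> clamp_line T Y s c 0 = 0"
  unfolding clamp_line_def low_env_def up_env_def by auto

lemma clamp_line_end: "\<bar>Y\<bar> \<le> T \<Longrightarrow> clamp_line T Y s c T = Y"
  unfolding clamp_line_def low_env_def up_env_def by auto

lemma env_bounds:
  assumes "lip1 y" "y 0 = 0" "0 \<le> t" "t \<le> T"
  shows "low_env T (y T) t \<le> y t" "y t \<le> up_env T (y T) t"
  using lip1D[OF assms(1), of t 0] lip1D[OF assms(1), of T t] assms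
  unfolding low_env_def up_env_def by auto

text \<open>A pair of parallel lines contributes the junk value \<open>0\<close> of the division, which is harmless.\<close>

definition crossings :: "(real \<times> real) set \<Rightarrow> real set" where
  "crossings F = (\<lambda>((p, q), (p', q')). (p' - p) / (q - q')) ` (F \<times> F)"

definition member_line :: "(real \<times> real) set \<Rightarrow> real \<Rightarrow> real \<Rightarrow> (real \<Rightarrow> real) \<Rightarrow> bool" where
  "member_line F a b f \<longleftrightarrow> (\<exists>(p, q)\<in>F. \<forall>t\<in>{a..b}. f t = p + q * t)"

lemma lines_ordered:
  assumes F: "(p, q) \<in> F" "(p', q') \<in> F" and no: "{a<..<b} \<inter> crossings F = {}"
  shows "(\<forall>t\<in>{a..b}. p + q * t \<le> p' + q' * t) \<or> (\<forall>t\<in>{a..b}. p' + q' * t \<le> p + q * t)"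
proof (cases "q = q'")
  case False
  define x where "x = (p' - p) / (q - q')"
  have "x \<in> crossings F" using F unfolding crossings_def x_def by force
  then have x: "x \<le> a \<or> b \<le> x" using no by (metis IntI emptyE greaterThanLessThan_iff not_le)
  have d: "p + q * t - (p' + q' * t) = (q - q') * (t - x)" for t
    using False unfolding x_def by (simp add: field_simps)
  have "(\<forall>t\<in>{a..b}. (q - q') * (t - x) \<le> 0) \<or> (\<forall>t\<in>{a..b}. (q - q') * (t - x) \<ge> 0)"
    using x False by (cases "q < q'") (auto simp: mult_le_0_iff zero_le_mult_iff)
  then show ?thesis unfolding d[symmetric] by auto
qed auto

text \<open>Between crossings any two lines keep their order, so the same line is selected
  throughout.\<close>

lemma member_line_max_min:
  assumes "op = max \<or> op = min"
    and "member_line F a b f" "member_line F a b g" "{a<..<b} \<inter> crossings F = {}"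
  shows "member_line F a b (\<lambda>t. op (f t) (g t))"
proof -
  obtain p q p' q' where *: "(p, q) \<in> F" "\<And>t. t \<in> {a..b} \<Longrightarrow> f t = p + q * t"
    "(p', q') \<in> F" "\<And>t. t \<in> {a..b} \<Longrightarrow> g t = p' + q' * t"
    using assms(2,3) unfolding member_line_def by blast
  have "(\<forall>t\<in>{a..b}. op (f t) (g t) = p + q * t) \<or> (\<forall>t\<in>{a..b}. op (f t) (g t) = p' + q' * t)"
    using lines_ordered[OF *(1,3) assms(4)] *(2,4) assms(1) by auto
  then show ?thesis using *(1,3) unfolding member_line_def by blast
qed

lemmas member_line_max = member_line_max_min[of max, simplified]
lemmas member_line_min = member_line_max_min[of min, simplified]

lemma member_line_self: "(p, q) \<in> F \<Longrightarrow> member_line F a b (\<lambda>t. p + q * t)"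
  unfolding member_line_def by blast

text \<open>Induction on the number of breakpoints before \<open>t\<close>, cutting off the piece
  after the last one. The successor counts segments instead of interior breakpoints.\<close>

lemma moments_piecewise_affine:
  assumes f: "lip1 f" "f 0 = 0" and S: "finite S"
    and aff: "\<And>a b. {a<..<b} \<inter> S = {} \<Longrightarrow> \<exists>p q. \<forall>t\<in>{a..b}. f t = p + q * t"
    and "0 \<le> t"
  shows "moments f t \<in> reach (Suc (card (S \<inter> {0<..<t})))"
  using \<open>0 \<le> t\<close>
proof (induction "card (S \<inter> {0<..<t})" arbitrary: t rule: less_induct)
  case less
  have step: "moments f t \<in> reach (Suc n)"
    if a: "0 \<le> a" "a \<le> t" "{a<..<t} \<inter> S = {}" "moments f a \<in> reach n" for a n
  proof -
    obtain p q where pq: "\<And>r. r \<in> {a..t} \<Longrightarrow> f r = p + q * r" using aff[OF a(3)] by blast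
    have "moments f (a + (t - a)) = line_step (t - a) (q * (t - a)) (moments f a)"
      using a pq lip1_continuous_on[OF f(1)] by (intro moments_affine) (auto simp: algebra_simps)
    moreover have "q * (t - a) = f t - f a" using pq a(2) by (simp add: algebra_simps)
    then have "\<bar>q * (t - a)\<bar> \<le> t - a" using lip1D[OF f(1), of t a] a(2) by simp
    ultimately show ?thesis using reach_SucI[OF a(4)] by simp
  qed
  have fin: "finite (S \<inter> {0<..<t})" using S by simp
  show ?case
  proof (cases "S \<inter> {0<..<t} = {}")
    case True
    then show ?thesis using step[of 0 0] less.prems moments_0[of f, OF f(2)] by (simp add: Int_commute)
  next
    case False
    define a where "a = Max (S \<inter> {0<..<t})"
    have a: "a \<in> S" "0 < a" "a < t" using Max_in[OF fin False] unfolding a_def by auto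
    have max: "x \<le> a" if "x \<in> S" "0 < x" "x < t" for x
      unfolding a_def using that fin by (intro Max_ge) auto
    have "S \<inter> {0<..<a} = (S \<inter> {0<..<t}) - {a}" using a max by force
    then have card: "Suc (card (S \<inter> {0<..<a})) = card (S \<inter> {0<..<t})"
      using a fin by (metis IntI card_Suc_Diff1 greaterThanLessThan_iff)
    moreover have "{a<..<t} \<inter> S = {}" using max a by force
    ultimately show ?thesis
      using step[of a "Suc (card (S \<inter> {0<..<a}))"] less.hyps[of a] a by simp
  qed
qed

lemma moments_clamp_line:
  assumes "\<bar>s\<bar> \<le> 1" "\<bar>Y\<bar> \<le> T"
  shows "moments (clamp_line T Y s c) T \<in> reach 26"
proof -
  \<comment> \<open>Two lines for each envelope and the clamped line. The \<open>5 * 5\<close> pairs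
    give at most 25 crossings, hence at most 26 segments.\<close>
  define F where "F = set [(0, -1), (Y - T, 1), (0, 1), (Y + T, -1), (c, s)]"
  have "card F \<le> 5"
    unfolding F_def using card_length[of "[(0, -1), (Y - T, 1), (0, 1), (Y + T, -1), (c, s)]"] by simp
  then have "card F * card F \<le> 5 * 5" by (intro mult_mono) auto
  moreover have finF: "finite F" unfolding F_def by simp
  ultimately have card: "card (crossings F) \<le> 25"
    using card_image_le[of "F \<times> F" "\<lambda>((p, q), (p', q')). (p' - p) / (q - q')"]
    unfolding crossings_def by (simp add: card_cartesian_product)
  have fin: "finite (crossings F)" using finF unfolding crossings_def by simp
  have aff: "\<exists>p q. \<forall>t\<in>{a..b}. clamp_line T Y s c t = p + q * t"
    if no: "{a<..<b} \<inter> crossings F = {}" for a b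
  proof -
    have "member_line F a b (clamp_line T Y s c)"
      unfolding clamp_line_def[abs_def] low_env_def up_env_def
      by (intro member_line_max member_line_min member_line_self no) (auto simp: F_def)
    then show ?thesis unfolding member_line_def by blast
  qed
  have "moments (clamp_line T Y s c) T \<in> reach (Suc (card (crossings F \<inter> {0<..<T})))"
    using assms lip1_clamp_line clamp_line_0 by (intro moments_piecewise_affine fin aff) auto
  moreover have "Suc (card (crossings F \<inter> {0<..<T})) \<le> 26"
    using card_mono[OF fin, of "crossings F \<inter> {0<..<T}"] card by simp
  ultimately show ?thesis using reach_mono by blast
qed

text \<open>The function \<open>d\<close> passes from nonnegative to nonpositive values at some
  \<open>t0\<close>, so \<open>(t - t0) * d t \<le> 0\<close>, and the term with \<open>t0\<close>
  integrates to zero.\<close>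

lemma integral_mult_id_single_sign_change:
  fixes d :: "real \<Rightarrow> real"
  assumes d: "continuous_on {0..T} d" "integral {0..T} d = 0"
    and change: "\<And>a b. 0 \<le> a \<Longrightarrow> a < b \<Longrightarrow> b \<le> T \<Longrightarrow> d a < 0 \<Longrightarrow> d b \<le> 0"
  shows "integral {0..T} (\<lambda>t. t * d t) \<le> 0"
proof -
  have "\<exists>t0. \<forall>t\<in>{0..T}. (t - t0) * d t \<le> 0"
  proof (cases "\<exists>a\<in>{0..T}. d a < 0")
    case False
    then have "\<forall>t\<in>{0..T}. (t - T) * d t \<le> 0"
      by (auto simp: mult_le_0_iff not_less)
    then show ?thesis ..
  next
    case True
    define N where "N = {a\<in>{0..T}. d a < 0}"
    have N: "N \<noteq> {}" "bdd_below N" using True unfolding N_def by (auto intro: bdd_belowI[of _ 0])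
    have "(t - Inf N) * d t \<le> 0" if t: "t \<in> {0..T}" for t
    proof (cases t "Inf N" rule: linorder_cases)
      case less
      then have "t \<notin> N" using cInf_lower[OF _ N(2), of t] by auto
      then have "d t \<ge> 0" using t unfolding N_def by auto
      then show ?thesis using less by (simp add: mult_le_0_iff)
    next
      case greater
      then obtain a where "a \<in> N" "a < t" using cInf_lessD[OF N(1)] by blast
      then have "d t \<le> 0" using change[of a t] t unfolding N_def by auto
      then show ?thesis using greater by (simp add: mult_le_0_iff)
    qed simp
    then show ?thesis by blast
  qed
  then obtain t0 where t0: "\<And>t. t \<in> {0..T} \<Longrightarrow> (t - t0) * d t \<le> 0" by blast
  have int: "(\<lambda>t. t * d t) integrable_on {0..T}" "(\<lambda>t. t0 * d t) integrable_on {0..T}"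
    using d(1) by (auto intro!: integrable_continuous_interval continuous_intros)
  have "integral {0..T} (\<lambda>t. t * d t) - t0 * integral {0..T} d = integral {0..T} (\<lambda>t. (t - t0) * d t)"
    using Henstock_Kurzweil_Integration.integral_diff[OF int] by (simp add: left_diff_distrib)
  also have "\<dots> \<le> integral {0..T} (\<lambda>t. 0)"
    using d(1) by (intro integral_le integrable_continuous_interval continuous_intros t0)
  finally show ?thesis using d(2) by simp
qed

lemma integral_eq_imp_eq:
  fixes f g :: "real \<Rightarrow> real"
  assumes "continuous_on {0..T} f" "continuous_on {0..T} g" "T > 0"
    and le: "\<And>t. t \<in> {0..T} \<Longrightarrow> f t \<le> g t" and eq: "integral {0..T} f = integral {0..T} g"
    and t: "t \<in> {0..T}"
  shows "f t = g t"
proof -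
  have int: "f integrable_on {0..T}" "g integrable_on {0..T}"
    using assms(1,2) by (auto intro: integrable_continuous_interval)
  have "((\<lambda>t. g t - f t) has_integral 0) (cbox 0 T)"
    using has_integral_diff[OF integrable_integral[OF int(2)] integrable_integral[OF int(1)]] eq by simp
  then have "g t - f t = 0"
    using assms by (intro has_integral_0_cbox_imp_0[of 0 T "\<lambda>t. g t - f t"]) (auto intro!: continuous_intros)
  then show ?thesis by simp
qed

text \<open>For every slope \<open>s\<close> in \<open>{-1..1}\<close> some \<open>c\<close> gives
  the right \<open>A\<close>. Even if \<open>c\<close> is not unique, the clamped curve on
  \<open>{0..T}\<close> is, so \<open>B\<close> depends on \<open>s\<close> alone. It is at most
  \<open>b\<close> for slope -1 and at least \<open>b\<close> for slope 1. The slopes of either kind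
  form closed sets \<open>P\<close> and \<open>Q\<close> that cover the interval; if
  \<open>b\<close> were never attained they would disconnect it. No continuous choice of
  \<open>c\<close> is required.\<close>

lemma clamp_line_exists:
  assumes y: "lip1 y" "y 0 = 0" and T: "T > 0"
  shows "\<exists>s c. \<bar>s\<bar> \<le> 1 \<and> integral {0..T} (clamp_line T (y T) s c) = integral {0..T} y \<and>
    integral {0..T} (\<lambda>t. t * clamp_line T (y T) s c t) = integral {0..T} (\<lambda>t. t * y t)"
proof (rule ccontr)
  assume neg: "\<not> ?thesis"
  define Y where "Y = y T"
  have Y: "\<bar>Y\<bar> \<le> T" using lip1_abs_le[OF y, of T T] T unfolding Y_def by simp
  define A where "A s c = integral {0..T} (clamp_line T Y s c)" for s c
  define B where "B s c = integral {0..T} (\<lambda>t. t * clamp_line T Y s c t)" for s c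
  define a where "a = integral {0..T} y"
  define b where "b = integral {0..T} (\<lambda>t. t * y t)"
  have ne: "B s c \<noteq> b" if "\<bar>s\<bar> \<le> 1" "A s c = a" for s c
    using neg that unfolding A_def B_def a_def b_def Y_def by blast
  have conty: "continuous_on S y" for S using lip1_continuous_on[OF y(1)] .
  have contc: "continuous_on S (clamp_line T Y s c)" for S s c
    unfolding clamp_line_def[abs_def] low_env_def up_env_def by (intro continuous_intros)
  have contA: "continuous_on UNIV (\<lambda>p. A (fst p) (snd p))"
    unfolding A_def clamp_line_def[abs_def] low_env_def up_env_def cbox_interval[symmetric]
    by (intro integral_continuous_on_param) (auto simp: case_prod_beta intro!: continuous_intros)
  have contB: "continuous_on UNIV (\<lambda>p. B (fst p) (snd p))"
    unfolding B_def clamp_line_def[abs_def] low_env_def up_env_def cbox_interval[symmetric]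
    by (intro integral_continuous_on_param) (auto simp: case_prod_beta intro!: continuous_intros)
  \<comment> \<open>At \<open>c = - 2 * T\<close> and \<open>c = 2 * T\<close> the line lies below,
    respectively above, all admissible values, so this range suffices. Its compactness makes the
    projections \<open>P\<close> and \<open>Q\<close> closed.\<close>
  define E where "E = ({-1..1} \<times> {-2 * T..2 * T}) \<inter> {p. A (fst p) (snd p) = a}"
  have "compact E"
    unfolding E_def by (intro compact_Int_closed compact_Times compact_Icc closed_Collect_eq contA continuous_intros)
  then have comp: "compact (E \<inter> {p. B (fst p) (snd p) \<le> b})" "compact (E \<inter> {p. b \<le> B (fst p) (snd p)})"
    by (intro compact_Int_closed closed_Collect_le contB continuous_intros; assumption?)+
  define P where "P = fst ` (E \<inter> {p. B (fst p) (snd p) \<le> b})"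
  define Q where "Q = fst ` (E \<inter> {p. b \<le> B (fst p) (snd p)})"
  have closed: "closed P" "closed Q"
    unfolding P_def Q_def
    by (rule compact_imp_closed[OF compact_continuous_image[OF continuous_on_fst[OF continuous_on_id]]], fact comp)+
  have env: "low_env T Y t \<le> y t" "y t \<le> up_env T Y t" if "t \<in> {0..T}" for t
    using env_bounds[OF y] that unfolding Y_def by auto
  have ex: "\<exists>c. (s, c) \<in> E" if s: "s \<in> {-1..1}" for s
  proof -
    have st: "\<bar>s * t\<bar> \<le> T" if "t \<in> {0..T}" for t
      using s that mult_mono[of "\<bar>s\<bar>" 1 "\<bar>t\<bar>" T] by (auto simp: abs_mult)
    have "A s (-2 * T) \<le> a"
      unfolding A_def a_def
    proof (intro integral_le integrable_continuous_interval contc conty)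
      fix t assume t: "t \<in> {0..T}"
      have "- T \<le> low_env T Y t" using t Y unfolding low_env_def by auto
      then show "clamp_line T Y s (-2 * T) t \<le> y t"
        using env[OF t] st[OF t] unfolding clamp_line_def by linarith
    qed
    moreover have "a \<le> A s (2 * T)"
      unfolding A_def a_def
    proof (intro integral_le integrable_continuous_interval contc conty)
      fix t assume t: "t \<in> {0..T}"
      have "up_env T Y t \<le> T" using t Y unfolding up_env_def by auto
      then show "y t \<le> clamp_line T Y s (2 * T) t"
        using env[OF t] st[OF t] unfolding clamp_line_def by linarith
    qed
    moreover have "continuous_on {-2 * T..2 * T} (\<lambda>c. A (fst (s, c)) (snd (s, c)))"
      by (rule continuous_on_compose2[OF contA]) (auto intro!: continuous_intros)
    then have "continuous_on {-2 * T..2 * T} (A s)" by simp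
    ultimately obtain c where "-2 * T \<le> c" "c \<le> 2 * T" "A s c = a"
      using IVT'[of "A s" "-2 * T" a "2 * T"] T by auto
    then show ?thesis using s unfolding E_def by auto
  qed
  have disj: "P \<inter> Q = {}"
  proof (rule ccontr)
    assume "P \<inter> Q \<noteq> {}"
    then obtain s c1 c2 where *: "(s, c1) \<in> E" "(s, c2) \<in> E" "B s c1 \<le> b" "b \<le> B s c2"
      unfolding P_def Q_def by auto
    \<comment> \<open>The clamped curve is monotone in \<open>c\<close>, so two of them with equal
      integrals coincide.\<close>
    have same: "B s c = B s c'" if "c \<le> c'" "A s c = A s c'" for c c'
    proof -
      have "clamp_line T Y s c t = clamp_line T Y s c' t" if t: "t \<in> {0..T}" for t
        using \<open>A s c = A s c'\<close> \<open>c \<le> c'\<close> t T unfolding A_def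
        by (intro integral_eq_imp_eq[OF contc contc]) (auto simp: clamp_line_def)
      then show ?thesis
        unfolding B_def by (intro Henstock_Kurzweil_Integration.integral_cong) simp
    qed
    have "A s c1 = a" "A s c2 = a" using * unfolding E_def by auto
    then have "B s c1 = B s c2" using same[of c1 c2] same[of c2 c1] by (metis linear)
    then have "B s c1 = b" using * by simp
    moreover have "\<bar>s\<bar> \<le> 1" using *(1) unfolding E_def by auto
    ultimately show False using ne \<open>A s c1 = a\<close> by blast
  qed
  have cover: "{-1..1} \<subseteq> P \<union> Q"
  proof
    fix s :: real assume "s \<in> {-1..1}"
    then obtain c where c: "(s, c) \<in> E" using ex by blast
    consider "B s c \<le> b" | "b \<le> B s c" by linarith
    then show "s \<in> P \<union> Q"
      unfolding P_def Q_def using c by cases force+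
  qed
  have diff: "integral {0..T} (\<lambda>t. t * (f t - g t)) = integral {0..T} (\<lambda>t. t * f t) - integral {0..T} (\<lambda>t. t * g t)"
    "integral {0..T} (\<lambda>t. f t - g t) = integral {0..T} f - integral {0..T} g"
    if "continuous_on {0..T} f" "continuous_on {0..T} g" for f g :: "real \<Rightarrow> real"
    using that
    by (auto simp: right_diff_distrib intro!: Henstock_Kurzweil_Integration.integral_diff
        integrable_continuous_interval continuous_intros)
  \<comment> \<open>A 1-Lipschitz curve cannot overtake a line of slope 1: once \<open>y\<close> is
    below the clamped line it never gets above it again. So the difference changes sign at most
    once. Slope -1 is dual.\<close>
  have "1 \<in> Q"
  proof -
    obtain c where c: "(1, c) \<in> E" using ex[of 1] by auto
    then have Aa: "A 1 c = a" unfolding E_def by auto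
    let ?d = "\<lambda>t. y t - clamp_line T Y 1 c t"
    have "integral {0..T} (\<lambda>t. t * ?d t) \<le> 0"
    proof (rule integral_mult_id_single_sign_change)
      show "continuous_on {0..T} ?d" by (intro continuous_intros conty contc)
      show "integral {0..T} ?d = 0" using Aa unfolding diff(2)[OF conty contc] A_def a_def by simp
      fix r t assume rt: "0 \<le> r" "r < t" "t \<le> T" "?d r < 0"
      have "clamp_line T Y 1 c r \<le> c + r"
        using rt env(1)[of r] unfolding clamp_line_def by auto
      moreover have "y t \<le> y r + (t - r)" using lip1D[OF y(1), of t r] rt by simp
      ultimately have "y t \<le> c + 1 * t" using rt by simp
      then show "?d t \<le> 0" using env(2)[of t] rt unfolding clamp_line_def by auto
    qed
    then have "b \<le> B 1 c" unfolding diff(1)[OF conty contc] B_def b_def by simp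
    then show ?thesis using c unfolding Q_def by force
  qed
  moreover have "-1 \<in> P"
  proof -
    obtain c where c: "(-1, c) \<in> E" using ex[of "-1"] by auto
    then have Aa: "A (-1) c = a" unfolding E_def by auto
    let ?d = "\<lambda>t. clamp_line T Y (-1) c t - y t"
    have "integral {0..T} (\<lambda>t. t * ?d t) \<le> 0"
    proof (rule integral_mult_id_single_sign_change)
      show "continuous_on {0..T} ?d" by (intro continuous_intros conty contc)
      show "integral {0..T} ?d = 0" using Aa unfolding diff(2)[OF contc conty] A_def a_def by simp
      fix r t assume rt: "0 \<le> r" "r < t" "t \<le> T" "?d r < 0"
      have "c - r \<le> clamp_line T Y (-1) c r"
        using rt env(2)[of r] unfolding clamp_line_def by auto
      moreover have "y r - (t - r) \<le> y t" using lip1D[OF y(1), of t r] rt by simp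
      ultimately have "c + (-1) * t \<le> y t" using rt by simp
      then show "?d t \<le> 0" using env(1)[of t] rt unfolding clamp_line_def by auto
    qed
    then have "B (-1) c \<le> b" unfolding diff(1)[OF contc conty] B_def b_def by simp
    then show ?thesis using c unfolding P_def by force
  qed
  moreover have "1 \<in> {-1..1::real}" "-1 \<in> {-1..1::real}" by simp_all
  ultimately have "{-1..1} \<inter> P \<noteq> {}" "{-1..1} \<inter> Q \<noteq> {}" by blast+
  then have "\<not> connected {-1..1::real}"
    using closed disj cover unfolding connected_closed by blast
  then show False by simp
qed

text \<open>Clamping a line between the extremal curves minimises \<open>\<integral>y\<^sup>2\<close>: where the clamped line
  differs from the line, it lies between the line and every other admissible curve.\<close>

lemma moments_reach_below:
  assumes y: "lip1 y" "y 0 = 0" and T: "T > 0"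
  shows "\<exists>c\<ge>0. add_last (- c) (moments y T) \<in> reach 26"
proof -
  define Y where "Y = y T"
  have Y: "\<bar>Y\<bar> \<le> T" using lip1_abs_le[OF y, of T T] T unfolding Y_def by simp
  obtain s c where s: "\<bar>s\<bar> \<le> 1"
    and A: "integral {0..T} (clamp_line T Y s c) = integral {0..T} y"
    and B: "integral {0..T} (\<lambda>t. t * clamp_line T Y s c t) = integral {0..T} (\<lambda>t. t * y t)"
    using clamp_line_exists[OF y T] unfolding Y_def by blast
  define f where "f = clamp_line T Y s c"
  have cont: "continuous_on S f" "continuous_on S y" for S
    using lip1_continuous_on lip1_clamp_line[OF s] y(1) unfolding f_def by blast+
  have int: "g integrable_on {0..T}" if "continuous_on {0..T} g" for g :: "real \<Rightarrow> real"
    using that by (rule integrable_continuous_interval)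
  have hi: "(g has_integral integral {0..T} g) {0..T}" if "continuous_on {0..T} g" for g :: "real \<Rightarrow> real"
    using int[OF that] by (rule integrable_integral)
  \<comment> \<open>The subtracted terms integrate to zero since \<open>f\<close> and
    \<open>y\<close> share the first two integrals. They turn the integrand into a pointwise
    nonnegative one.\<close>
  have "((\<lambda>t. (y t)\<^sup>2 - (f t)\<^sup>2 - 2 * (c * (y t - f t) + s * (t * y t - t * f t))) has_integral
      (integral {0..T} (\<lambda>t. (y t)\<^sup>2) - integral {0..T} (\<lambda>t. (f t)\<^sup>2)
        - 2 * (c * (integral {0..T} y - integral {0..T} f)
          + s * (integral {0..T} (\<lambda>t. t * y t) - integral {0..T} (\<lambda>t. t * f t))))) {0..T}"
    by (intro has_integral_diff has_integral_mult_right has_integral_add hi continuous_intros cont)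
  then have "((\<lambda>t. (y t)\<^sup>2 - (f t)\<^sup>2 - 2 * (c * (y t - f t) + s * (t * y t - t * f t))) has_integral
      (integral {0..T} (\<lambda>t. (y t)\<^sup>2) - integral {0..T} (\<lambda>t. (f t)\<^sup>2))) {0..T}"
    using A B unfolding f_def by simp
  moreover have "(y t)\<^sup>2 - (f t)\<^sup>2 - 2 * (c * (y t - f t) + s * (t * y t - t * f t)) \<ge> 0" if t: "t \<in> {0..T}" for t
  proof -
    have env: "low_env T Y t \<le> y t" "y t \<le> up_env T Y t"
      using env_bounds[OF y] t unfolding Y_def by auto
    then have "(y t \<ge> f t \<and> f t \<ge> c + s * t) \<or> (y t \<le> f t \<and> f t \<le> c + s * t)"
      unfolding f_def clamp_line_def by linarith
    then have "(y t - f t) * (f t - (c + s * t)) \<ge> 0"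
      by (auto simp: zero_le_mult_iff)
    moreover have "(y t)\<^sup>2 - (f t)\<^sup>2 - 2 * (c * (y t - f t) + s * (t * y t - t * f t))
        = (y t - f t)\<^sup>2 + 2 * ((y t - f t) * (f t - (c + s * t)))"
      by (simp add: power2_eq_square algebra_simps)
    ultimately show ?thesis by simp
  qed
  ultimately have ge: "integral {0..T} (\<lambda>t. (y t)\<^sup>2) - integral {0..T} (\<lambda>t. (f t)\<^sup>2) \<ge> 0"
    by (rule has_integral_nonneg)
  have "moments f T = add_last (- (integral {0..T} (\<lambda>t. (y t)\<^sup>2) - integral {0..T} (\<lambda>t. (f t)\<^sup>2))) (moments y T)"
    using A B clamp_line_end[OF Y] unfolding moments_def f_def Y_def by simp
  then show ?thesis
    using ge moments_clamp_line[OF s Y, of c] unfolding f_def by metis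
qed

section \<open>Absolutely continuous functions\<close>

lemma division_Sup_Inf:
  fixes D :: "real set set"
  assumes "D division_of \<Union>D" "\<Union>D \<subseteq> {a..b}" "k \<in> D"
  shows "Inf k \<in> {a..b}" "Sup k \<in> {a..b}" "Inf k \<le> Sup k" "k = {Inf k..Sup k}"
proof -
  obtain c d where k: "k = {c..d}" using division_ofD(4)[OF assms(1,3)] unfolding cbox_interval by blast
  moreover have "k \<noteq> {}" using division_ofD(3)[OF assms(1,3)] .
  ultimately have cd: "c \<le> d" by simp
  then have eq: "Inf k = c" "Sup k = d" unfolding k by simp_all
  have sub: "{c..d} \<subseteq> {a..b}" using assms(2,3) unfolding k[symmetric] by blast
  show "Inf k \<in> {a..b}" "Sup k \<in> {a..b}" "Inf k \<le> Sup k" "k = {Inf k..Sup k}"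
    unfolding eq using cd sub k by auto
qed

lemma abs_continuousD:
  assumes "abs_continuous_on_interval a b f" "\<epsilon> > 0"
  obtains \<delta> where "\<delta> > 0" "\<And>D. D division_of \<Union>D \<Longrightarrow> \<Union>D \<subseteq> {a..b} \<Longrightarrow>
      (\<Sum>k\<in>D. Sup k - Inf k) < \<delta> \<Longrightarrow> (\<Sum>k\<in>D. norm (f (Sup k) - f (Inf k))) < \<epsilon>"
  using assms unfolding abs_continuous_on_interval_def by meson

text \<open>The common source of the closure rules below, with \<open>f = g\<close> where there is
  only one argument.\<close>

lemma abs_continuous_dominated:
  assumes f: "abs_continuous_on_interval a b f" and g: "abs_continuous_on_interval a b g" and M: "M > 0"
    and le: "\<And>s t. s \<in> {a..b} \<Longrightarrow> t \<in> {a..b} \<Longrightarrow>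
        norm (h t - h s) \<le> M * (norm (f t - f s) + norm (g t - g s))"
  shows "abs_continuous_on_interval a b h"
  unfolding abs_continuous_on_interval_def
proof (intro allI impI)
  fix \<epsilon> :: real assume "\<epsilon> > 0"
  then have e: "\<epsilon> / (2 * M) > 0" using M by simp
  obtain \<delta>1 where d1: "\<delta>1 > 0" "\<And>D. D division_of \<Union>D \<Longrightarrow> \<Union>D \<subseteq> {a..b} \<Longrightarrow>
      (\<Sum>k\<in>D. Sup k - Inf k) < \<delta>1 \<Longrightarrow> (\<Sum>k\<in>D. norm (f (Sup k) - f (Inf k))) < \<epsilon> / (2 * M)"
    using abs_continuousD[OF f e] by blast
  obtain \<delta>2 where d2: "\<delta>2 > 0" "\<And>D. D division_of \<Union>D \<Longrightarrow> \<Union>D \<subseteq> {a..b} \<Longrightarrow>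
      (\<Sum>k\<in>D. Sup k - Inf k) < \<delta>2 \<Longrightarrow> (\<Sum>k\<in>D. norm (g (Sup k) - g (Inf k))) < \<epsilon> / (2 * M)"
    using abs_continuousD[OF g e] by blast
  show "\<exists>\<delta>>0. \<forall>D. D division_of \<Union>D \<longrightarrow> \<Union>D \<subseteq> {a..b} \<longrightarrow>
        (\<Sum>k\<in>D. Sup k - Inf k) < \<delta> \<longrightarrow> (\<Sum>k\<in>D. norm (h (Sup k) - h (Inf k))) < \<epsilon>"
  proof (intro exI[of _ "min \<delta>1 \<delta>2"] conjI allI impI)
    show "min \<delta>1 \<delta>2 > 0" using d1(1) d2(1) by simp
    fix D :: "real set set"
    assume D: "D division_of \<Union>D" "\<Union>D \<subseteq> {a..b}" "(\<Sum>k\<in>D. Sup k - Inf k) < min \<delta>1 \<delta>2"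
    have "(\<Sum>k\<in>D. norm (h (Sup k) - h (Inf k)))
        \<le> (\<Sum>k\<in>D. M * (norm (f (Sup k) - f (Inf k)) + norm (g (Sup k) - g (Inf k))))"
      using division_Sup_Inf[OF D(1,2)] by (intro sum_mono le) auto
    also have "\<dots> = M * ((\<Sum>k\<in>D. norm (f (Sup k) - f (Inf k))) + (\<Sum>k\<in>D. norm (g (Sup k) - g (Inf k))))"
      by (simp add: sum_distrib_left[symmetric] sum.distrib)
    also have "\<dots> < M * (\<epsilon> / (2 * M) + \<epsilon> / (2 * M))"
      using d1(2)[OF D(1,2)] d2(2)[OF D(1,2)] D(3) M by (intro mult_strict_left_mono add_strict_mono) auto
    also have "\<dots> = \<epsilon>" using M by simp
    finally show "(\<Sum>k\<in>D. norm (h (Sup k) - h (Inf k))) < \<epsilon>" .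
  qed
qed

lemma abs_continuous_lipschitz:
  fixes f :: "real \<Rightarrow> 'a::real_normed_vector"
  assumes "\<And>s t. s \<in> {a..b} \<Longrightarrow> t \<in> {a..b} \<Longrightarrow> norm (f t - f s) \<le> K * \<bar>t - s\<bar>"
  shows "abs_continuous_on_interval a b f"
proof -
  have id: "abs_continuous_on_interval a b (\<lambda>t::real. t)"
    unfolding abs_continuous_on_interval_def
  proof (intro allI impI)
    fix \<epsilon> :: real assume "\<epsilon> > 0"
    moreover have "(\<Sum>k\<in>D. norm (Sup k - Inf k)) = (\<Sum>k\<in>D. Sup k - Inf k)"
      if "D division_of \<Union>D" "\<Union>D \<subseteq> {a..b}" for D :: "real set set"
      using division_Sup_Inf(3)[OF that] by (intro sum.cong) auto
    ultimately show "\<exists>\<delta>>0. \<forall>D. D division_of \<Union>D \<longrightarrow> \<Union>D \<subseteq> {a..b} \<longrightarrow>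
        (\<Sum>k\<in>D. Sup k - Inf k) < \<delta> \<longrightarrow> (\<Sum>k\<in>D. norm (Sup k - Inf k)) < \<epsilon>"
      by (intro exI[of _ \<epsilon>]) auto
  qed
  have "norm (f t - f s) \<le> (\<bar>K\<bar> + 1) * (norm (t - s) + norm (t - s))"
    if "s \<in> {a..b}" "t \<in> {a..b}" for s t
  proof -
    have "K * \<bar>t - s\<bar> \<le> (\<bar>K\<bar> + 1) * \<bar>t - s\<bar>" by (intro mult_right_mono) auto
    then have "norm (f t - f s) \<le> (\<bar>K\<bar> + 1) * \<bar>t - s\<bar>" using assms[OF that] by linarith
    moreover have "0 \<le> (\<bar>K\<bar> + 1) * \<bar>t - s\<bar>" by simp
    ultimately show ?thesis unfolding real_norm_def distrib_left by linarith
  qed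
  then show ?thesis
    by (intro abs_continuous_dominated[OF id id, of "\<bar>K\<bar> + 1"]) auto
qed

lemma abs_continuous_add:
  assumes "abs_continuous_on_interval a b f" "abs_continuous_on_interval a b g"
  shows "abs_continuous_on_interval a b (\<lambda>t. f t + g t)"
  by (rule abs_continuous_dominated[OF assms, of 1])
    (auto simp: add_diff_add intro: norm_triangle_ineq)

lemma abs_continuous_diff:
  assumes "abs_continuous_on_interval a b f" "abs_continuous_on_interval a b g"
  shows "abs_continuous_on_interval a b (\<lambda>t. f t - g t)"
proof (rule abs_continuous_dominated[OF assms, of 1])
  fix s t
  have eq: "f t - g t - (f s - g s) = (f t - f s) - (g t - g s)" by simp
  show "norm (f t - g t - (f s - g s)) \<le> 1 * (norm (f t - f s) + norm (g t - g s))"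
    unfolding eq mult_1 by (rule norm_triangle_ineq4)
qed simp

lemma abs_continuous_bounded_linear:
  assumes "abs_continuous_on_interval a b f" "bounded_linear h"
  shows "abs_continuous_on_interval a b (\<lambda>t. h (f t))"
proof -
  obtain K where K: "K > 0" "\<And>x. norm (h x) \<le> norm x * K"
    using bounded_linear.pos_bounded[OF assms(2)] by blast
  have "norm (h (f t) - h (f s)) \<le> K * (norm (f t - f s) + norm (f t - f s))" for s t
  proof -
    have "norm (h (f t) - h (f s)) \<le> norm (f t - f s) * K"
      using K(2)[of "f t - f s"] by (simp add: linear_diff[OF bounded_linear.linear[OF assms(2)]])
    moreover have "0 \<le> norm (f t - f s) * K" using K(1) by simp
    ultimately show ?thesis by (simp add: algebra_simps)
  qed
  then show ?thesis using K(1) by (intro abs_continuous_dominated[OF assms(1) assms(1)])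
qed

lemma abs_continuous_mult:
  fixes f g :: "real \<Rightarrow> real"
  assumes f: "abs_continuous_on_interval a b f" and g: "abs_continuous_on_interval a b g"
    and M: "\<And>t. t \<in> {a..b} \<Longrightarrow> \<bar>f t\<bar> \<le> M" "\<And>t. t \<in> {a..b} \<Longrightarrow> \<bar>g t\<bar> \<le> M"
  shows "abs_continuous_on_interval a b (\<lambda>t. f t * g t)"
proof (rule abs_continuous_dominated[OF f g, of "\<bar>M\<bar> + 1"])
  fix s t assume st: "s \<in> {a..b}" "t \<in> {a..b}"
  have "f t * g t - f s * g s = f t * (g t - g s) + g s * (f t - f s)" by (simp add: algebra_simps)
  then have "\<bar>f t * g t - f s * g s\<bar> \<le> \<bar>f t\<bar> * \<bar>g t - g s\<bar> + \<bar>g s\<bar> * \<bar>f t - f s\<bar>"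
    using abs_triangle_ineq[of "f t * (g t - g s)" "g s * (f t - f s)"] by (simp add: abs_mult)
  also have "\<dots> \<le> (\<bar>M\<bar> + 1) * \<bar>g t - g s\<bar> + (\<bar>M\<bar> + 1) * \<bar>f t - f s\<bar>"
    using M(1)[OF st(2)] M(2)[OF st(1)] by (intro add_mono mult_right_mono) auto
  finally show "norm (f t * g t - f s * g s) \<le> (\<bar>M\<bar> + 1) * (norm (f t - f s) + norm (g t - g s))"
    by (simp add: algebra_simps)
qed simp

lemma abs_continuous_imp_continuous_on:
  assumes f: "abs_continuous_on_interval a b f"
  shows "continuous_on {a..b} f"
  unfolding continuous_on_iff
proof (intro ballI allI impI)
  fix t \<epsilon> :: real assume t: "t \<in> {a..b}" and "\<epsilon> > 0"
  then obtain \<delta> where d: "\<delta> > 0" "\<And>D. D division_of \<Union>D \<Longrightarrow> \<Union>D \<subseteq> {a..b} \<Longrightarrow>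
      (\<Sum>k\<in>D. Sup k - Inf k) < \<delta> \<Longrightarrow> (\<Sum>k\<in>D. norm (f (Sup k) - f (Inf k))) < \<epsilon>"
    using abs_continuousD[OF f] by blast
  have *: "norm (f v - f u) < \<epsilon>" if "u \<in> {a..b}" "v \<in> {a..b}" "u \<le> v" "v - u < \<delta>" for u v
  proof -
    have "{cbox u v} division_of cbox u v" using that(3) by (intro division_of_self) auto
    then show ?thesis using d(2)[of "{{u..v}}"] that by auto
  qed
  have "dist (f s) (f t) < \<epsilon>" if "s \<in> {a..b}" "dist s t < \<delta>" for s
    using *[of s t] *[of t s] that t by (cases "s \<le> t") (auto simp: dist_norm norm_minus_commute)
  then show "\<exists>d>0. \<forall>s\<in>{a..b}. dist s t < d \<longrightarrow> dist (f s) (f t) < \<epsilon>"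
    using d(1) by blast
qed

lemma abs_continuous_bound:
  fixes f :: "real \<Rightarrow> real"
  assumes "abs_continuous_on_interval a b f"
  shows "\<exists>M. \<forall>t\<in>{a..b}. \<bar>f t\<bar> \<le> M"
  using compact_imp_bounded[OF compact_continuous_image[OF abs_continuous_imp_continuous_on[OF assms] compact_Icc]]
  unfolding bounded_iff by auto

lemma abs_continuous_times:
  fixes f g :: "real \<Rightarrow> real"
  assumes f: "abs_continuous_on_interval a b f" and g: "abs_continuous_on_interval a b g"
  shows "abs_continuous_on_interval a b (\<lambda>t. f t * g t)"
proof -
  obtain M N where "\<forall>t\<in>{a..b}. \<bar>f t\<bar> \<le> M" "\<forall>t\<in>{a..b}. \<bar>g t\<bar> \<le> N"
    using abs_continuous_bound[OF f] abs_continuous_bound[OF g] by blast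
  then show ?thesis
    by (intro abs_continuous_mult[OF f g, of "max M N"]) (auto simp: le_max_iff_disj)
qed

lemma abs_continuous_const: "abs_continuous_on_interval a b (\<lambda>t. c)"
  by (rule abs_continuous_lipschitz[of _ _ _ 0]) simp

lemma abs_continuous_id: "abs_continuous_on_interval a b (\<lambda>t::real. t)"
  by (rule abs_continuous_lipschitz[of _ _ _ 1]) simp

lemma abs_continuous_integral:
  fixes g :: "real \<Rightarrow> real"
  assumes "continuous_on {a..b} g"
  shows "abs_continuous_on_interval a b (\<lambda>t. integral {a..t} g)"
proof -
  obtain K where "\<forall>x\<in>g ` {a..b}. norm x \<le> K"
    using compact_imp_bounded[OF compact_continuous_image[OF assms compact_Icc]]
    unfolding bounded_iff by blast
  then have K: "norm (g t) \<le> K" if "t \<in> {a..b}" for t using that by blast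
  have "norm (integral {a..t} g - integral {a..s} g) \<le> K * norm (t - s)"
    if "s \<in> {a..b}" "t \<in> {a..b}" for s t
    by (rule field_differentiable_bound[where S = "{a..b}" and f' = g])
      (use integral_has_real_derivative[OF assms] K that in auto)
  then show ?thesis by (intro abs_continuous_lipschitz[of _ _ _ K]) simp
qed

lemma lip1_abs_continuous: "lip1 f \<Longrightarrow> abs_continuous_on_interval a b f"
  by (rule abs_continuous_lipschitz[of _ _ _ 1]) (simp add: lip1D)

section \<open>Monotonicity of absolutely continuous functions from the sign of their
  derivative\<close>

lemma sum_lengths_le_measure:
  fixes D :: "real set set"
  assumes D: "D division_of \<Union>D" and sub: "\<Union>D \<subseteq> U" and U: "U \<in> lmeasurable"
  shows "(\<Sum>k\<in>D. Sup k - Inf k) \<le> measure lebesgue U"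
proof -
  have fin: "finite D" using D by blast
  have "bounded (\<Union>D)" using elementary_bounded[OF D] .
  then obtain a b where ab: "\<Union>D \<subseteq> cbox a b" using bounded_subset_cbox_symmetric by metis
  have "((\<lambda>x. 1::real) has_integral (Sup k - Inf k)) k" if "k \<in> D" for k
  proof -
    have k: "Inf k \<le> Sup k" "k = {Inf k..Sup k}"
      using division_Sup_Inf(3,4)[OF D _ that] ab by auto
    have "((\<lambda>x. 1::real) has_integral (Sup k - Inf k) *\<^sub>R 1) {Inf k..Sup k}"
      using has_integral_const_real[of "1::real" "Inf k" "Sup k"] k(1) by simp
    then show ?thesis using k(2) by simp
  qed
  then have "((\<lambda>x. 1::real) has_integral (\<Sum>k\<in>D. Sup k - Inf k)) (\<Union>D)"
    by (rule has_integral_combine_division[OF D])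
  moreover have "compact (\<Union>D)" using D by (auto intro!: compact_Union fin elim: division_ofD)
  then have m: "\<Union>D \<in> lmeasurable" by (rule lmeasurable_compact)
  ultimately have "measure lebesgue (\<Union>D) = (\<Sum>k\<in>D. Sup k - Inf k)"
    using lmeasure_integral[OF m] by (simp add: integral_unique)
  moreover have "measure lebesgue (\<Union>D) \<le> measure lebesgue U"
    using sub m U by (intro measure_mono_fmeasurable) (auto dest: fmeasurableD)
  ultimately show ?thesis by simp
qed

lemma negligible_open_cover:
  fixes N :: "real set"
  assumes "negligible N" "\<delta> > 0"
  obtains U where "open U" "N \<subseteq> U" "U \<in> lmeasurable" "measure lebesgue U < \<delta>"
proof -
  have N: "N \<in> lmeasurable" "measure lebesgue N = 0"
    using assms(1) negligible_imp_measurable negligible_imp_measure0 by blast+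
  then obtain U where U: "open U" "N \<subseteq> U" "U - N \<in> lmeasurable" "emeasure lebesgue (U - N) < ennreal \<delta>"
    using sets_lebesgue_outer_open[OF fmeasurableD[OF N(1)] assms(2)] by blast
  have eq: "U = N \<union> (U - N)" using U(2) by blast
  have m: "U \<in> lmeasurable" by (subst eq) (intro fmeasurable.Un N U)
  have "measure lebesgue U \<le> measure lebesgue N + measure lebesgue (U - N)"
    by (subst eq) (intro measure_Un_le fmeasurableD N U)
  moreover have "measure lebesgue (U - N) < \<delta>"
    using U(4) assms(2) by (simp add: emeasure_eq_measure2[OF U(3)] ennreal_less_iff)
  ultimately show thesis using that U m N by simp
qed

text \<open>On a fine tagged division the intervals with a tag in the exceptional set are
  controlled by absolute continuity, the others by the derivative.\<close>

lemma abs_continuous_mono: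
  fixes g :: "real \<Rightarrow> real"
  assumes ac: "abs_continuous_on_interval a b g" and N: "negligible N"
    and st: "a \<le> s" "s \<le> t" "t \<le> b"
    and der: "\<And>x. x \<in> {a..b} - N \<Longrightarrow> \<exists>D\<ge>0. (g has_real_derivative D) (at x within {a..b})"
  shows "g s \<le> g t"
proof -
  have "g s - g t \<le> \<epsilon> * (t - s + 1)" if \<epsilon>: "\<epsilon> > 0" for \<epsilon>
  proof -
    obtain \<delta> where d: "\<delta> > 0" "\<And>D. D division_of \<Union>D \<Longrightarrow> \<Union>D \<subseteq> {a..b} \<Longrightarrow>
      (\<Sum>k\<in>D. Sup k - Inf k) < \<delta> \<Longrightarrow> (\<Sum>k\<in>D. norm (g (Sup k) - g (Inf k))) < \<epsilon>"
      using abs_continuousD[OF ac \<epsilon>] by blast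
    obtain U where U: "open U" "N \<subseteq> U" "U \<in> lmeasurable" "measure lebesgue U < \<delta>"
      using negligible_open_cover[OF N d(1)] by blast
    \<comment> \<open>One radius serves both kinds of tag: in \<open>N\<close> the ball stays in the
      small open set \<open>U\<close>, elsewhere the derivative controls every short interval that
      straddles the tag.\<close>
    have "\<exists>r>0. (x \<in> N \<longrightarrow> ball x r \<subseteq> U) \<and> (x \<in> {a..b} - N \<longrightarrow>
        (\<forall>u\<in>{a..b}. \<forall>v\<in>{a..b}. u \<le> x \<longrightarrow> x \<le> v \<longrightarrow> \<bar>u - x\<bar> < r \<longrightarrow> \<bar>v - x\<bar> < r \<longrightarrow>
          g v - g u \<ge> - \<epsilon> * (v - u)))" for x
    proof (cases "x \<in> N \<or> x \<notin> {a..b}")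
      case True
      show ?thesis
      proof (cases "x \<in> N")
        case True
        then show ?thesis using U(1,2) by (auto simp: open_contains_ball)
      next
        case False
        then show ?thesis using True by (intro exI[of _ 1]) auto
      qed
    next
      case False
      then obtain D where D: "D \<ge> 0" "(g has_real_derivative D) (at x within {a..b})"
        using der by blast
      then have "(g has_derivative (*) D) (at x within {a..b})"
        by (simp add: has_field_derivative_def)
      then obtain r where r: "r > 0" "\<And>y. y \<in> {a..b} \<Longrightarrow> norm (y - x) < r \<Longrightarrow>
          norm (g y - g x - D * (y - x)) \<le> \<epsilon> * norm (y - x)"
        using \<epsilon> unfolding has_derivative_within_alt by blast
      have "g v - g u \<ge> - \<epsilon> * (v - u)"
        if uv: "u \<in> {a..b}" "v \<in> {a..b}" "u \<le> x" "x \<le> v" "\<bar>u - x\<bar> < r" "\<bar>v - x\<bar> < r" for u v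
      proof -
        have "\<bar>g v - g x - D * (v - x)\<bar> \<le> \<epsilon> * (v - x)" "\<bar>g u - g x - D * (u - x)\<bar> \<le> \<epsilon> * (x - u)"
          using r(2)[OF uv(1)] r(2)[OF uv(2)] uv by auto
        moreover have "D * (v - x) \<ge> 0" "D * (u - x) \<le> 0"
          using D(1) uv by (auto intro: mult_nonneg_nonneg mult_nonneg_nonpos)
        moreover have "- \<epsilon> * (v - u) = - (\<epsilon> * (v - x)) - \<epsilon> * (x - u)" by (simp add: algebra_simps)
        ultimately show ?thesis by linarith
      qed
      then show ?thesis using r(1) False by blast
    qed
    then obtain \<rho> where \<rho>: "\<And>x. \<rho> x > 0" "\<And>x. x \<in> N \<Longrightarrow> ball x (\<rho> x) \<subseteq> U"
      "\<And>x u v. x \<in> {a..b} - N \<Longrightarrow> u \<in> {a..b} \<Longrightarrow> v \<in> {a..b} \<Longrightarrow> u \<le> x \<Longrightarrow> x \<le> v \<Longrightarrow>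
        \<bar>u - x\<bar> < \<rho> x \<Longrightarrow> \<bar>v - x\<bar> < \<rho> x \<Longrightarrow> g v - g u \<ge> - \<epsilon> * (v - u)"
      by metis
    have "gauge (\<lambda>x. ball x (\<rho> x))" using \<rho>(1) by (intro gauge_ball_dependent) auto
    then obtain p where p: "p tagged_division_of {s..t}" "(\<lambda>x. ball x (\<rho> x)) fine p"
      using fine_division_exists_real by blast
    have fin: "finite p" using p(1) by blast
    have mem: "x \<in> k \<and> k \<subseteq> {s..t} \<and> k \<subseteq> ball x (\<rho> x) \<and> Inf k \<in> k \<and> Sup k \<in> k \<and> Inf k \<le> x \<and> x \<le> Sup k"
      if xk: "(x, k) \<in> p" for x k
    proof -
      obtain c d where "k = cbox c d" "x \<in> k" "k \<subseteq> {s..t}" using tagged_division_ofD(2,3,4)[OF p(1) xk] by blast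
      then show ?thesis using p(2) xk unfolding fine_def by auto
    qed
    define p1 where "p1 = {(x, k) \<in> p. x \<in> N}"
    have sub: "p1 \<subseteq> p" unfolding p1_def by blast
    have p1: "p1 tagged_partial_division_of {s..t}"
      using tagged_partial_division_subset[OF _ sub] p(1) unfolding tagged_division_of_def by blast
    let ?D = "snd ` p1"
    have D: "?D division_of \<Union>?D" using partial_division_of_tagged_division[OF p1] .
    have DU: "\<Union>?D \<subseteq> U" "\<Union>?D \<subseteq> {a..b}"
      using mem \<rho>(2) st unfolding p1_def by fastforce+
    have "(\<Sum>k\<in>?D. Sup k - Inf k) < \<delta>"
      using sum_lengths_le_measure[OF D DU(1) U(3)] U(4) by simp
    then have small: "(\<Sum>k\<in>?D. norm (g (Sup k) - g (Inf k))) < \<epsilon>"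
      using d(2)[OF D DU(2)] by blast
    \<comment> \<open>Different tags can share an interval only if it is degenerate. Passing from
      tagged intervals to the set of intervals thus requires the value 0 on degenerate ones,
      including the empty set, where \<open>Sup\<close> and \<open>Inf\<close> are
      arbitrary.\<close>
    define \<phi> where "\<phi> k = (if k = {} then 0 else norm (g (Sup k) - g (Inf k)))" for k
    have "(\<Sum>(x, k)\<in>p1. \<phi> k) = (\<Sum>k\<in>?D. \<phi> k)"
    proof (rule sum.over_tagged_division_lemma[where d = \<phi>, OF tagged_partial_division_of_Union_self[OF p1]])
      fix u v :: real assume "box u v = {}"
      then have "u \<ge> v" by auto
      then show "\<phi> (cbox u v) = 0" unfolding \<phi>_def by (cases "u = v") auto
    qed
    moreover have "\<phi> k = norm (g (Sup k) - g (Inf k))" if "(x, k) \<in> p1" for x k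
      using mem[of x k] sub that unfolding \<phi>_def by auto
    then have "(\<Sum>(x, k)\<in>p1. \<phi> k) = (\<Sum>(x, k)\<in>p1. norm (g (Sup k) - g (Inf k)))"
      "(\<Sum>k\<in>?D. \<phi> k) = (\<Sum>k\<in>?D. norm (g (Sup k) - g (Inf k)))"
      by (auto intro!: sum.cong)
    ultimately have "(\<Sum>(x, k)\<in>p1. norm (g (Sup k) - g (Inf k))) = (\<Sum>k\<in>?D. norm (g (Sup k) - g (Inf k)))"
      by simp
    then have bad: "(\<Sum>(x, k)\<in>p1. g (Sup k) - g (Inf k)) > - \<epsilon>"
      using small norm_sum[of "\<lambda>(x, k). g (Sup k) - g (Inf k)" p1] by (simp add: case_prod_beta)
    have good: "(\<Sum>(x, k)\<in>p - p1. g (Sup k) - g (Inf k)) \<ge> (\<Sum>(x, k)\<in>p - p1. - \<epsilon> * (Sup k - Inf k))"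
    proof (intro sum_mono, clarify)
      fix x k assume xk: "(x, k) \<in> p" "(x, k) \<notin> p1"
      then have "x \<notin> N" unfolding p1_def by blast
      moreover have "{s..t} \<subseteq> {a..b}" using st by auto
      moreover have "\<bar>Inf k - x\<bar> < \<rho> x" "\<bar>Sup k - x\<bar> < \<rho> x"
        using mem[OF xk(1)] by (auto simp: subset_iff dist_real_def abs_minus_commute)
      ultimately show "- \<epsilon> * (Sup k - Inf k) \<le> g (Sup k) - g (Inf k)"
        using mem[OF xk(1)] by (intro \<rho>(3)[of x]) auto
    qed
    have "(\<Sum>(x, k)\<in>p - p1. - \<epsilon> * (Sup k - Inf k)) \<ge> (\<Sum>(x, k)\<in>p. - \<epsilon> * (Sup k - Inf k))"
    proof -
      have "(\<Sum>(x, k)\<in>p1. - \<epsilon> * (Sup k - Inf k)) \<le> 0"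
      proof (intro sum_nonpos, clarify)
        fix x k assume "(x, k) \<in> p1"
        then have "Inf k \<le> Sup k" using mem[of x k] sub by auto
        then show "- \<epsilon> * (Sup k - Inf k) \<le> 0" using \<epsilon> by simp
      qed
      then show ?thesis using sum.subset_diff[OF sub fin, of "\<lambda>(x, k). - \<epsilon> * (Sup k - Inf k)"] by simp
    qed
    moreover have "(\<Sum>(x, k)\<in>p. - \<epsilon> * (Sup k - Inf k)) = - \<epsilon> * (t - s)"
      using additive_tagged_division_1[OF st(2) p(1), of "\<lambda>x. - \<epsilon> * x"] by (simp add: algebra_simps)
    moreover have "(\<Sum>(x, k)\<in>p. g (Sup k) - g (Inf k)) = g t - g s"
      using additive_tagged_division_1[OF st(2) p(1), of g] .
    moreover have "(\<Sum>(x, k)\<in>p. g (Sup k) - g (Inf k))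
        = (\<Sum>(x, k)\<in>p - p1. g (Sup k) - g (Inf k)) + (\<Sum>(x, k)\<in>p1. g (Sup k) - g (Inf k))"
      by (rule sum.subset_diff[OF sub fin])
    ultimately show ?thesis using bad good by (simp add: algebra_simps)
  qed
  then have "\<forall>\<epsilon>>0. g s - g t \<le> \<epsilon> * (t - s + 1)" by blast
  have "g s - g t \<le> 0"
  proof (rule field_le_epsilon)
    fix e :: real assume "e > 0"
    then have "e / (t - s + 1) > 0" using st(2) by simp
    then have "g s - g t \<le> (e / (t - s + 1)) * (t - s + 1)"
      using \<open>\<forall>\<epsilon>>0. _\<close> by blast
    then show "g s - g t \<le> 0 + e" using st(2) by simp
  qed
  then show ?thesis by simp
qed

lemma abs_continuous_eq:
  fixes g :: "real \<Rightarrow> real"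
  assumes ac: "abs_continuous_on_interval a b g" and N: "negligible N" and t: "t \<in> {a..b}"
    and der: "\<And>x. x \<in> {a..b} - N \<Longrightarrow> (g has_real_derivative 0) (at x within {a..b})"
  shows "g t = g a"
proof (rule antisym)
  show "g a \<le> g t"
    by (rule abs_continuous_mono[OF ac N]) (use t der in \<open>auto intro!: exI[of _ 0]\<close>)
  have ac': "abs_continuous_on_interval a b (\<lambda>t. 0 - g t)"
    using abs_continuous_diff[OF abs_continuous_const ac] .
  have der': "((\<lambda>t. 0 - g t) has_real_derivative 0) (at x within {a..b})" if "x \<in> {a..b} - N" for x
    using DERIV_minus[OF der[OF that]] by simp
  have "0 - g a \<le> 0 - g t"
    by (rule abs_continuous_mono[OF ac' N]) (use t der' in \<open>auto intro!: exI[of _ 0]\<close>)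
  then show "g t \<le> g a" by simp
qed

section \<open>Singular trajectories\<close>

text \<open>With \<open>x = e * t\<close> the velocity of \<open>y\<close> disappears by integration
  by parts: \<open>t * y'\<close>, \<open>t\<^sup>2 * y'\<close> and \<open>y\<^sup>2 * y'\<close>
  have the primitives \<open>t * y - A\<close>, \<open>t\<^sup>2 * y - 2 * B\<close> and
  \<open>y ^ 3 / 3\<close>. So \<open>C\<close> enters \<open>w_end\<close> only.\<close>

fun z_end :: "real \<Rightarrow> state \<Rightarrow> real" where
  "z_end e (s, y, A, B, C) = e * (s * y - 2 * A) / 2"

fun v_end :: "state \<Rightarrow> real" where
  "v_end (s, y, A, B, C) = s\<^sup>2 * y / 2 - B + y ^ 3 / 6"

fun w_end :: "real \<Rightarrow> state \<Rightarrow> real" where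
  "w_end e (s, y, A, B, C) = - (e * (s ^ 3 / 3 + C) / 2)"

text \<open>The trajectory for \<open>u\<^sub>1 = e\<close>, respectively \<open>u\<^sub>2 = e\<close>, in terms of the moments of its other
  horizontal coordinate. Exchanging \<open>x\<close> and \<open>y\<close> turns \<open>(z, v, w)\<close> into \<open>(- z, - w, - v)\<close>.\<close>

definition point1 :: "real \<Rightarrow> state \<Rightarrow> real ^ 5" where
  "point1 e st = (e * fst st) *\<^sub>R axis 1 1 + fst (snd st) *\<^sub>R axis 2 1 + z_end e st *\<^sub>R axis 3 1
     + v_end st *\<^sub>R axis 4 1 + w_end e st *\<^sub>R axis 5 1"

definition point2 :: "real \<Rightarrow> state \<Rightarrow> real ^ 5" where
  "point2 e st = fst (snd st) *\<^sub>R axis 1 1 + (e * fst st) *\<^sub>R axis 2 1 + (- z_end e st) *\<^sub>R axis 3 1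
     + (- w_end e st) *\<^sub>R axis 4 1 + (- v_end st) *\<^sub>R axis 5 1"

lemma polynomial_function_ends:
  "polynomial_function (z_end e)" "polynomial_function v_end" "polynomial_function (w_end e)"
proof -
  have "z_end e st = e * (fst st * fst (snd st) - 2 * fst (snd (snd st))) / 2"
    "v_end st = (fst st)\<^sup>2 * fst (snd st) / 2 - fst (snd (snd (snd st))) + fst (snd st) ^ 3 / 6"
    "w_end e st = - (e * (fst st ^ 3 / 3 + snd (snd (snd (snd st)))) / 2)" for st
    by (cases st; simp)+
  then have eq: "z_end e = (\<lambda>st. e * (fst st * fst (snd st) - 2 * fst (snd (snd st))) / 2)"
    "v_end = (\<lambda>st. (fst st)\<^sup>2 * fst (snd st) / 2 - fst (snd (snd (snd st))) + fst (snd st) ^ 3 / 6)"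
    "w_end e = (\<lambda>st. - (e * (fst st ^ 3 / 3 + snd (snd (snd (snd st)))) / 2))"
    by blast+
  show "polynomial_function (z_end e)" unfolding eq(1) by (intro polynomial_function_intros)
  show "polynomial_function v_end" unfolding eq(2) by (intro polynomial_function_intros)
  show "polynomial_function (w_end e)" unfolding eq(3) by (intro polynomial_function_intros)
qed

lemma polynomial_function_point1: "polynomial_function (point1 e)"
  unfolding point1_def[abs_def]
  by (intro polynomial_function_add polynomial_function_mult polynomial_function_ends
      polynomial_function_times polynomial_function_const polynomial_function_fst
      polynomial_function_snd polynomial_function_id)

lemma polynomial_function_point2: "polynomial_function (point2 e)"
  unfolding point2_def[abs_def]
  by (intro polynomial_function_add polynomial_function_mult polynomial_function_minus
      polynomial_function_ends
      polynomial_function_times polynomial_function_const polynomial_function_fst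
      polynomial_function_snd polynomial_function_id)

lemma exhaust_5: "x = 1 \<or> x = 2 \<or> x = 3 \<or> x = 4 \<or> x = 5" for x :: 5
proof (induct x)
  case (of_int z)
  \<comment> \<open>In the type \<open>5\<close> the numeral \<open>5\<close> denotes
    \<open>0\<close>.\<close>
  then have "z = 0 \<or> z = 1 \<or> z = 2 \<or> z = 3 \<or> z = 4" by fastforce
  then show ?case by auto
qed

lemma forall_5: "(\<forall>i::5. P i) \<longleftrightarrow> P 1 \<and> P 2 \<and> P 3 \<and> P 4 \<and> P 5"
  by (metis exhaust_5)

lemma axis_nth_5:
  "axis i c $ j = (if i = j then c else (0::real))" for i j :: 5
  by (simp add: axis_def)

lemma point1_nth:
  "point1 e st $ 1 = e * fst st" "point1 e st $ 2 = fst (snd st)" "point1 e st $ 3 = z_end e st"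
  "point1 e st $ 4 = v_end st" "point1 e st $ 5 = w_end e st"
  by (simp_all add: point1_def axis_nth_5)

lemma point2_nth:
  "point2 e st $ 1 = fst (snd st)" "point2 e st $ 2 = e * fst st" "point2 e st $ 3 = - z_end e st"
  "point2 e st $ 4 = - w_end e st" "point2 e st $ 5 = - v_end st"
  by (simp_all add: point2_def axis_nth_5)

lemma field_nth:
  "(a *\<^sub>R X1 q + b *\<^sub>R X2 q) $ 1 = a" "(a *\<^sub>R X1 q + b *\<^sub>R X2 q) $ 2 = b"
  "(a *\<^sub>R X1 q + b *\<^sub>R X2 q) $ 3 = (q $ 1 * b - q $ 2 * a) / 2"
  "(a *\<^sub>R X1 q + b *\<^sub>R X2 q) $ 4 = ((q $ 1)\<^sup>2 + (q $ 2)\<^sup>2) / 2 * b"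
  "(a *\<^sub>R X1 q + b *\<^sub>R X2 q) $ 5 = - (((q $ 1)\<^sup>2 + (q $ 2)\<^sup>2) / 2 * a)"
  by (simp_all add: X1_def X2_def axis_nth_5 algebra_simps diff_divide_distrib)

lemma AE_lebesgue_on_iff_negligible:
  "(AE t in lebesgue_on {a..b::real}. P t) \<longleftrightarrow> negligible {t\<in>{a..b}. \<not> P t}"
proof -
  have "(AE t in lebesgue_on {a..b}. P t) \<longleftrightarrow> (AE t in lebesgue. t \<in> {a..b} \<longrightarrow> P t)"
    by (rule AE_restrict_space_iff) simp
  also have "\<dots> \<longleftrightarrow> {t\<in>space lebesgue. \<not> (t \<in> {a..b} \<longrightarrow> P t)} \<in> null_sets lebesgue"
    by (rule completion.AE_iff_null_sets)
  also have "{t\<in>space lebesgue. \<not> (t \<in> {a..b} \<longrightarrow> P t)} = {t\<in>{a..b}. \<not> P t}" by auto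
  finally show ?thesis by (simp add: negligible_iff_null_sets)
qed

lemma moments_ends:
  assumes f: "lip1 f" and e: "e = 1 \<or> e = -1"
  shows "abs_continuous_on_interval 0 T (\<lambda>t. z_end e (moments f t))"
    "abs_continuous_on_interval 0 T (\<lambda>t. v_end (moments f t))"
    "abs_continuous_on_interval 0 T (\<lambda>t. w_end e (moments f t))"
    and "\<And>t D. t \<in> {0..T} \<Longrightarrow> (f has_real_derivative D) (at t within {0..T}) \<Longrightarrow>
      ((\<lambda>t. z_end e (moments f t)) has_real_derivative (e * t * D - f t * e) / 2) (at t within {0..T}) \<and>
      ((\<lambda>t. v_end (moments f t)) has_real_derivative ((e * t)\<^sup>2 + (f t)\<^sup>2) / 2 * D) (at t within {0..T}) \<and>
      ((\<lambda>t. w_end e (moments f t)) has_real_derivative - (((e * t)\<^sup>2 + (f t)\<^sup>2) / 2 * e)) (at t within {0..T})"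
proof -
  have cf: "continuous_on S f" for S using lip1_continuous_on[OF f] .
  have acf: "abs_continuous_on_interval 0 T f" using lip1_abs_continuous[OF f] .
  have acI: "abs_continuous_on_interval 0 T (\<lambda>t. integral {0..t} f)"
    "abs_continuous_on_interval 0 T (\<lambda>t. integral {0..t} (\<lambda>r. r * f r))"
    "abs_continuous_on_interval 0 T (\<lambda>t. integral {0..t} (\<lambda>r. (f r)\<^sup>2))"
    by (intro abs_continuous_integral continuous_intros cf)+
  show "abs_continuous_on_interval 0 T (\<lambda>t. z_end e (moments f t))"
    unfolding moments_def z_end.simps divide_inverse
    by (intro abs_continuous_diff abs_continuous_times abs_continuous_const abs_continuous_id acf acI)
  show "abs_continuous_on_interval 0 T (\<lambda>t. v_end (moments f t))"
    unfolding moments_def v_end.simps divide_inverse power2_eq_square[of _] power3_eq_cube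
    by (intro abs_continuous_diff abs_continuous_add abs_continuous_times abs_continuous_const
        abs_continuous_id acf acI)
  have "abs_continuous_on_interval 0 T (\<lambda>t. (- 1) * (e * (t ^ 3 / 3 + integral {0..t} (\<lambda>r. (f r)\<^sup>2)) / 2))"
    unfolding divide_inverse power3_eq_cube
    by (intro abs_continuous_add abs_continuous_times abs_continuous_const abs_continuous_id acI)
  then show "abs_continuous_on_interval 0 T (\<lambda>t. w_end e (moments f t))"
    unfolding moments_def w_end.simps by simp
  fix t D assume t: "t \<in> {0..T}" and D: "(f has_real_derivative D) (at t within {0..T})"
  have dI: "((\<lambda>t. integral {0..t} f) has_real_derivative f t) (at t within {0..T})"
    "((\<lambda>t. integral {0..t} (\<lambda>r. r * f r)) has_real_derivative t * f t) (at t within {0..T})"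
    "((\<lambda>t. integral {0..t} (\<lambda>r. (f r)\<^sup>2)) has_real_derivative (f t)\<^sup>2) (at t within {0..T})"
    using t by (intro integral_has_real_derivative[of 0 T _ t] continuous_intros cf; assumption)+
  have e2: "(e * t)\<^sup>2 = t\<^sup>2" using e by auto
  have "((\<lambda>t. e * (t * f t - 2 * integral {0..t} f) / 2) has_real_derivative (e * t * D - f t * e) / 2)
      (at t within {0..T})"
    using D dI(1) by (auto intro!: derivative_eq_intros simp: field_simps)
  moreover have "((\<lambda>t. t\<^sup>2 * f t / 2 - integral {0..t} (\<lambda>r. r * f r) + f t ^ 3 / 6) has_real_derivative
      (t\<^sup>2 + (f t)\<^sup>2) / 2 * D) (at t within {0..T})"
    using D dI(2) by (auto intro!: derivative_eq_intros simp: field_simps power2_eq_square)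
  moreover have "((\<lambda>t. - (e * (t ^ 3 / 3 + integral {0..t} (\<lambda>r. (f r)\<^sup>2)) / 2)) has_real_derivative
      - ((t\<^sup>2 + (f t)\<^sup>2) / 2 * e)) (at t within {0..T})"
    using dI(3) by (auto intro!: derivative_eq_intros simp: field_simps power2_eq_square)
  ultimately show "((\<lambda>t. z_end e (moments f t)) has_real_derivative (e * t * D - f t * e) / 2) (at t within {0..T}) \<and>
      ((\<lambda>t. v_end (moments f t)) has_real_derivative ((e * t)\<^sup>2 + (f t)\<^sup>2) / 2 * D) (at t within {0..T}) \<and>
      ((\<lambda>t. w_end e (moments f t)) has_real_derivative - (((e * t)\<^sup>2 + (f t)\<^sup>2) / 2 * e)) (at t within {0..T})"
    unfolding e2 moments_def z_end.simps v_end.simps w_end.simps by blast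
qed

text \<open>Serves both controls: \<open>\<alpha>\<close> is the coordinate with constant velocity,
  \<open>\<beta>\<close> the other one. The two sides of each equation are absolutely continuous,
  vanish at 0 and have the same derivative almost everywhere.\<close>

lemma singular_endpoint:
  fixes \<alpha> \<beta> \<zeta> \<nu> \<omega> :: "real \<Rightarrow> real"
  assumes T: "T > 0" and e: "e = 1 \<or> e = -1"
    and ac: "abs_continuous_on_interval 0 T \<alpha>" "abs_continuous_on_interval 0 T \<beta>"
      "abs_continuous_on_interval 0 T \<zeta>" "abs_continuous_on_interval 0 T \<nu>"
      "abs_continuous_on_interval 0 T \<omega>"
    and init: "\<alpha> 0 = 0" "\<beta> 0 = 0" "\<zeta> 0 = 0" "\<nu> 0 = 0" "\<omega> 0 = 0"
    and N: "negligible N"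
    and der: "\<And>t. t \<in> {0..T} - N \<Longrightarrow> \<bar>u t\<bar> \<le> 1 \<and>
        (\<alpha> has_real_derivative e) (at t within {0..T}) \<and>
        (\<beta> has_real_derivative u t) (at t within {0..T}) \<and>
        (\<zeta> has_real_derivative (\<alpha> t * u t - \<beta> t * e) / 2) (at t within {0..T}) \<and>
        (\<nu> has_real_derivative ((\<alpha> t)\<^sup>2 + (\<beta> t)\<^sup>2) / 2 * u t) (at t within {0..T}) \<and>
        (\<omega> has_real_derivative - (((\<alpha> t)\<^sup>2 + (\<beta> t)\<^sup>2) / 2 * e)) (at t within {0..T})"
  shows "\<exists>y. lip1 y \<and> y 0 = 0 \<and> \<alpha> T = e * T \<and> \<beta> T = y T \<and> \<zeta> T = z_end e (moments y T) \<and>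
    \<nu> T = v_end (moments y T) \<and> \<omega> T = w_end e (moments y T)"
proof -
  have e2: "e * e = 1" using e by auto
  have \<alpha>: "\<alpha> t = e * t" if t: "t \<in> {0..T}" for t
  proof -
    have "\<alpha> t - e * t = \<alpha> 0 - e * 0"
    proof (rule abs_continuous_eq[OF _ N t])
      show "abs_continuous_on_interval 0 T (\<lambda>t. \<alpha> t - e * t)"
        by (intro abs_continuous_diff abs_continuous_times abs_continuous_const abs_continuous_id ac)
      fix t assume t: "t \<in> {0..T} - N"
      have "((\<lambda>t. \<alpha> t - e * t) has_real_derivative e - e * 1) (at t within {0..T})"
        using der[OF t] by (intro DERIV_diff DERIV_cmult DERIV_ident) auto
      then show "((\<lambda>t. \<alpha> t - e * t) has_real_derivative 0) (at t within {0..T})" by simp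
    qed
    then show ?thesis using init by simp
  qed
  have lip: "\<beta> t - \<beta> s \<le> t - s \<and> \<beta> s - \<beta> t \<le> t - s" if st: "0 \<le> s" "s \<le> t" "t \<le> T" for s t
  proof
    have "s - \<beta> s \<le> t - \<beta> t"
    proof (rule abs_continuous_mono[OF _ N st])
      show "abs_continuous_on_interval 0 T (\<lambda>t. t - \<beta> t)"
        by (intro abs_continuous_diff abs_continuous_id ac)
      fix t assume t: "t \<in> {0..T} - N"
      have "((\<lambda>t. t - \<beta> t) has_real_derivative 1 - u t) (at t within {0..T})"
        using der[OF t] by (intro DERIV_diff DERIV_ident) auto
      moreover have "1 - u t \<ge> 0" using der[OF t] by auto
      ultimately show "\<exists>D\<ge>0. ((\<lambda>t. t - \<beta> t) has_real_derivative D) (at t within {0..T})" by blast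
    qed
    then show "\<beta> t - \<beta> s \<le> t - s" by simp
    have "s + \<beta> s \<le> t + \<beta> t"
    proof (rule abs_continuous_mono[OF _ N st])
      show "abs_continuous_on_interval 0 T (\<lambda>t. t + \<beta> t)"
        by (intro abs_continuous_add abs_continuous_id ac)
      fix t assume t: "t \<in> {0..T} - N"
      have "((\<lambda>t. t + \<beta> t) has_real_derivative 1 + u t) (at t within {0..T})"
        using der[OF t] by (intro DERIV_add DERIV_ident) auto
      moreover have "1 + u t \<ge> 0" using der[OF t] by auto
      ultimately show "\<exists>D\<ge>0. ((\<lambda>t. t + \<beta> t) has_real_derivative D) (at t within {0..T})" by blast
    qed
    then show "\<beta> s - \<beta> t \<le> t - s" by simp
  qed
  \<comment> \<open>\<open>lip1\<close> speaks of the whole line, so \<open>\<beta>\<close> is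
    continued by constants outside \<open>{0..T}\<close>.\<close>
  define y where "y t = \<beta> (max 0 (min t T))" for t
  have y: "lip1 y"
    unfolding lip1_def
  proof (intro allI)
    fix a b
    have "\<bar>y r - y s\<bar> \<le> \<bar>r - s\<bar>" if "s \<le> r" for r s
    proof -
      define r' s' where rs: "r' = max 0 (min r T)" "s' = max 0 (min s T)"
      have "0 \<le> s'" "s' \<le> r'" "r' \<le> T" "r' - s' \<le> r - s" unfolding rs using that T by auto
      then show ?thesis
        using lip[of s' r'] that unfolding y_def rs[symmetric] by linarith
    qed
    from this[of a b] this[of b a] show "\<bar>y a - y b\<bar> \<le> \<bar>a - b\<bar>"
      by (cases "a \<le> b") (auto simp: abs_minus_commute)
  qed
  have y\<beta>: "y t = \<beta> t" if "t \<in> {0..T}" for t using that unfolding y_def by auto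
  have y0: "y 0 = 0" using y\<beta>[of 0] T init by simp
  have T0: "T \<in> {0..T}" using T by simp
  note ac_ends = moments_ends(1-3)[OF y e]
  have dy: "(y has_real_derivative u t) (at t within {0..T})" if t: "t \<in> {0..T} - N" for t
    by (rule has_field_derivative_transform_within[where f = \<beta> and d = 1]) (use der[OF t] t y\<beta> in auto)
  have d_ends: "((\<lambda>t. z_end e (moments y t)) has_real_derivative (\<alpha> t * u t - \<beta> t * e) / 2) (at t within {0..T})"
    "((\<lambda>t. v_end (moments y t)) has_real_derivative ((\<alpha> t)\<^sup>2 + (\<beta> t)\<^sup>2) / 2 * u t) (at t within {0..T})"
    "((\<lambda>t. w_end e (moments y t)) has_real_derivative - (((\<alpha> t)\<^sup>2 + (\<beta> t)\<^sup>2) / 2 * e)) (at t within {0..T})"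
    if t: "t \<in> {0..T} - N" for t
  proof -
    have t': "t \<in> {0..T}" using t by simp
    show "((\<lambda>t. z_end e (moments y t)) has_real_derivative (\<alpha> t * u t - \<beta> t * e) / 2) (at t within {0..T})"
      "((\<lambda>t. v_end (moments y t)) has_real_derivative ((\<alpha> t)\<^sup>2 + (\<beta> t)\<^sup>2) / 2 * u t) (at t within {0..T})"
      "((\<lambda>t. w_end e (moments y t)) has_real_derivative - (((\<alpha> t)\<^sup>2 + (\<beta> t)\<^sup>2) / 2 * e)) (at t within {0..T})"
      using moments_ends(4)[OF y e t' dy[OF t]] unfolding \<alpha>[OF t'] y\<beta>[OF t', symmetric] by blast+
  qed
  have m0: "moments y 0 = (0, 0, 0, 0, 0)" using moments_0[of y, OF y0] by (simp add: zero_prod_def)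
  have eq: "g T = h T"
    if "abs_continuous_on_interval 0 T g" "abs_continuous_on_interval 0 T h" "g 0 = 0" "h 0 = 0"
      "\<And>t. t \<in> {0..T} - N \<Longrightarrow> (g has_real_derivative D t) (at t within {0..T})"
      "\<And>t. t \<in> {0..T} - N \<Longrightarrow> (h has_real_derivative D t) (at t within {0..T})"
    for g h D :: "real \<Rightarrow> real"
  proof -
    have "g T - h T = g 0 - h 0"
    proof (rule abs_continuous_eq[OF abs_continuous_diff[OF that(1,2)] N T0])
      fix t assume t: "t \<in> {0..T} - N"
      show "((\<lambda>t. g t - h t) has_real_derivative 0) (at t within {0..T})"
        using DERIV_diff[OF that(5)[OF t] that(6)[OF t]] by simp
    qed
    then show ?thesis using that(3,4) by simp
  qed
  have "\<zeta> T = z_end e (moments y T)"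
    by (rule eq[OF ac(3) ac_ends(1) _ _ _ d_ends(1)]) (use der init m0 in auto)
  moreover have "\<nu> T = v_end (moments y T)"
    by (rule eq[OF ac(4) ac_ends(2) _ _ _ d_ends(2)]) (use der init m0 in auto)
  moreover have "\<omega> T = w_end e (moments y T)"
    by (rule eq[OF ac(5) ac_ends(3) _ _ _ d_ends(3)]) (use der init m0 in auto)
  ultimately show ?thesis
    using y y0 \<alpha>[OF T0] y\<beta>[OF T0] by (intro exI[of _ y]) simp
qed

lemma has_vector_derivative_nth:
  fixes q :: "real \<Rightarrow> real ^ 'n"
  assumes "(q has_vector_derivative F) (at t within S)"
  shows "((\<lambda>t. q t $ i) has_real_derivative F $ i) (at t within S)"
  using bounded_linear.has_vector_derivative[OF bounded_linear_vec_nth assms]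
  by (simp add: has_real_derivative_iff_has_vector_derivative)

lemma attainable_sing_forward:
  assumes T: "T > 0" and p: "p \<in> attainable_sing T"
  shows "\<exists>e y. (e = 1 \<or> e = -1) \<and> lip1 y \<and> y 0 = 0 \<and>
           (p = point1 e (moments y T) \<or> p = point2 e (moments y T))"
proof -
  obtain q u where p: "p = q T" and adm: "admissible_control T u" and sing: "singular_control T u"
    and tr: "trajectory T u q"
    using p unfolding attainable_sing_def by blast
  have q0: "q 0 = 0" and acq: "abs_continuous_on_interval 0 T q"
    using tr unfolding trajectory_def by blast+
  have ac: "abs_continuous_on_interval 0 T (\<lambda>t. q t $ i)" for i
    using abs_continuous_bounded_linear[OF acq bounded_linear_vec_nth] .
  have acm: "abs_continuous_on_interval 0 T (\<lambda>t. - (q t $ i))" for i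
    using abs_continuous_bounded_linear[OF ac bounded_linear_minus[OF bounded_linear_ident]] .
  define F where "F t = (u t $ 1) *\<^sub>R X1 (q t) + (u t $ 2) *\<^sub>R X2 (q t)" for t
  define N1 where "N1 = {t\<in>{0..T}. \<not> (q has_vector_derivative F t) (at t within {0..T})}"
  have N1: "negligible N1"
    using tr unfolding trajectory_def N1_def F_def AE_lebesgue_on_iff_negligible by blast
  obtain i :: 2 and e :: real where ie: "e = 1 \<or> e = -1" "AE t in lebesgue_on {0..T}. u t $ i = e"
    using sing unfolding singular_control_def by blast
  define N2 where "N2 = {t\<in>{0..T}. \<not> u t $ i = e}"
  have N2: "negligible N2"
    using ie(2) unfolding N2_def AE_lebesgue_on_iff_negligible .
  have N: "negligible (N1 \<union> N2)" using N1 N2 by (rule negligible_Un)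
  have d: "((\<lambda>t. q t $ j) has_real_derivative F t $ j) (at t within {0..T})" "u t $ i = e"
    if "t \<in> {0..T} - (N1 \<union> N2)" for t j
    using that has_vector_derivative_nth unfolding N1_def N2_def by blast+
  have dm: "((\<lambda>t. - (q t $ j)) has_real_derivative - (F t $ j)) (at t within {0..T})"
    if "t \<in> {0..T} - (N1 \<union> N2)" for t j
    using DERIV_minus[OF d(1)[OF that]] .
  have bound: "\<bar>u t $ 1\<bar> \<le> 1" "\<bar>u t $ 2\<bar> \<le> 1" if "t \<in> {0..T}" for t
    using adm that unfolding admissible_control_def by auto
  have vec: "p = r" if "p $ 1 = r $ 1" "p $ 2 = r $ 2" "p $ 3 = r $ 3" "p $ 4 = r $ 4" "p $ 5 = r $ 5" for r
    using that by (simp add: vec_eq_iff forall_5)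
  consider "i = 1" | "i = 2" using exhaust_2 by blast
  then show ?thesis
  proof cases
    case 1
    have "\<exists>y. lip1 y \<and> y 0 = 0 \<and> q T $ 1 = e * T \<and> q T $ 2 = y T \<and> q T $ 3 = z_end e (moments y T) \<and>
      q T $ 4 = v_end (moments y T) \<and> q T $ 5 = w_end e (moments y T)"
    proof (rule singular_endpoint[OF T ie(1) ac ac ac ac ac _ _ _ _ _ N])
      fix t assume t: "t \<in> {0..T} - (N1 \<union> N2)"
      then show "\<bar>u t $ 2\<bar> \<le> 1 \<and>
          ((\<lambda>t. q t $ 1) has_real_derivative e) (at t within {0..T}) \<and>
          ((\<lambda>t. q t $ 2) has_real_derivative u t $ 2) (at t within {0..T}) \<and>
          ((\<lambda>t. q t $ 3) has_real_derivative (q t $ 1 * u t $ 2 - q t $ 2 * e) / 2) (at t within {0..T}) \<and>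
          ((\<lambda>t. q t $ 4) has_real_derivative ((q t $ 1)\<^sup>2 + (q t $ 2)\<^sup>2) / 2 * u t $ 2) (at t within {0..T}) \<and>
          ((\<lambda>t. q t $ 5) has_real_derivative - (((q t $ 1)\<^sup>2 + (q t $ 2)\<^sup>2) / 2 * e)) (at t within {0..T})"
        using d(1)[OF t, of 1] d(1)[OF t, of 2] d(1)[OF t, of 3] d(1)[OF t, of 4] d(1)[OF t, of 5]
          d(2)[OF t] bound(2) 1
        unfolding F_def field_nth by auto
    qed (simp_all add: q0)
    then obtain y where y: "lip1 y" "y 0 = 0" "q T $ 1 = e * T" "q T $ 2 = y T" "q T $ 3 = z_end e (moments y T)"
      "q T $ 4 = v_end (moments y T)" "q T $ 5 = w_end e (moments y T)" by blast
    have "p = point1 e (moments y T)"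
      by (rule vec) (simp_all only: p point1_nth y, simp_all add: moments_def)
    then show ?thesis using ie(1) y(1,2) by blast
  next
    case 2
    have "\<exists>y. lip1 y \<and> y 0 = 0 \<and> q T $ 2 = e * T \<and> q T $ 1 = y T \<and> - (q T $ 3) = z_end e (moments y T) \<and>
      - (q T $ 5) = v_end (moments y T) \<and> - (q T $ 4) = w_end e (moments y T)"
    proof (rule singular_endpoint[OF T ie(1) ac ac acm acm acm _ _ _ _ _ N])
      fix t assume t: "t \<in> {0..T} - (N1 \<union> N2)"
      have F: "F t $ 1 = u t $ 1" "F t $ 2 = e" "- (F t $ 3) = (q t $ 2 * u t $ 1 - q t $ 1 * e) / 2"
        "- (F t $ 5) = ((q t $ 2)\<^sup>2 + (q t $ 1)\<^sup>2) / 2 * u t $ 1"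
        "- (F t $ 4) = - (((q t $ 2)\<^sup>2 + (q t $ 1)\<^sup>2) / 2 * e)"
        using d(2)[OF t] 2 unfolding F_def field_nth by (simp_all add: field_simps)
      show "\<bar>u t $ 1\<bar> \<le> 1 \<and>
          ((\<lambda>t. q t $ 2) has_real_derivative e) (at t within {0..T}) \<and>
          ((\<lambda>t. q t $ 1) has_real_derivative u t $ 1) (at t within {0..T}) \<and>
          ((\<lambda>t. - (q t $ 3)) has_real_derivative (q t $ 2 * u t $ 1 - q t $ 1 * e) / 2) (at t within {0..T}) \<and>
          ((\<lambda>t. - (q t $ 5)) has_real_derivative ((q t $ 2)\<^sup>2 + (q t $ 1)\<^sup>2) / 2 * u t $ 1) (at t within {0..T}) \<and>
          ((\<lambda>t. - (q t $ 4)) has_real_derivative - (((q t $ 2)\<^sup>2 + (q t $ 1)\<^sup>2) / 2 * e)) (at t within {0..T})"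
        using d(1)[OF t, of 1] d(1)[OF t, of 2] dm[OF t, of 3] dm[OF t, of 4] dm[OF t, of 5]
          bound(1)[of t] t
        unfolding F by simp
    qed (simp_all add: q0)
    then obtain y where y: "lip1 y" "y 0 = 0" "q T $ 2 = e * T" "q T $ 1 = y T" "- (q T $ 3) = z_end e (moments y T)"
      "- (q T $ 5) = v_end (moments y T)" "- (q T $ 4) = w_end e (moments y T)" by blast
    have "p = point2 e (moments y T)"
      by (rule vec) (simp_all only: p point2_nth y(3,4) y(5-7)[symmetric], simp_all add: moments_def)
    then show ?thesis using ie(1) y(1,2) by blast
  qed
qed

text \<open>The derivative is a pointwise limit of continuous difference quotients bounded by 1,
  hence measurable with the same bound. On the exceptional set it is put to 0, because an admissible
  control is bounded everywhere and not just almost everywhere.\<close>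

lemma piecewise_C1_derivative:
  assumes f: "piecewise_C1_lip1 f"
  shows "\<exists>S w. finite S \<and> w \<in> borel_measurable borel \<and> (\<forall>t. \<bar>w t\<bar> \<le> 1) \<and>
           (\<forall>t. t \<notin> S \<longrightarrow> (f has_real_derivative w t) (at t))"
proof -
  obtain S where S: "finite S" "\<And>t. t \<notin> S \<Longrightarrow> \<exists>D. (f has_real_derivative D) (at t)"
    using f unfolding piecewise_C1_lip1_def by blast
  have lip: "lip1 f" using f unfolding piecewise_C1_lip1_def by blast
  define w where "w t = (if t \<in> S then 0 else deriv f t)" for t
  have der: "(f has_real_derivative w t) (at t)" if "t \<notin> S" for t
    using S(2)[OF that] that DERIV_imp_deriv unfolding w_def by fastforce
  define v where "v n t = (if t \<in> S then 0 else (f (t + inverse (real (Suc n))) - f t) / inverse (real (Suc n)))" for n t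
  have "filterlim (\<lambda>n. inverse (real (Suc n))) (at 0) sequentially"
    unfolding filterlim_at using LIMSEQ_inverse_real_of_nat by auto
  then have lim: "(\<lambda>n. v n t) \<longlonglongrightarrow> w t" for t
    using der[of t] filterlim_compose[of "\<lambda>h. (f (t + h) - f t) / h" "nhds (w t)" "at 0"]
    unfolding v_def w_def DERIV_def by (cases "t \<in> S") auto
  have bound: "\<bar>v n t\<bar> \<le> 1" for n t
  proof -
    have "\<bar>f (t + inverse (real (Suc n))) - f t\<bar> \<le> inverse (real (Suc n))"
      using lip1D[OF lip, of "t + inverse (real (Suc n))" t] by simp
    then show ?thesis unfolding v_def by (auto simp: abs_divide divide_le_eq_1)
  qed
  have [measurable]: "f \<in> borel_measurable borel"
    using lip1_continuous_on[OF lip] by (rule borel_measurable_continuous_onI)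
  have [measurable]: "S \<in> sets borel"
    using S(1) by (intro borel_closed finite_imp_closed)
  have "v n \<in> borel_measurable borel" for n
    unfolding v_def[abs_def] by measurable
  then have "w \<in> borel_measurable borel"
    using lim by (intro borel_measurable_LIMSEQ_real[of borel v w]) auto
  moreover have "\<bar>w t\<bar> \<le> 1" for t
    using tendsto_rabs[OF lim[of t]] bound by (intro LIMSEQ_le_const2) auto
  ultimately show ?thesis using S(1) der by blast
qed

lemma abs_continuous_scaleR_const:
  "abs_continuous_on_interval a b f \<Longrightarrow> abs_continuous_on_interval a b (\<lambda>t. f t *\<^sub>R v)"
  using abs_continuous_bounded_linear[OF _ bounded_linear_scaleR_left] .

lemma has_vector_derivative_scaleR_const:
  "(f has_real_derivative D) (at t within S) \<Longrightarrow> ((\<lambda>t. f t *\<^sub>R v) has_vector_derivative D *\<^sub>R v) (at t within S)"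
  using bounded_linear.has_vector_derivative[OF bounded_linear_scaleR_left]
  by (simp add: has_real_derivative_iff_has_vector_derivative)

lemma attainable_sing_backward:
  assumes T: "T > 0" and e: "e = 1 \<or> e = -1" and f: "piecewise_C1_lip1 f"
  shows "point1 e (moments f T) \<in> attainable_sing T" "point2 e (moments f T) \<in> attainable_sing T"
proof -
  have lip: "lip1 f" and f0: "f 0 = 0" using f unfolding piecewise_C1_lip1_def by blast+
  obtain S w where S: "finite S" and w: "w \<in> borel_measurable borel" "\<And>t. \<bar>w t\<bar> \<le> 1"
    "\<And>t. t \<notin> S \<Longrightarrow> (f has_real_derivative w t) (at t)"
    using piecewise_C1_derivative[OF f] by blast
  have "w \<in> borel_measurable lborel" using w(1) by simp
  then have w': "w \<in> borel_measurable (lebesgue_on {0..T})"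
    by (intro measurable_restrict_space1 measurable_completion)
  have AE: "AE t in lebesgue_on {0..T}. P t" if "\<And>t. t \<in> {0..T} - S \<Longrightarrow> P t" for P
    unfolding AE_lebesgue_on_iff_negligible
    by (rule negligible_subset[OF negligible_finite[OF S]]) (use that in blast)
  have acf: "abs_continuous_on_interval 0 T f" using lip1_abs_continuous[OF lip] .
  have acid: "abs_continuous_on_interval 0 T (\<lambda>t. e * t)"
    by (intro abs_continuous_times abs_continuous_const abs_continuous_id)
  note ac = moments_ends(1-3)[OF lip e]
  have neg: "abs_continuous_on_interval 0 T (\<lambda>t. - g t)" if "abs_continuous_on_interval 0 T g" for g :: "real \<Rightarrow> real"
    using abs_continuous_bounded_linear[OF that bounded_linear_minus[OF bounded_linear_ident]] .
  have d: "(f has_real_derivative w t) (at t within {0..T})"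
    "((\<lambda>t. z_end e (moments f t)) has_real_derivative (e * t * w t - f t * e) / 2) (at t within {0..T})"
    "((\<lambda>t. v_end (moments f t)) has_real_derivative ((e * t)\<^sup>2 + (f t)\<^sup>2) / 2 * w t) (at t within {0..T})"
    "((\<lambda>t. w_end e (moments f t)) has_real_derivative - (((e * t)\<^sup>2 + (f t)\<^sup>2) / 2 * e)) (at t within {0..T})"
    "((\<lambda>t. e * t) has_real_derivative e) (at t within {0..T})"
    if t: "t \<in> {0..T} - S" for t
  proof -
    show fd: "(f has_real_derivative w t) (at t within {0..T})"
      using w(3)[of t] t by (auto intro: has_field_derivative_at_within)
    have t': "t \<in> {0..T}" using t by simp
    show "((\<lambda>t. z_end e (moments f t)) has_real_derivative (e * t * w t - f t * e) / 2) (at t within {0..T})"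
      "((\<lambda>t. v_end (moments f t)) has_real_derivative ((e * t)\<^sup>2 + (f t)\<^sup>2) / 2 * w t) (at t within {0..T})"
      "((\<lambda>t. w_end e (moments f t)) has_real_derivative - (((e * t)\<^sup>2 + (f t)\<^sup>2) / 2 * e)) (at t within {0..T})"
      using moments_ends(4)[OF lip e t' fd] by blast+
    show "((\<lambda>t. e * t) has_real_derivative e) (at t within {0..T})"
      by (auto intro!: derivative_eq_intros)
  qed
  have m: "fst (moments f t) = t" "fst (snd (moments f t)) = f t" for t by (simp_all add: moments_def)
  have e1: "\<bar>e\<bar> \<le> 1" using e by auto
  have ax2: "axis i c $ j = (if i = j then c else (0::real))" for i j :: 2 and c by (simp add: axis_def)
  let ?u1 = "\<lambda>t. e *\<^sub>R axis 1 1 + w t *\<^sub>R axis 2 1 :: real ^ 2"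
  let ?q1 = "\<lambda>t. point1 e (moments f t)"
  have adm1: "admissible_control T ?u1"
    unfolding admissible_control_def using w' w(2) e1
    by (auto simp: ax2 intro!: borel_measurable_add borel_measurable_scaleR borel_measurable_const)
  have sing1: "singular_control T ?u1"
    unfolding singular_control_def using e by (intro exI[of _ 1]) (auto simp: ax2)
  have traj1: "trajectory T ?u1 ?q1"
    unfolding trajectory_def
  proof (intro conjI AE)
    show "?q1 0 = 0"
      by (simp add: moments_0[of f, OF f0] vec_eq_iff forall_5 point1_nth zero_prod_def)
    show "abs_continuous_on_interval 0 T ?q1"
      unfolding point1_def m
      by (intro abs_continuous_add abs_continuous_scaleR_const ac acf acid)
    fix t assume t: "t \<in> {0..T} - S"
    have "(?q1 has_vector_derivative e *\<^sub>R axis 1 1 + w t *\<^sub>R axis 2 1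
        + ((e * t * w t - f t * e) / 2) *\<^sub>R axis 3 1 + (((e * t)\<^sup>2 + (f t)\<^sup>2) / 2 * w t) *\<^sub>R axis 4 1
        + (- (((e * t)\<^sup>2 + (f t)\<^sup>2) / 2 * e)) *\<^sub>R axis 5 1) (at t within {0..T})"
      unfolding point1_def m
      by (intro has_vector_derivative_add has_vector_derivative_scaleR_const d[OF t])
    moreover have "e *\<^sub>R axis 1 1 + w t *\<^sub>R axis 2 1
        + ((e * t * w t - f t * e) / 2) *\<^sub>R axis 3 1 + (((e * t)\<^sup>2 + (f t)\<^sup>2) / 2 * w t) *\<^sub>R axis 4 1
        + (- (((e * t)\<^sup>2 + (f t)\<^sup>2) / 2 * e)) *\<^sub>R axis 5 1
        = (?u1 t $ 1) *\<^sub>R X1 (?q1 t) + (?u1 t $ 2) *\<^sub>R X2 (?q1 t)"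
      unfolding vec_eq_iff forall_5 field_nth point1_nth m by (simp add: axis_nth_5 ax2)
    ultimately show "(?q1 has_vector_derivative (?u1 t $ 1) *\<^sub>R X1 (?q1 t) + (?u1 t $ 2) *\<^sub>R X2 (?q1 t))
        (at t within {0..T})" by simp
  qed
  show "point1 e (moments f T) \<in> attainable_sing T"
    unfolding attainable_sing_def
    by (intro CollectI exI[of _ ?q1] exI[of _ ?u1] conjI refl adm1 sing1 traj1)
  let ?u2 = "\<lambda>t. w t *\<^sub>R axis 1 1 + e *\<^sub>R axis 2 1 :: real ^ 2"
  let ?q2 = "\<lambda>t. point2 e (moments f t)"
  have adm2: "admissible_control T ?u2"
    unfolding admissible_control_def using w' w(2) e1
    by (auto simp: ax2 intro!: borel_measurable_add borel_measurable_scaleR borel_measurable_const)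
  have sing2: "singular_control T ?u2"
    unfolding singular_control_def using e by (intro exI[of _ 2]) (auto simp: ax2)
  have traj2: "trajectory T ?u2 ?q2"
    unfolding trajectory_def
  proof (intro conjI AE)
    show "?q2 0 = 0"
      by (simp add: moments_0[of f, OF f0] vec_eq_iff forall_5 point2_nth zero_prod_def)
    show "abs_continuous_on_interval 0 T ?q2"
      unfolding point2_def m
      by (intro abs_continuous_add abs_continuous_scaleR_const neg ac acf acid)
    fix t assume t: "t \<in> {0..T} - S"
    have "(?q2 has_vector_derivative w t *\<^sub>R axis 1 1 + e *\<^sub>R axis 2 1
        + (- ((e * t * w t - f t * e) / 2)) *\<^sub>R axis 3 1 + (- (- (((e * t)\<^sup>2 + (f t)\<^sup>2) / 2 * e))) *\<^sub>R axis 4 1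
        + (- (((e * t)\<^sup>2 + (f t)\<^sup>2) / 2 * w t)) *\<^sub>R axis 5 1) (at t within {0..T})"
      unfolding point2_def m
      by (intro has_vector_derivative_add has_vector_derivative_scaleR_const DERIV_minus d[OF t])
    moreover have "w t *\<^sub>R axis 1 1 + e *\<^sub>R axis 2 1
        + (- ((e * t * w t - f t * e) / 2)) *\<^sub>R axis 3 1 + (- (- (((e * t)\<^sup>2 + (f t)\<^sup>2) / 2 * e))) *\<^sub>R axis 4 1
        + (- (((e * t)\<^sup>2 + (f t)\<^sup>2) / 2 * w t)) *\<^sub>R axis 5 1
        = (?u2 t $ 1) *\<^sub>R X1 (?q2 t) + (?u2 t $ 2) *\<^sub>R X2 (?q2 t)"
      unfolding vec_eq_iff forall_5 field_nth point2_nth m by (simp add: axis_nth_5 ax2 add.commute field_simps)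
    ultimately show "(?q2 has_vector_derivative (?u2 t $ 1) *\<^sub>R X1 (?q2 t) + (?u2 t $ 2) *\<^sub>R X2 (?q2 t))
        (at t within {0..T})" by simp
  qed
  show "point2 e (moments f T) \<in> attainable_sing T"
    unfolding attainable_sing_def
    by (intro CollectI exI[of _ ?q2] exI[of _ ?u2] conjI refl adm2 sing2 traj2)
qed

text \<open>The states between two polygonal ones that differ in \<open>C\<close> only. Recording
  the distances \<open>c\<close> and \<open>d\<close> to both turns this into a polynomial
  image.\<close>

definition moment_set :: "real \<Rightarrow> state set" where
  "moment_set T = (\<lambda>(st, c, d). add_last c st) ` {(st, c, d). st \<in> reach 26 \<and> fst st = T \<and> c \<ge> 0 \<and> d \<ge> 0
     \<and> add_last (c + d) st \<in> reach 26}"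

lemma semialgebraic_moment_set: "semialgebraic (moment_set T)"
proof -
  have add: "add_last c st = (fst st, fst (snd st), fst (snd (snd st)), fst (snd (snd (snd st))),
      snd (snd (snd (snd st))) + c)" for c st
    by (cases st) simp
  have poly: "polynomial_function (\<lambda>p :: state \<times> real \<times> real. add_last (fst (snd p)) (fst p))"
    "polynomial_function (\<lambda>p :: state \<times> real \<times> real. add_last (fst (snd p) + snd (snd p)) (fst p))"
    "polynomial_function (\<lambda>p :: state \<times> real \<times> real. fst p)"
    unfolding add by (intro polynomial_function_intros)+
  have real: "real_polynomial_function (\<lambda>p :: state \<times> real \<times> real. fst (fst p) - T)"
    "real_polynomial_function (\<lambda>p :: state \<times> real \<times> real. fst (snd p))"
    "real_polynomial_function (\<lambda>p :: state \<times> real \<times> real. snd (snd p))"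
    unfolding real_polynomial_function_eq by (intro polynomial_function_intros)+
  let ?S = "(\<lambda>p :: state \<times> real \<times> real. fst p) -` reach 26 \<inter> {p. fst (fst p) - T = 0}
      \<inter> {p. fst (snd p) \<ge> 0} \<inter> {p. snd (snd p) \<ge> 0}
      \<inter> (\<lambda>p. add_last (fst (snd p) + snd (snd p)) (fst p)) -` reach 26"
  have "semialgebraic ?S"
    by (intro semialgebraic.inter semialgebraic_vimage[OF semialgebraic_reach] poly semialgebraic_eq0
        semialgebraic_nonneg real)
  then have "semialgebraic ((\<lambda>p. add_last (fst (snd p)) (fst p)) ` ?S)"
    by (rule semialgebraic_image[OF _ poly(1)])
  moreover have "(\<lambda>p. add_last (fst (snd p)) (fst p)) ` ?S = moment_set T"
    unfolding moment_set_def case_prod_beta by (rule arg_cong2[where f = image]) auto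
  ultimately show ?thesis by simp
qed

lemma moments_in_moment_set:
  assumes "lip1 y" "y 0 = 0" "T > 0"
  shows "moments y T \<in> moment_set T"
proof -
  obtain c where c: "c \<ge> 0" "add_last (- c) (moments y T) \<in> reach 26"
    using moments_reach_below[OF assms] by blast
  obtain d where d: "d \<ge> 0" "add_last d (moments y T) \<in> reach 8"
    using moments_reach_above[OF assms] by blast
  have "add_last d (moments y T) \<in> reach 26" using d(2) reach_mono[of 8 26] by auto
  then have "(add_last (- c) (moments y T), c, d) \<in> {(st, c, d). st \<in> reach 26 \<and> fst st = T \<and> c \<ge> 0 \<and> d \<ge> 0
     \<and> add_last (c + d) st \<in> reach 26}"
    using c d(1) by (simp add: moments_def)
  then show ?thesis
    unfolding moment_set_def by (rule rev_image_eqI) simp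
qed

lemma moment_set_realized:
  assumes "p \<in> moment_set T"
  shows "\<exists>h. piecewise_C1_lip1 h \<and> moments h T = p"
proof -
  obtain st c d where *: "p = add_last c st" "st \<in> reach 26" "fst st = T" "c \<ge> 0" "d \<ge> 0"
    "add_last (c + d) st \<in> reach 26"
    using assms unfolding moment_set_def by auto
  obtain Y A B C where st: "st = (T, Y, A, B, C)" using *(3) by (cases st) auto
  obtain f where f: "piecewise_C1_lip1 f" "moments f T = (T, Y, A, B, C)"
    using reach_realized[OF *(2)] unfolding st by auto
  obtain g where g: "piecewise_C1_lip1 g" "moments g T = (T, Y, A, B, C + (c + d))"
    using reach_realized[OF *(6)] unfolding st by auto
  show ?thesis
    using moments_intermediate[OF f(1) g(1) f(2) g(2), of "C + c"] *(4,5) unfolding *(1) st by auto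
qed

theorem corollary4:
  fixes T :: real
  assumes "T > 0"
  shows "semialgebraic (attainable_sing T)"
proof -
  have "attainable_sing T = (\<Union>e\<in>{1, -1}. point1 e ` moment_set T \<union> point2 e ` moment_set T)"
  proof (intro set_eqI iffI)
    fix p assume "p \<in> attainable_sing T"
    then obtain e y where y: "e = 1 \<or> e = -1" "lip1 y" "y 0 = 0"
      "p = point1 e (moments y T) \<or> p = point2 e (moments y T)"
      using attainable_sing_forward[OF assms] by blast
    have "moments y T \<in> moment_set T" using moments_in_moment_set[OF y(2,3) assms] .
    then show "p \<in> (\<Union>e\<in>{1, -1}. point1 e ` moment_set T \<union> point2 e ` moment_set T)"
      using y(1,4) by blast
  next
    fix p assume "p \<in> (\<Union>e\<in>{1, -1}. point1 e ` moment_set T \<union> point2 e ` moment_set T)"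
    then obtain e st where e: "e = 1 \<or> e = -1" "st \<in> moment_set T" "p = point1 e st \<or> p = point2 e st"
      by blast
    obtain h where "piecewise_C1_lip1 h" "moments h T = st"
      using moment_set_realized[OF e(2)] by blast
    then show "p \<in> attainable_sing T"
      using attainable_sing_backward[OF assms e(1)] e(3) by blast
  qed
  moreover have "semialgebraic (\<Union>e\<in>{1, -1}. point1 e ` moment_set T \<union> point2 e ` moment_set T)"
    by (intro semialgebraic_UN semialgebraic.union semialgebraic_image semialgebraic_moment_set
        polynomial_function_point1 polynomial_function_point2) simp
  ultimately show ?thesis by simp
qed

end
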